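(* Fix three connected, rigid and mutually incomparable graphs $I_0,I_1,I_2$, an integer $c_{\max}>\max\{|V(I_0)|,|V(I_1)|,|V(I_2)|\}$, two distinct vertices $v^0_\ell,v^0_r$ of $I_0$, and three distinct vertices $v^i_\ell,v^i_r,v^i_p$ of $I_i$ for $i=1,2$. For $m$ a power of 2, let $G_m$ be the graph obtained from the complete binary tree with $m$ leaves as follows: replace the root by a copy of $I_0$, and replace all nodes of level $d\ge1$ by copies of $I_1$ if $d$ is odd and of $I_2$ if $d$ is even; for each tree node labelled $I_i$ with children labelled $I_j$, add an edge between $v^i_\ell$ (in the parent) and $v^j_p$ (in the left child), and an edge between $v^i_r$ (in the parent) and $v^j_p$ (in the right child); finally expand each such added edge into a simple path with $c_{\max}$ vertices on it. Let $H_m$ be the undirected complete graph on $m^6$ vertices. Then over any field, the family $(f_m)$ with $f_m(\bar Y)=f_{G_m,H_m}(\bar Y)$ is complete for $\mathsf{VP}$ under $p$-projections.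
   Context: A graph is rigid if its only homomorphism to itself is the identity; two graphs are incomparable if there is no homomorphism in either direction (homomorphism: vertex map preserving edges). For graphs $G,H$, with a variable $Y_{(a,b)}$ for each edge $(a,b)\in E(H)$, the homomorphism polynomial is $f_{G,H}(\bar Y)=\sum_{\phi}\prod_{(u,v)\in E(G)}Y_{(\phi(u),\phi(v))}$, the sum over all homomorphisms $\phi:G\to H$. $\mathsf{VP}$ is the class of $p$-families (polynomially bounded number of variables and degree) computed by polynomial-size arithmetic circuits. A polynomial $f$ is a projection of $g$ if obtained by substituting field constants or variables of $f$ for the variables of $g$; $(f_n)$ is a $p$-projection of $(g_m)$ if each $f_n$ is a projection of $g_{t(n)}$ with $t$ polynomially bounded. Complete for $\mathsf{VP}$ under $p$-projections means the family is in $\mathsf{VP}$ and every family in $\mathsf{VP}$ is a $p$-projection of it. *)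

theory Defs
  imports Main "HOL-Library.Poly_Mapping" "HOL-Library.FuncSet"
begin

type_synonym ('x, 'a) mpoly = "('x \<Rightarrow>\<^sub>0 nat) \<Rightarrow>\<^sub>0 'a"

definition mvar :: "'x \<Rightarrow> ('x, 'a::comm_ring_1) mpoly" where
  "mvar x = Poly_Mapping.single (Poly_Mapping.single x 1) 1"

definition mconst :: "'a \<Rightarrow> ('x, 'a::comm_ring_1) mpoly" where
  "mconst c = Poly_Mapping.single 0 c"

definition mvars :: "('x, 'a::zero) mpoly \<Rightarrow> 'x set" where
  "mvars p = \<Union> (Poly_Mapping.keys ` Poly_Mapping.keys p)"

definition mdegree :: "('x, 'a::zero) mpoly \<Rightarrow> nat" where
  "mdegree p = Max (insert 0 ((\<lambda>m. sum (Poly_Mapping.lookup m) (Poly_Mapping.keys m)) ` Poly_Mapping.keys p))"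

definition msubst :: "('x \<Rightarrow> ('y, 'a::comm_ring_1) mpoly) \<Rightarrow> ('x, 'a) mpoly \<Rightarrow> ('y, 'a) mpoly" where
  "msubst s p = (\<Sum>m\<in>Poly_Mapping.keys p. mconst (Poly_Mapping.lookup p m) * (\<Prod>x\<in>Poly_Mapping.keys m. s x ^ Poly_Mapping.lookup m x))"

definition is_projection :: "('y, 'a::comm_ring_1) mpoly \<Rightarrow> ('x, 'a) mpoly \<Rightarrow> bool" where
  "is_projection f g \<longleftrightarrow> (\<exists>\<sigma> :: 'x \<Rightarrow> 'a + 'y.
      msubst (\<lambda>x. case \<sigma> x of Inl c \<Rightarrow> mconst c | Inr y \<Rightarrow> mvar y) g = f)"

datatype ('a, 'x) gate = GIn 'x | GConst 'a | GAdd nat nat | GMul nat nat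

fun gate_val :: "('x, 'a::comm_ring_1) mpoly list \<Rightarrow> ('a, 'x) gate \<Rightarrow> ('x, 'a) mpoly" where
  "gate_val vs (GIn x) = mvar x"
| "gate_val vs (GConst c) = mconst c"
| "gate_val vs (GAdd i j) = vs ! i + vs ! j"
| "gate_val vs (GMul i j) = vs ! i * vs ! j"

definition circ_vals :: "('a::comm_ring_1, 'x) gate list \<Rightarrow> ('x, 'a) mpoly list" where
  "circ_vals C = foldl (\<lambda>vs g. vs @ [gate_val vs g]) [] C"

fun gate_ok :: "nat \<Rightarrow> ('a, 'x) gate \<Rightarrow> bool" where
  "gate_ok k (GAdd i j) \<longleftrightarrow> i < k \<and> j < k"
| "gate_ok k (GMul i j) \<longleftrightarrow> i < k \<and> j < k"
| "gate_ok k _ \<longleftrightarrow> True"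

definition circ_computes :: "('a::comm_ring_1, 'x) gate list \<Rightarrow> ('x, 'a) mpoly \<Rightarrow> bool" where
  "circ_computes C p \<longleftrightarrow> C \<noteq> [] \<and> (\<forall>k < length C. gate_ok k (C ! k)) \<and> last (circ_vals C) = p"

definition poly_bounded :: "(nat \<Rightarrow> nat) \<Rightarrow> bool" where
  "poly_bounded t \<longleftrightarrow> (\<exists>c k. \<forall>n. t n \<le> c * n ^ k + c)"

definition in_VP_on :: "(nat \<Rightarrow> bool) \<Rightarrow> (nat \<Rightarrow> ('x, 'a::comm_ring_1) mpoly) \<Rightarrow> bool" where
  "in_VP_on P f \<longleftrightarrow> (\<exists>q. poly_bounded q \<and> (\<forall>n. P n \<longrightarrow>
      finite (mvars (f n)) \<and> card (mvars (f n)) \<le> q n \<and> mdegree (f n) \<le> q n \<and>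
      (\<exists>C. circ_computes C (f n) \<and> length C \<le> q n)))"

abbreviation in_VP :: "(nat \<Rightarrow> ('x, 'a::comm_ring_1) mpoly) \<Rightarrow> bool" where
  "in_VP f \<equiv> in_VP_on (\<lambda>_. True) f"

definition p_projection_on :: "(nat \<Rightarrow> bool) \<Rightarrow> (nat \<Rightarrow> ('y, 'a::comm_ring_1) mpoly)
     \<Rightarrow> (nat \<Rightarrow> ('x, 'a) mpoly) \<Rightarrow> bool" where
  "p_projection_on P f g \<longleftrightarrow> (\<exists>t. poly_bounded t \<and> (\<forall>n. P (t n) \<and> is_projection (f n) (g (t n))))"

definition VP_complete_on :: "(nat \<Rightarrow> bool) \<Rightarrow> (nat \<Rightarrow> ('x, 'a::comm_ring_1) mpoly) \<Rightarrow> bool" where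
  "VP_complete_on P g \<longleftrightarrow> in_VP_on P g \<and>
     (\<forall>f :: nat \<Rightarrow> (nat, 'a) mpoly. in_VP f \<longrightarrow> p_projection_on P f g)"

type_synonym 'v graph = "'v set \<times> 'v set set"

definition V :: "'v graph \<Rightarrow> 'v set" where "V G = fst G"
definition E :: "'v graph \<Rightarrow> 'v set set" where "E G = snd G"

definition wf_graph :: "'v graph \<Rightarrow> bool" where
  "wf_graph G \<longleftrightarrow> finite (V G) \<and> (\<forall>e\<in>E G. \<exists>a b. a \<noteq> b \<and> e = {a, b} \<and> a \<in> V G \<and> b \<in> V G)"

definition connected_graph :: "'v graph \<Rightarrow> bool" where
  "connected_graph G \<longleftrightarrow> V G \<noteq> {} \<and>
     (\<forall>a\<in>V G. \<forall>b\<in>V G. (\<lambda>x y. {x, y} \<in> E G)\<^sup>*\<^sup>* a b)"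

definition is_hom :: "'v graph \<Rightarrow> 'w graph \<Rightarrow> ('v \<Rightarrow> 'w) \<Rightarrow> bool" where
  "is_hom G H \<phi> \<longleftrightarrow> (\<forall>v\<in>V G. \<phi> v \<in> V H) \<and> (\<forall>e\<in>E G. \<phi> ` e \<in> E H)"

definition rigid :: "'v graph \<Rightarrow> bool" where
  "rigid G \<longleftrightarrow> (\<forall>\<phi>. is_hom G G \<phi> \<longrightarrow> (\<forall>v\<in>V G. \<phi> v = v))"

definition incomparable :: "'v graph \<Rightarrow> 'w graph \<Rightarrow> bool" where
  "incomparable G H \<longleftrightarrow> \<not> (\<exists>\<phi>. is_hom G H \<phi>) \<and> \<not> (\<exists>\<psi>. is_hom H G \<psi>)"

definition hom_poly :: "'v graph \<Rightarrow> 'w graph \<Rightarrow> ('w set, 'a::comm_ring_1) mpoly" where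
  "hom_poly G H = (\<Sum>\<phi> \<in> {\<phi> \<in> V G \<rightarrow>\<^sub>E V H. is_hom G H \<phi>}. \<Prod>e\<in>E G. mvar (\<phi> ` e))"

text \<open>Tree nodes of the complete binary tree with m leaves are numbered heap-style
  1 .. 2m-1 (root 1, children of k are 2k and 2k+1); level of k is floor(log2 k).\<close>
fun level :: "nat \<Rightarrow> nat" where
  "level k = (if k \<le> 1 then 0 else Suc (level (k div 2)))"

definition lab :: "nat \<Rightarrow> nat" where
  "lab k = (if k = 1 then 0 else if odd (level k) then 1 else 2)"

datatype 'v gvert = TV nat 'v | PV nat nat

text \<open>PV k j (1 \<le> j \<le> c) are the c new vertices of the path joining node k (k \<ge> 2)
  to its parent k div 2.\<close>
definition Gm :: "(nat \<Rightarrow> 'v graph) \<Rightarrow> (nat \<Rightarrow> 'v) \<Rightarrow> (nat \<Rightarrow> 'v) \<Rightarrow> (nat \<Rightarrow> 'v)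
     \<Rightarrow> nat \<Rightarrow> nat \<Rightarrow> 'v gvert graph" where
  "Gm I vl vr vp c m =
    ({TV k x | k x. k \<in> {1..<2*m} \<and> x \<in> V (I (lab k))} \<union>
     {PV k j | k j. k \<in> {2..<2*m} \<and> j \<in> {1..c}},
     {TV k ` e | k e. k \<in> {1..<2*m} \<and> e \<in> E (I (lab k))} \<union>
     {{TV (k div 2) (if even k then vl (lab (k div 2)) else vr (lab (k div 2))), PV k 1}
        | k. k \<in> {2..<2*m}} \<union>
     {{PV k j, PV k (Suc j)} | k j. k \<in> {2..<2*m} \<and> j \<in> {1..<c}} \<union>
     {{PV k c, TV k (vp (lab k))} | k. k \<in> {2..<2*m}})"

definition Hm :: "nat \<Rightarrow> nat graph" where
  "Hm m = ({..<m^6}, {{a, b} | a b. a < m^6 \<and> b < m^6 \<and> a \<noteq> b})"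

end

theory Submission
  imports Defs "HOL-Computational_Algebra.Polynomial"
begin

text \<open>Membership in VP: a homomorphism sum over a tree of constant-size blocks is evaluated by
  dynamic programming, whose states are the polynomially many maps of one block.

  Hardness: homogenizing a circuit gives a weighted grammar in Chomsky normal form whose derivations
  from a nonterminal, counted by their number of leaves, sum up to the homogeneous components.
  Following the heavy path of every derivation, as in the depth reduction of Valiant, Skyum,
  Berkowitz and Rackoff, yields logarithmically many layers in which every node is a product of two
  linear combinations of nodes of the next layer. Such a form is realised as a target graph: a node
  becomes a copy of one of the rigid graphs, a coefficient becomes the weight of a path between two
  copies. By rigidity and incomparability every homomorphism maps each copy in \<open>G\<^sub>m\<close> identically onto
  a copy in the target, and then the connecting paths must go from a layer to the next one, so that
  the homomorphism sum is the expansion of the layered form.\<close>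

subsection \<open>Polynomials\<close>

text \<open>The graph \<open>G\<^sub>m\<close> dictates the normal form: the leaves of its tree all
  have the same depth, so a form must have exactly \<open>log m\<close> layers of binary products,
  and shorter ones are padded. A heavy path can be long, so it is not followed node by node but cut,
  and the contexts between two of its nodes become nodes of the form as well. Trees and contexts
  double their sizes in turn, trees one doubling ahead, since cutting a context can split off a
  light tree of nearly the degree that the context misses. A cut yields three factors, hence two
  layers, and doubling both kinds costs four.

  On the graph side a copy could be folded into paths, and a path could turn back. The former is
  excluded because a connected rigid graph with two vertices has no vertex of degree one: a path
  vertex can be folded back in two ways, while rigidity makes both the identity. The latter is
  excluded because all paths have equal length, consecutive labels differ and the ports are
  distinct. A label of a non-root copy only gives the parity of its layer; the layer itself is
  propagated from the root, whose label occurs once.\<close>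

abbreviation mon_degree :: "('x \<Rightarrow>\<^sub>0 nat) \<Rightarrow> nat" where
  "mon_degree m \<equiv> sum (Poly_Mapping.lookup m) (Poly_Mapping.keys m)"

lemma mon_degree_superset:
  assumes "finite A" "Poly_Mapping.keys m \<subseteq> A"
  shows "mon_degree m = sum (Poly_Mapping.lookup m) A"
  using assms by (intro sum.mono_neutral_left) (auto simp: in_keys_iff)

lemma mon_degree_add: "mon_degree (m + m') = mon_degree m + mon_degree m'"
proof -
  let ?A = "Poly_Mapping.keys m \<union> Poly_Mapping.keys m'"
  have "mon_degree (m + m') = sum (Poly_Mapping.lookup (m + m')) ?A"
    by (rule mon_degree_superset) (auto dest: subsetD[OF Poly_Mapping.keys_add])
  also have "\<dots> = sum (Poly_Mapping.lookup m) ?A + sum (Poly_Mapping.lookup m') ?A"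
    by (simp add: Poly_Mapping.lookup_add sum.distrib)
  also have "\<dots> = mon_degree m + mon_degree m'"
    by (simp add: mon_degree_superset[of ?A m, symmetric] mon_degree_superset[of ?A m', symmetric])
  finally show ?thesis .
qed

lemma mon_degree_sum: "mon_degree (sum g A) = (\<Sum>a\<in>A. mon_degree (g a))"
  by (induction A rule: infinite_finite_induct) (simp_all add: mon_degree_add)

lemma mon_degree_eq_0_iff: "mon_degree m = 0 \<longleftrightarrow> m = 0"
  by (auto simp: in_keys_iff intro: poly_mapping_eqI)

lemma mconst_0 [simp]: "mconst 0 = 0"
  and mconst_1 [simp]: "mconst 1 = 1"
  and mconst_add: "mconst (a + b) = mconst a + mconst b"
  and mconst_mult: "mconst (a * b) = mconst a * mconst b"
  by (simp_all add: mconst_def single_add mult_single)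

lemma mconst_sum: "mconst (sum f A) = (\<Sum>a\<in>A. mconst (f a))"
  by (induction A rule: infinite_finite_induct) (simp_all add: mconst_add)

lemma prod_mvar:
  "(\<Prod>a\<in>A. mvar (g a) :: ('x, 'a::comm_ring_1) mpoly)
     = Poly_Mapping.single (\<Sum>a\<in>A. Poly_Mapping.single (g a) 1) 1"
  by (induction A rule: infinite_finite_induct) (simp_all add: mvar_def mult_single)

section \<open>Substitution into polynomials\<close>

definition mon_subst :: "('x \<Rightarrow> 'b::comm_ring_1) \<Rightarrow> ('x \<Rightarrow>\<^sub>0 nat) \<Rightarrow> 'b" where
  "mon_subst s m = (\<Prod>x\<in>Poly_Mapping.keys m. s x ^ Poly_Mapping.lookup m x)"

lemma mon_subst_superset:
  assumes "finite A" "Poly_Mapping.keys m \<subseteq> A"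
  shows "mon_subst s m = (\<Prod>x\<in>A. s x ^ Poly_Mapping.lookup m x)"
  unfolding mon_subst_def
  using assms by (intro prod.mono_neutral_left) (auto simp: in_keys_iff)

lemma mon_subst_add: "mon_subst s (m + m') = mon_subst s m * mon_subst s m'"
proof -
  let ?A = "Poly_Mapping.keys m \<union> Poly_Mapping.keys m'"
  have "mon_subst s (m + m') = (\<Prod>x\<in>?A. s x ^ Poly_Mapping.lookup (m + m') x)"
    by (rule mon_subst_superset) (auto dest: subsetD[OF Poly_Mapping.keys_add])
  also have "\<dots> = mon_subst s m * mon_subst s m'"
    by (simp add: Poly_Mapping.lookup_add power_add prod.distrib
        mon_subst_superset[of ?A m, symmetric] mon_subst_superset[of ?A m', symmetric])
  finally show ?thesis .
qed

lemma mon_subst_sum_single: "mon_subst s (\<Sum>a\<in>A. Poly_Mapping.single (g a) 1) = (\<Prod>a\<in>A. s (g a))"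
  by (induction A rule: infinite_finite_induct) (simp_all add: mon_subst_add, simp_all add: mon_subst_def)

lemma msubst_superset:
  assumes "finite A" "Poly_Mapping.keys p \<subseteq> A"
  shows "msubst s p = (\<Sum>m\<in>A. mconst (Poly_Mapping.lookup p m) * mon_subst s m)"
  unfolding msubst_def mon_subst_def
  using assms by (intro sum.mono_neutral_left) (auto simp: in_keys_iff)

lemma msubst_add: "msubst s (p + q) = msubst s p + msubst s q"
proof -
  let ?A = "Poly_Mapping.keys p \<union> Poly_Mapping.keys q"
  have "msubst s (p + q) = (\<Sum>m\<in>?A. mconst (Poly_Mapping.lookup (p + q) m) * mon_subst s m)"
    by (rule msubst_superset) (auto dest: subsetD[OF Poly_Mapping.keys_add])
  also have "\<dots> = msubst s p + msubst s q"
    by (simp add: Poly_Mapping.lookup_add mconst_add algebra_simps sum.distrib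
        msubst_superset[of ?A p] msubst_superset[of ?A q])
  finally show ?thesis .
qed

lemma msubst_sum: "msubst s (sum f A) = (\<Sum>a\<in>A. msubst s (f a))"
  by (induction A rule: infinite_finite_induct) (simp_all add: msubst_add, simp_all add: msubst_def)

lemma msubst_prod_mvar: "msubst s (\<Prod>a\<in>A. mvar (g a)) = (\<Prod>a\<in>A. s (g a))"
proof -
  let ?m = "\<Sum>a\<in>A. Poly_Mapping.single (g a) (1::nat)"
  have "msubst s (\<Prod>a\<in>A. mvar (g a)) = (\<Sum>m\<in>{?m}. mconst (Poly_Mapping.lookup (Poly_Mapping.single ?m 1) m) * mon_subst s m)"
    unfolding prod_mvar by (rule msubst_superset) auto
  then show ?thesis using mon_subst_sum_single[of s g A] by simp
qed

lemma keys_sum_subset: "Poly_Mapping.keys (sum f A) \<subseteq> (\<Union>a\<in>A. Poly_Mapping.keys (f a))"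
proof (induction A rule: infinite_finite_induct)
  case (insert x A)
  then show ?case using Poly_Mapping.keys_add[of "f x" "sum f A"] by auto
qed auto

section \<open>Homogeneous polynomials\<close>

definition homogeneous :: "nat \<Rightarrow> ('x, 'a::comm_ring_1) mpoly \<Rightarrow> bool" where
  "homogeneous i p \<longleftrightarrow> (\<forall>m\<in>Poly_Mapping.keys p. mon_degree m = i)"

lemma homogeneous_0 [simp]: "homogeneous i 0"
  by (simp add: homogeneous_def)

lemma homogeneous_add: "homogeneous i p \<Longrightarrow> homogeneous i q \<Longrightarrow> homogeneous i (p + q)"
  using Poly_Mapping.keys_add[of p q] unfolding homogeneous_def by blast

lemma homogeneous_sum: "(\<And>a. a \<in> A \<Longrightarrow> homogeneous i (f a)) \<Longrightarrow> homogeneous i (sum f A)"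
  using keys_sum_subset[of f A] unfolding homogeneous_def by blast

lemma homogeneous_mult: "homogeneous i p \<Longrightarrow> homogeneous j q \<Longrightarrow> homogeneous (i + j) (p * q)"
  using Poly_Mapping.keys_mult[of p q] unfolding homogeneous_def
  by (fastforce simp: mon_degree_add)

lemma homogeneous_mvar: "homogeneous 1 (mvar x)"
  by (simp add: homogeneous_def mvar_def)

lemma homogeneous_mconst: "homogeneous 0 (mconst a)"
  by (auto simp: homogeneous_def mconst_def)

lemma homogeneous_0_imp_mconst:
  assumes "homogeneous 0 p" shows "\<exists>a. p = mconst a"
proof
  have "Poly_Mapping.lookup p m = 0" if "m \<noteq> 0" for m
    using assms that unfolding homogeneous_def by (metis in_keys_iff mon_degree_eq_0_iff)
  then show "p = mconst (Poly_Mapping.lookup p 0)"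
    unfolding mconst_def by (intro poly_mapping_eqI) (auto simp: lookup_single when_def)
qed

lemma mdegree_le_iff: "mdegree p \<le> d \<longleftrightarrow> (\<forall>m\<in>Poly_Mapping.keys p. mon_degree m \<le> d)"
  by (auto simp: mdegree_def)

text \<open>A small circuit can have exponential formal degree \<open>k\<close> although
  \<open>f\<close> has degree at most \<open>d\<close>. The excess \<open>r\<close> has only
  monomials of degree above \<open>d\<close>, but it is a difference of polynomials of degree at
  most \<open>d\<close>, so it vanishes.\<close>

lemma homogeneous_components_truncate:
  assumes "mdegree f \<le> d" "f = (\<Sum>i\<le>k. F i)" "\<And>i. homogeneous i (F i)"
    and "\<And>i. k < i \<Longrightarrow> F i = 0"
  shows "f = (\<Sum>i\<le>d. F i)"
proof -
  have f: "f = (\<Sum>i\<le>max k d. F i)"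
    unfolding assms(2) by (rule sum.mono_neutral_left) (use assms(4) in auto)
  have split: "{..max k d} = {..d} \<union> {d<..max k d}" by auto
  define r where "r = (\<Sum>i\<in>{d<..max k d}. F i)"
  have fr: "f = (\<Sum>i\<le>d. F i) + r"
    unfolding f split r_def by (rule sum.union_disjoint) auto
  have "Poly_Mapping.keys r \<subseteq> Poly_Mapping.keys f \<union> Poly_Mapping.keys (\<Sum>i\<le>d. F i)"
    using keys_diff[of f "\<Sum>i\<le>d. F i"] fr by auto
  moreover have "\<forall>m\<in>Poly_Mapping.keys f. mon_degree m \<le> d"
    using assms(1) by (simp add: mdegree_le_iff)
  moreover have "\<forall>m\<in>Poly_Mapping.keys (\<Sum>i\<le>d. F i). mon_degree m \<le> d"
    using keys_sum_subset[of F "{..d}"] assms(3) unfolding homogeneous_def by fastforce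
  moreover have "\<forall>m\<in>Poly_Mapping.keys r. d < mon_degree m"
    using keys_sum_subset[of F "{d<..max k d}"] assms(3) unfolding homogeneous_def r_def by fastforce
  ultimately have "Poly_Mapping.keys r = {}" by fastforce
  then have "r = 0" by simp
  with fr show ?thesis by simp
qed

subsection \<open>Polynomially bounded functions\<close>

lemma poly_bounded_mono: "poly_bounded t \<Longrightarrow> (\<And>n. s n \<le> t n) \<Longrightarrow> poly_bounded s"
  unfolding poly_bounded_def by (meson order_trans)

text \<open>Bounds of the shape \<open>c * (n + 1) ^ k\<close> are closed under sums and products
  without an exception at \<open>n = 0\<close>.\<close>

lemma poly_boundedI: "(\<And>n. t n \<le> c * (n + 1) ^ k) \<Longrightarrow> poly_bounded t"
proof -
  assume t: "\<And>n. t n \<le> c * (n + 1) ^ k"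
  have "(n + 1) ^ k \<le> 2 ^ k * n ^ k + 1" for n :: nat
  proof (cases "n = 0")
    case False
    then have "(n + 1) ^ k \<le> (2 * n) ^ k" by (intro power_mono) auto
    then show ?thesis by (simp add: power_mult_distrib)
  qed simp
  then have "t n \<le> c * 2 ^ k * n ^ k + c * 2 ^ k" for n
    using mult_le_mono2[of "(n + 1) ^ k" "2 ^ k * n ^ k + 1" c] t[of n]
    by (smt (verit, best) One_nat_def add_left_mono distrib_left le_trans mult.assoc mult_le_mono2 nat_mult_1_right one_le_numeral one_le_power)
  then show ?thesis unfolding poly_bounded_def by blast
qed

lemma poly_boundedE:
  assumes "poly_bounded t" obtains c k where "\<And>n. t n \<le> c * (n + 1) ^ k"
proof -
  from assms obtain c k where ck: "\<And>n. t n \<le> c * n ^ k + c" unfolding poly_bounded_def by blast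
  have "t n \<le> 2 * c * (n + 1) ^ k" for n
  proof -
    have "n ^ k \<le> (n + 1) ^ k" "1 \<le> (n + 1) ^ k" by (auto intro: power_mono)
    then have "c * n ^ k + c * 1 \<le> c * (n + 1) ^ k + c * (n + 1) ^ k" by (intro add_mono mult_le_mono2)
    then show ?thesis using ck[of n] by simp
  qed
  then show thesis by (rule that)
qed

lemma poly_bounded_const: "poly_bounded (\<lambda>_. a)"
  by (rule poly_boundedI[of _ a 0]) simp

lemma poly_bounded_id: "poly_bounded (\<lambda>n. n)"
  by (rule poly_boundedI[of _ 1 1]) simp

lemma poly_bounded_mult: assumes "poly_bounded s" "poly_bounded t" shows "poly_bounded (\<lambda>n. s n * t n)"
proof -
  obtain c k where s: "\<And>n. s n \<le> c * (n + 1) ^ k" using poly_boundedE[OF assms(1)] by blast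
  obtain c' k' where t: "\<And>n. t n \<le> c' * (n + 1) ^ k'" using poly_boundedE[OF assms(2)] by blast
  have "s n * t n \<le> (c * c') * (n + 1) ^ (k + k')" for n
    using mult_le_mono[OF s[of n] t[of n]] by (simp add: power_add mult_ac)
  then show ?thesis by (rule poly_boundedI)
qed

lemma poly_bounded_add: assumes "poly_bounded s" "poly_bounded t" shows "poly_bounded (\<lambda>n. s n + t n)"
proof -
  obtain c k where s: "\<And>n. s n \<le> c * (n + 1) ^ k" using poly_boundedE[OF assms(1)] by blast
  obtain c' k' where t: "\<And>n. t n \<le> c' * (n + 1) ^ k'" using poly_boundedE[OF assms(2)] by blast
  have "s n + t n \<le> (c + c') * (n + 1) ^ (k + k')" for n
  proof -
    have "(n + 1) ^ k \<le> (n + 1) ^ (k + k')" "(n + 1) ^ k' \<le> (n + 1) ^ (k + k')"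
      by (auto intro!: power_increasing)
    then have "s n \<le> c * (n + 1) ^ (k + k')" "t n \<le> c' * (n + 1) ^ (k + k')"
      using s[of n] t[of n] by (meson mult_le_mono2 order_trans)+
    then show ?thesis by (simp add: distrib_right)
  qed
  then show ?thesis by (rule poly_boundedI)
qed

lemma poly_bounded_power: "poly_bounded s \<Longrightarrow> poly_bounded (\<lambda>n. s n ^ k)"
  by (induction k) (auto intro: poly_bounded_mult poly_bounded_const)

lemmas poly_bounded_intros =
  poly_bounded_const poly_bounded_id poly_bounded_mult poly_bounded_add poly_bounded_power

subsection \<open>Straight-line computations\<close>

definition valid_circ :: "('a, 'x) gate list \<Rightarrow> bool" where
  "valid_circ C \<longleftrightarrow> (\<forall>k<length C. gate_ok k (C ! k))"

lemma circ_vals_Nil [simp]: "circ_vals [] = []"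
  by (simp add: circ_vals_def)

lemma circ_vals_snoc [simp]: "circ_vals (C @ [g]) = circ_vals C @ [gate_val (circ_vals C) g]"
  by (simp add: circ_vals_def)

lemma length_circ_vals [simp]: "length (circ_vals C) = length C"
  by (induction C rule: rev_induct) auto

lemma gate_val_append: "gate_ok (length vs) g \<Longrightarrow> gate_val (vs @ ws) g = gate_val vs g"
  by (cases g) (auto simp: nth_append)

lemma valid_circ_snoc: "valid_circ (C @ [g]) \<longleftrightarrow> valid_circ C \<and> gate_ok (length C) g"
  by (auto simp: valid_circ_def nth_append less_Suc_eq)

lemma gate_ok_mono: "gate_ok k g \<Longrightarrow> k \<le> l \<Longrightarrow> gate_ok l g"
  by (cases g) auto

lemma circ_vals_nth:
  "valid_circ C \<Longrightarrow> k < length C \<Longrightarrow> circ_vals C ! k = gate_val (circ_vals C) (C ! k)"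
proof (induction C rule: rev_induct)
  case (snoc g C)
  from snoc.prems have ok: "valid_circ C" "gate_ok (length C) g"
    by (auto simp: valid_circ_snoc)
  show ?case
  proof (cases "k < length C")
    case True
    then have "gate_ok (length (circ_vals C)) (C ! k)"
      using ok(1) by (auto simp: valid_circ_def intro: gate_ok_mono)
    with True snoc.IH[OF ok(1)] show ?thesis
      by (simp add: nth_append gate_val_append)
  next
    case False
    with snoc.prems have "k = length C" by simp
    with ok(2) show ?thesis by (simp add: nth_append gate_val_append)
  qed
qed simp

definition computable_within :: "('x, 'a::comm_ring_1) mpoly set \<Rightarrow> nat \<Rightarrow> bool" where
  "computable_within S n \<longleftrightarrow> (\<exists>C. valid_circ C \<and> length C \<le> n \<and> S \<subseteq> set (circ_vals C))"

text \<open>The cost of \<open>T\<close> relative to \<open>S\<close>. Quantifying over every larger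
  \<open>S'\<close> means that all values computed so far stay available, so that costs simply add
  up in \<open>slp_trans\<close>.\<close>

definition slp :: "('x, 'a::comm_ring_1) mpoly set \<Rightarrow> ('x, 'a) mpoly set \<Rightarrow> nat \<Rightarrow> bool" where
  "slp S T q \<longleftrightarrow> (\<forall>S' n. S \<subseteq> S' \<longrightarrow> computable_within S' n \<longrightarrow> computable_within (S' \<union> T) (n + q))"

lemma computable_within_mono:
  "computable_within S n \<Longrightarrow> S' \<subseteq> S \<Longrightarrow> n \<le> n' \<Longrightarrow> computable_within S' n'"
  unfolding computable_within_def by (meson order_trans)

lemma slp_mono: "slp S T q \<Longrightarrow> S \<subseteq> S1 \<Longrightarrow> T1 \<subseteq> T \<Longrightarrow> q \<le> q1 \<Longrightarrow> slp S1 T1 q1"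
proof (unfold slp_def, intro allI impI)
  fix S' n assume *: "\<forall>S' n. S \<subseteq> S' \<longrightarrow> computable_within S' n \<longrightarrow> computable_within (S' \<union> T) (n + q)"
    "S \<subseteq> S1" "T1 \<subseteq> T" "q \<le> q1" "S1 \<subseteq> S'" "computable_within S' n"
  then have "computable_within (S' \<union> T) (n + q)" by (meson order_trans)
  then show "computable_within (S' \<union> T1) (n + q1)"
    by (rule computable_within_mono) (use * in auto)
qed

lemma slp_subset: "T \<subseteq> S \<Longrightarrow> slp S T q"
proof (unfold slp_def, intro allI impI)
  fix S' n assume "T \<subseteq> S" "S \<subseteq> S'" "computable_within S' n"
  then show "computable_within (S' \<union> T) (n + q)" by (elim computable_within_mono) auto
qed

lemma slp_trans: "slp S T q \<Longrightarrow> slp (S \<union> T) U r \<Longrightarrow> slp S (T \<union> U) (q + r)"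
proof (unfold slp_def, intro allI impI)
  fix S' n assume *: "\<forall>S' n. S \<subseteq> S' \<longrightarrow> computable_within S' n \<longrightarrow> computable_within (S' \<union> T) (n + q)"
    "\<forall>S' n. S \<union> T \<subseteq> S' \<longrightarrow> computable_within S' n \<longrightarrow> computable_within (S' \<union> U) (n + r)"
    "S \<subseteq> S'" "computable_within S' n"
  then have "computable_within (S' \<union> T) (n + q)" by blast
  moreover have "S \<union> T \<subseteq> S' \<union> T" using *(3) by blast
  ultimately have "computable_within (S' \<union> T \<union> U) (n + q + r)" using *(2) by blast
  then show "computable_within (S' \<union> (T \<union> U)) (n + (q + r))" by (simp add: Un_assoc add.assoc)
qed

lemma slp_UN:
  assumes "finite X" "\<And>x. x \<in> X \<Longrightarrow> slp S (T x) q"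
  shows "slp S (\<Union>x\<in>X. T x) (card X * q)"
  using assms
proof (induction X rule: finite_induct)
  case empty
  then show ?case by (simp add: slp_subset)
next
  case (insert x X)
  have "slp S (T x \<union> (\<Union>x\<in>X. T x)) (q + card X * q)"
    by (rule slp_trans) (use insert in \<open>auto intro: slp_mono\<close>)
  with insert.hyps show ?case by simp
qed

lemma slp_gate:
  assumes "\<And>C. valid_circ C \<Longrightarrow> S \<subseteq> set (circ_vals C) \<Longrightarrow>
             \<exists>g. gate_ok (length C) g \<and> gate_val (circ_vals C) g = p"
  shows "slp S {p} 1"
  unfolding slp_def
proof (intro allI impI)
  fix S' n assume "S \<subseteq> S'" "computable_within S' n"
  then obtain C where C: "valid_circ C" "length C \<le> n" "S' \<subseteq> set (circ_vals C)"
    unfolding computable_within_def by blast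
  with assms[of C] \<open>S \<subseteq> S'\<close> obtain g where "gate_ok (length C) g" "gate_val (circ_vals C) g = p"
    by blast
  with C show "computable_within (S' \<union> {p}) (n + 1)"
    unfolding computable_within_def by (intro exI[of _ "C @ [g]"]) (auto simp: valid_circ_snoc)
qed

lemma slp_mvar: "slp S {mvar x} 1"
  by (rule slp_gate) (rule exI[of _ "GIn x"], simp)

lemma slp_mconst: "slp S {mconst a} 1"
  by (rule slp_gate) (rule exI[of _ "GConst a"], simp)

lemma slp_add: "p \<in> S \<Longrightarrow> q \<in> S \<Longrightarrow> slp S {p + q} 1"
proof (rule slp_gate)
  fix C assume "p \<in> S" "q \<in> S" "S \<subseteq> set (circ_vals C)"
  then obtain i j where "i < length C" "circ_vals C ! i = p" "j < length C" "circ_vals C ! j = q"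
    by (metis in_set_conv_nth length_circ_vals subsetD)
  then show "\<exists>g. gate_ok (length C) g \<and> gate_val (circ_vals C) g = p + q"
    by (intro exI[of _ "GAdd i j"]) simp
qed

lemma slp_mult: "p \<in> S \<Longrightarrow> q \<in> S \<Longrightarrow> slp S {p * q} 1"
proof (rule slp_gate)
  fix C assume "p \<in> S" "q \<in> S" "S \<subseteq> set (circ_vals C)"
  then obtain i j where "i < length C" "circ_vals C ! i = p" "j < length C" "circ_vals C ! j = q"
    by (metis in_set_conv_nth length_circ_vals subsetD)
  then show "\<exists>g. gate_ok (length C) g \<and> gate_val (circ_vals C) g = p * q"
    by (intro exI[of _ "GMul i j"]) simp
qed

lemma slp_sum: "finite A \<Longrightarrow> f ` A \<subseteq> S \<Longrightarrow> slp S {sum f A} (card A + 1)"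
proof (induction A rule: finite_induct)
  case empty
  then show ?case using slp_mconst[of S 0] by simp
next
  case (insert a A)
  then have "slp S ({sum f A} \<union> {f a + sum f A}) ((card A + 1) + 1)"
    by (intro slp_trans slp_add) auto
  then show ?case by (rule slp_mono) (use insert.hyps in auto)
qed

lemma slp_prod: "finite A \<Longrightarrow> f ` A \<subseteq> S \<Longrightarrow> slp S {prod f A} (card A + 1)"
proof (induction A rule: finite_induct)
  case empty
  then show ?case using slp_mconst[of S 1] by simp
next
  case (insert a A)
  then have "slp S ({prod f A} \<union> {f a * prod f A}) ((card A + 1) + 1)"
    by (intro slp_trans slp_mult) auto
  then show ?case by (rule slp_mono) (use insert.hyps in auto)
qed

lemma slp_imp_circ_computes:
  assumes "slp {} {p} q"
  obtains C where "circ_computes C p" "length C \<le> q + 2"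
proof -
  have "computable_within {} 0"
    unfolding computable_within_def by (intro exI[of _ "[]"]) (simp add: valid_circ_def)
  then have "computable_within ({} \<union> {p}) (0 + q)"
    using assms unfolding slp_def by blast
  then obtain C where C: "valid_circ C" "length C \<le> q" "p \<in> set (circ_vals C)"
    unfolding computable_within_def by auto
  then obtain i where i: "i < length C" "circ_vals C ! i = p"
    by (metis in_set_conv_nth length_circ_vals)
  \<comment> \<open>The output has to be the last gate; adding a zero copies gate \<open>i\<close>
    to the end.\<close>
  let ?C = "(C @ [GConst 0]) @ [GAdd i (length C)]"
  have "valid_circ ?C" unfolding valid_circ_snoc using C i by simp
  moreover have "last (circ_vals ?C) = p"
    unfolding circ_vals_snoc using i by (simp add: nth_append)
  ultimately have "circ_computes ?C p"
    by (simp add: circ_computes_def valid_circ_def del: circ_vals_snoc)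
  with C(2) show thesis by (intro that[of ?C]) auto
qed

subsection \<open>Sums over heap-indexed trees\<close>

text \<open>The sum over all state assignments to the subtree below \<open>k\<close> that give
  \<open>k\<close> the state \<open>x\<close>. The guard \<open>0 < k\<close> makes the recursion
  terminate, since 0 would be its own left child.\<close>

function tree_val :: "(nat \<Rightarrow> 's set) \<Rightarrow> (nat \<Rightarrow> 's \<Rightarrow> 'r::comm_semiring_1) \<Rightarrow> (nat \<Rightarrow> 's \<Rightarrow> 's \<Rightarrow> 'r)
    \<Rightarrow> nat \<Rightarrow> nat \<Rightarrow> 's \<Rightarrow> 'r" where
  "tree_val X w e m k x = w k x *
     (if 0 < k \<and> k < m
      then (\<Sum>y\<in>X (2 * k). e (2 * k) x y * tree_val X w e m (2 * k) y) *
           (\<Sum>y\<in>X (2 * k + 1). e (2 * k + 1) x y * tree_val X w e m (2 * k + 1) y)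
      else 1)"
  by auto
termination
  by (relation "measure (\<lambda>(X, w, e, m, k, x). 2 * m - k)") auto

declare tree_val.simps [simp del]

lemma sum_PiE_insert:
  assumes "x \<notin> S"
  shows "sum h (Pi\<^sub>E (insert x S) T) = (\<Sum>g\<in>Pi\<^sub>E S T. \<Sum>y\<in>T x. h (g(x := y)))"
proof -
  have inj: "inj_on (\<lambda>(y, g). g(x := y)) (T x \<times> Pi\<^sub>E S T)"
  proof (rule inj_onI, clarify)
    fix y g y' g'
    assume *: "g \<in> Pi\<^sub>E S T" "g' \<in> Pi\<^sub>E S T" "g(x := y) = g'(x := y')"
    then have "y = y'" by (metis fun_upd_same)
    moreover have "g = g'"
    proof (rule PiE_ext[OF *(1,2)])
      fix i assume "i \<in> S"
      with assms have "i \<noteq> x" by auto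
      then show "g i = g' i" using *(3) by (metis fun_upd_other)
    qed
    ultimately show "y = y' \<and> g = g'" by simp
  qed
  have "sum h (Pi\<^sub>E (insert x S) T) = (\<Sum>(y, g)\<in>T x \<times> Pi\<^sub>E S T. h (g(x := y)))"
    unfolding PiE_insert_eq by (subst sum.reindex[OF inj]) (simp add: case_prod_unfold)
  also have "\<dots> = (\<Sum>y\<in>T x. \<Sum>g\<in>Pi\<^sub>E S T. h (g(x := y)))"
    by (simp add: sum.cartesian_product)
  also have "\<dots> = (\<Sum>g\<in>Pi\<^sub>E S T. \<Sum>y\<in>T x. h (g(x := y)))"
    by (rule sum.swap)
  finally show ?thesis .
qed

text \<open>For every \<open>n \<ge> 1\<close>, not only for powers of two, the indices below
  \<open>2 * n\<close> form a tree whose inner nodes have two children. The tree can therefore be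
  pruned one pair of leaves at a time.\<close>

definition heap_sum :: "(nat \<Rightarrow> 's set) \<Rightarrow> (nat \<Rightarrow> 's \<Rightarrow> 'r::comm_semiring_1) \<Rightarrow> (nat \<Rightarrow> 's \<Rightarrow> 's \<Rightarrow> 'r)
    \<Rightarrow> nat \<Rightarrow> 'r" where
  "heap_sum X w e n = (\<Sum>\<Phi>\<in>Pi\<^sub>E {1..<2 * n} X.
     (\<Prod>k\<in>{1..<2 * n}. w k (\<Phi> k)) * (\<Prod>k\<in>{2..<2 * n}. e k (\<Phi> (k div 2)) (\<Phi> k)))"

text \<open>The last two indices are leaves and both children of \<open>n\<close>. Summing out their
  states first turns them into a factor of the weight of \<open>n\<close>.\<close>

lemma heap_sum_Suc:
  fixes w :: "nat \<Rightarrow> 's \<Rightarrow> 'r::comm_semiring_1"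
  assumes "n \<ge> 1"
  shows "heap_sum X w e (Suc n) = heap_sum X
     (w(n := \<lambda>x. w n x * ((\<Sum>y\<in>X (2 * n). e (2 * n) x y * w (2 * n) y) *
                           (\<Sum>y\<in>X (2 * n + 1). e (2 * n + 1) x y * w (2 * n + 1) y)))) e n"
proof -
  let ?W = "\<lambda>\<Phi>. \<Prod>k\<in>{1..<2 * n}. w k (\<Phi> k)"
  let ?L = "\<lambda>\<Phi>. \<Prod>k\<in>{2..<2 * n}. e k (\<Phi> (k div 2)) (\<Phi> k)"
  let ?l = "\<lambda>x. \<Sum>y\<in>X (2 * n). e (2 * n) x y * w (2 * n) y"
  let ?r = "\<lambda>x. \<Sum>y\<in>X (2 * n + 1). e (2 * n + 1) x y * w (2 * n + 1) y"
  have set1: "{1..<2 * Suc n} = insert (2 * n + 1) (insert (2 * n) {1..<2 * n})"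
    and set2: "{2..<2 * Suc n} = insert (2 * n + 1) (insert (2 * n) {2..<2 * n})"
    using assms by auto
  have split: "(\<Prod>k\<in>{1..<2 * Suc n}. w k ((\<Phi>(2 * n := y, 2 * n + 1 := z)) k)) *
      (\<Prod>k\<in>{2..<2 * Suc n}. e k ((\<Phi>(2 * n := y, 2 * n + 1 := z)) (k div 2)) ((\<Phi>(2 * n := y, 2 * n + 1 := z)) k)) =
      ?W \<Phi> * ?L \<Phi> * ((e (2 * n) (\<Phi> n) y * w (2 * n) y) * (e (2 * n + 1) (\<Phi> n) z * w (2 * n + 1) z))"
    for \<Phi> y z
  proof -
    let ?\<Phi> = "\<Phi>(2 * n := y, 2 * n + 1 := z)"
    have "(\<Prod>k\<in>{1..<2 * n}. w k (?\<Phi> k)) = ?W \<Phi>"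
      by (rule prod.cong) auto
    moreover have "(\<Prod>k\<in>{2..<2 * n}. e k (?\<Phi> (k div 2)) (?\<Phi> k)) = ?L \<Phi>"
      by (rule prod.cong) auto
    moreover have "?\<Phi> (2 * n div 2) = \<Phi> n" "?\<Phi> ((2 * n + 1) div 2) = \<Phi> n" "?\<Phi> (2 * n) = y" "?\<Phi> (2 * n + 1) = z"
      using assms by auto
    ultimately show ?thesis unfolding set1 set2
      by (subst (1 2) prod.insert; simp del: fun_upd_apply)+ (simp del: fun_upd_apply add: mult_ac)
  qed
  have "heap_sum X w e (Suc n) = (\<Sum>\<Phi>\<in>Pi\<^sub>E {1..<2 * n} X. \<Sum>y\<in>X (2 * n). \<Sum>z\<in>X (2 * n + 1).
      ?W \<Phi> * ?L \<Phi> * ((e (2 * n) (\<Phi> n) y * w (2 * n) y) * (e (2 * n + 1) (\<Phi> n) z * w (2 * n + 1) z)))"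
    unfolding heap_sum_def split[symmetric] set1
    by (subst sum_PiE_insert, simp)+ (rule refl)
  also have "\<dots> = (\<Sum>\<Phi>\<in>Pi\<^sub>E {1..<2 * n} X. ?W \<Phi> * ?L \<Phi> * (?l (\<Phi> n) * ?r (\<Phi> n)))"
    unfolding sum_product unfolding sum_distrib_left by (rule refl)
  also have "\<dots> = heap_sum X (w(n := \<lambda>x. w n x * (?l x * ?r x))) e n"
    unfolding heap_sum_def
  proof (rule sum.cong[OF refl])
    fix \<Phi>
    have n: "n \<in> {1..<2 * n}" using assms by auto
    have "(\<Prod>k\<in>{1..<2 * n}. (w(n := \<lambda>x. w n x * (?l x * ?r x))) k (\<Phi> k)) = ?W \<Phi> * (?l (\<Phi> n) * ?r (\<Phi> n))"
    proof -
      let ?u = "w(n := \<lambda>x. w n x * (?l x * ?r x))"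
      have rem: "(\<Prod>k\<in>{1..<2 * n}. f k) = f n * (\<Prod>k\<in>{1..<2 * n} - {n}. f k)" for f :: "nat \<Rightarrow> 'r"
        by (rule prod.remove) (use n in auto)
      have "(\<Prod>k\<in>{1..<2 * n} - {n}. ?u k (\<Phi> k)) = (\<Prod>k\<in>{1..<2 * n} - {n}. w k (\<Phi> k))"
        by (rule prod.cong) auto
      then show ?thesis
        unfolding rem[of "\<lambda>k. ?u k (\<Phi> k)"] rem[of "\<lambda>k. w k (\<Phi> k)"]
        by (simp only: fun_upd_same mult_ac)
    qed
    then show "?W \<Phi> * ?L \<Phi> * (?l (\<Phi> n) * ?r (\<Phi> n)) =
      (\<Prod>k\<in>{1..<2 * n}. (w(n := \<lambda>x. w n x * (?l x * ?r x))) k (\<Phi> k)) * ?L \<Phi>"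
      by (simp add: mult_ac)
  qed
  finally show ?thesis .
qed

lemma heap_sum_eq_tree_val:
  assumes "m \<ge> 1"
  shows "heap_sum X w e m = (\<Sum>x\<in>X 1. tree_val X w e m 1 x)"
proof -
  \<comment> \<open>Invariant of the pruning: in the tree with \<open>n\<close> leaves, each leaf
    carries as weight the value of the full subtree that has been removed below it.\<close>
  let ?w = "\<lambda>n k. if k < n then w k else tree_val X w e m k"
  have "heap_sum X w e m = heap_sum X (?w m) e m"
  proof -
    have "?w m = w" by (auto simp: fun_eq_iff tree_val.simps[of X w e m])
    then show ?thesis by simp
  qed
  moreover have *: "heap_sum X (?w n) e n = heap_sum X (?w 1) e 1" if "1 \<le> n" "n \<le> m" for n
    using that
  proof (induction n rule: dec_induct)
    case (step n)
    have *: "tree_val X w e m n = (\<lambda>x. w n x *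
        ((\<Sum>y\<in>X (2 * n). e (2 * n) x y * tree_val X w e m (2 * n) y) *
         (\<Sum>y\<in>X (2 * n + 1). e (2 * n + 1) x y * tree_val X w e m (2 * n + 1) y)))"
      by (rule ext, subst tree_val.simps) (use step in simp)
    have "heap_sum X (?w (Suc n)) e (Suc n) = heap_sum X (?w n) e n"
      unfolding heap_sum_Suc[OF \<open>1 \<le> n\<close>]
      by (rule arg_cong[where f = "\<lambda>u. heap_sum X u e n"]) (use step * in \<open>auto simp: fun_eq_iff\<close>)
    with step show ?case by simp
  qed simp
  ultimately have "heap_sum X w e m = heap_sum X (?w 1) e 1" using *[OF assms order_refl] by metis
  also have "\<dots> = (\<Sum>x\<in>X 1. tree_val X w e m 1 x)"
  proof -
    have "{1..<2 * 1} = insert (1 :: nat) {}" by auto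
    then show ?thesis unfolding heap_sum_def by (simp add: sum_PiE_insert)
  qed
  finally show ?thesis .
qed

subsection \<open>Homomorphism sums of the tree graphs\<close>

text \<open>All maps are summed; being a homomorphism is enforced by weight 0 on non-edges. This
  makes the sum local and lets it factor over blocks.\<close>

definition hom_sum :: "'v graph \<Rightarrow> 'w set \<Rightarrow> ('w set \<Rightarrow> 'r::comm_semiring_1) \<Rightarrow> 'r" where
  "hom_sum G U w = (\<Sum>\<phi>\<in>V G \<rightarrow>\<^sub>E U. \<Prod>e\<in>E G. w (\<phi> ` e))"

primrec node :: "'v gvert \<Rightarrow> nat" where
  "node (TV k x) = k"
| "node (PV k j) = k"

declare level.simps [simp del]

lemma lab_le_2: "lab k \<in> {0, 1, 2}"
  by (simp add: lab_def)

lemma wf_graph_edgeD: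
  "wf_graph G \<Longrightarrow> e \<in> E G \<Longrightarrow> \<exists>a b. a \<noteq> b \<and> e = {a, b} \<and> a \<in> V G \<and> b \<in> V G"
  by (simp add: wf_graph_def)

lemma wf_graph_finite_E: "wf_graph G \<Longrightarrow> finite (E G)"
  by (rule finite_subset[of _ "Pow (V G)"]) (auto simp: wf_graph_def)

lemma wf_graph_card_E: assumes "wf_graph G" shows "card (E G) \<le> 2 ^ card (V G)"
proof -
  have "finite (V G)" "E G \<subseteq> Pow (V G)" using assms by (auto simp: wf_graph_def)
  then have "card (E G) \<le> card (Pow (V G))" by (intro card_mono) auto
  with \<open>finite (V G)\<close> show ?thesis by (simp add: card_Pow)
qed

lemma UN_if_Int: "(\<Union>k\<in>K. if P k then F k else {}) = (\<Union>k\<in>K \<inter> {k. P k}. F k)"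
  by (auto split: if_splits)

locale tree_graph =
  fixes I :: "nat \<Rightarrow> 'v graph" and vl vr vp :: "nat \<Rightarrow> 'v" and c :: nat
  assumes wf: "i \<in> {0, 1, 2} \<Longrightarrow> wf_graph (I i)"
    and vl: "i \<in> {0, 1, 2} \<Longrightarrow> vl i \<in> V (I i)"
    and vr: "i \<in> {0, 1, 2} \<Longrightarrow> vr i \<in> V (I i)"
    and vp: "i \<in> {1, 2} \<Longrightarrow> vp i \<in> V (I i)"
    and c_pos: "1 \<le> c"
begin

text \<open>The path to the parent is put into the block of the child, so that \<open>link k\<close>
  is the only edge between the block of \<open>k\<close> and that of its parent.\<close>

definition block :: "nat \<Rightarrow> 'v gvert set" where
  "block k = TV k ` V (I (lab k)) \<union> (if 2 \<le> k then PV k ` {1..c} else {})"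

definition own :: "nat \<Rightarrow> 'v gvert set set" where
  "own k = (\<lambda>e. TV k ` e) ` E (I (lab k)) \<union>
     (if 2 \<le> k then (\<lambda>j. {PV k j, PV k (Suc j)}) ` {1..<c} \<union> {{PV k c, TV k (vp (lab k))}} else {})"

definition att :: "nat \<Rightarrow> 'v" where
  "att k = (if even k then vl (lab (k div 2)) else vr (lab (k div 2)))"

definition link :: "nat \<Rightarrow> 'v gvert set" where
  "link k = {TV (k div 2) (att k), PV k 1}"

lemma V_Gm: "V (Gm I vl vr vp c m) = (\<Union>k\<in>{1..<2 * m}. block k)"
proof -
  have K: "{1..<2 * m} \<inter> {k. 2 \<le> k} = {2..<2 * m}" by auto
  show ?thesis
    unfolding Gm_def V_def fst_conv block_def UN_Un_distrib UN_if_Int K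
    by (rule arg_cong2[where f = "(\<union>)"]; blast)
qed

lemma E_Gm: "E (Gm I vl vr vp c m) = (\<Union>k\<in>{1..<2 * m}. own k) \<union> link ` {2..<2 * m}"
proof -
  let ?A = "\<lambda>k. (\<lambda>e. TV k ` e) ` E (I (lab k))"
  let ?B = "\<lambda>k. (\<lambda>j. {PV k j, PV k (Suc j)}) ` {1..<c}"
  let ?C = "\<lambda>k. {PV k c, TV k (vp (lab k))}"
  have "(\<Union>k\<in>{1..<2 * m}. own k) = (\<Union>k\<in>{1..<2 * m}. ?A k) \<union>
      ((\<Union>k\<in>{2..<2 * m}. ?B k) \<union> (\<Union>k\<in>{2..<2 * m}. {?C k}))"
    (is "?L = ?R1 \<union> (?R2 \<union> ?R3)")
  proof -
    have K: "{1..<2 * m} \<inter> {k. 2 \<le> k} = {2..<2 * m}" by auto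
    have "?L = ?R1 \<union> (\<Union>k\<in>{1..<2 * m} \<inter> {k. 2 \<le> k}. ?B k \<union> {?C k})"
      unfolding own_def UN_Un_distrib UN_if_Int ..
    then show ?thesis unfolding K UN_Un_distrib .
  qed
  moreover have "?R1 = {TV k ` e | k e. k \<in> {1..<2*m} \<and> e \<in> E (I (lab k))}" by blast
  moreover have "?R2 = {{PV k j, PV k (Suc j)} | k j. k \<in> {2..<2*m} \<and> j \<in> {1..<c}}" by blast
  moreover have "?R3 = {?C k | k. k \<in> {2..<2*m}}" by blast
  moreover have "link ` {2..<2 * m} = {{TV (k div 2) (if even k then vl (lab (k div 2)) else vr (lab (k div 2))), PV k 1} | k. k \<in> {2..<2*m}}"
    unfolding link_def att_def by blast
  ultimately show ?thesis unfolding Gm_def E_def snd_conv by (simp only: Un_ac)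
qed

lemma finite_block: "finite (block k)"
  using wf[OF lab_le_2[of k]] by (simp add: block_def wf_graph_def)

lemma finite_own: "finite (own k)"
  using wf_graph_finite_E[OF wf[OF lab_le_2[of k]]] by (simp add: own_def)

lemma lab_child: "k \<noteq> 1 \<Longrightarrow> lab k \<in> {1, 2}"
  by (auto simp: lab_def)

lemma own_subset: "e \<in> own k \<Longrightarrow> e \<subseteq> block k"
proof -
  assume "e \<in> own k"
  then consider f where "f \<in> E (I (lab k))" "e = TV k ` f"
    | j where "2 \<le> k" "j \<in> {1..<c}" "e = {PV k j, PV k (Suc j)}"
    | "2 \<le> k" "e = {PV k c, TV k (vp (lab k))}"
    unfolding own_def by (auto split: if_splits)
  then show ?thesis
  proof cases
    case 1
    then have "f \<subseteq> V (I (lab k))" using wf_graph_edgeD[OF wf[OF lab_le_2]] by fastforce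
    with 1 show ?thesis by (auto simp: block_def)
  next
    case 2
    then show ?thesis by (auto simp: block_def)
  next
    case 3
    then have "vp (lab k) \<in> V (I (lab k))" by (intro vp lab_child) simp
    with 3 c_pos show ?thesis by (auto simp: block_def)
  qed
qed

lemma own_nonempty: "e \<in> own k \<Longrightarrow> e \<noteq> {}"
  using wf_graph_edgeD[OF wf[OF lab_le_2[of k]]] unfolding own_def
  by (auto split: if_splits)

lemma node_block: "v \<in> block k \<Longrightarrow> node v = k"
  by (auto simp: block_def split: if_splits)

lemma node_own: "e \<in> own k \<Longrightarrow> node ` e = {k}"
proof -
  assume e: "e \<in> own k"
  then have "node ` e \<subseteq> {k}" using own_subset node_block by blast
  with own_nonempty[OF e] show ?thesis by auto
qed

lemma node_link: "node ` link k = {k div 2, k}"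
  by (simp add: link_def)

lemma att_in: "att k \<in> V (I (lab (k div 2)))"
  using vl[OF lab_le_2] vr[OF lab_le_2] by (simp add: att_def)

lemma link_parent: "TV (k div 2) (att k) \<in> block (k div 2)"
  using att_in by (simp add: block_def)

lemma link_child: "2 \<le> k \<Longrightarrow> PV k 1 \<in> block k"
  using c_pos by (simp add: block_def)

lemma inj_on_link: "inj_on link A"
proof (rule inj_onI)
  fix x y assume "link x = link y"
  then have "PV x 1 \<in> link y" by (auto simp: link_def)
  then show "x = y" by (auto simp: link_def)
qed

lemma prod_E_Gm:
  "(\<Prod>e\<in>E (Gm I vl vr vp c m). g e) =
     (\<Prod>k\<in>{1..<2 * m}. \<Prod>e\<in>own k. g e) * (\<Prod>k\<in>{2..<2 * m}. g (link k))"
proof -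
  have "(\<Union>k\<in>{1..<2 * m}. own k) \<inter> link ` {2..<2 * m} = {}"
  proof (rule equals0I)
    fix e assume "e \<in> (\<Union>k\<in>{1..<2 * m}. own k) \<inter> link ` {2..<2 * m}"
    then obtain k l where "2 \<le> l" "e = link l" "e \<in> own k" by auto
    then have "{l div 2, l} = {k}" using node_own node_link by metis
    with \<open>2 \<le> l\<close> show False by auto
  qed
  moreover have "\<forall>i\<in>{1..<2 * m}. \<forall>j\<in>{1..<2 * m}. i \<noteq> j \<longrightarrow> own i \<inter> own j = {}"
  proof (intro ballI impI equals0I)
    fix i j :: nat and e assume "i \<noteq> j" "e \<in> own i \<inter> own j"
    then have "{i} = {j}" using node_own by (metis IntD1 IntD2)
    with \<open>i \<noteq> j\<close> show False by simp
  qed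
  ultimately show ?thesis
    unfolding E_Gm using finite_own
    by (subst prod.union_disjoint) (auto simp: prod.UNION_disjoint prod.reindex[OF inj_on_link])
qed

lemma hom_sum_Gm:
  assumes "m \<ge> 1"
  shows "hom_sum (Gm I vl vr vp c m) U w =
     (\<Sum>x\<in>block 1 \<rightarrow>\<^sub>E U. tree_val (\<lambda>k. block k \<rightarrow>\<^sub>E U) (\<lambda>k x. \<Prod>e\<in>own k. w (x ` e))
        (\<lambda>k x y. w {x (TV (k div 2) (att k)), y (PV k 1)}) m 1 x)"
proof -
  let ?G = "Gm I vl vr vp c m" and ?K = "{1..<2 * m}"
  let ?X = "\<lambda>k. block k \<rightarrow>\<^sub>E U"
  let ?w = "\<lambda>k x. \<Prod>e\<in>own k. w (x ` e)"
  let ?e = "\<lambda>k x y. w {x (TV (k div 2) (att k)), y (PV k 1)}"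
  have node_in: "node v \<in> ?K \<and> v \<in> block (node v)" if "v \<in> V ?G" for v
    using that node_block unfolding V_Gm by blast
  have blockV: "block k \<subseteq> V ?G" if "k \<in> ?K" for k
    using that unfolding V_Gm by blast
  have "hom_sum ?G U w = heap_sum ?X ?w ?e m"
    unfolding hom_sum_def heap_sum_def
  \<comment> \<open>The blocks partition the vertices, with \<open>node\<close> as the class map, so
    a map on \<open>V ?G\<close> is the same as a family of maps on the blocks.\<close>
  proof (rule sum.reindex_bij_witness[where
        i = "\<lambda>\<Phi>. \<lambda>v\<in>V ?G. \<Phi> (node v) v" and j = "\<lambda>\<phi>. \<lambda>k\<in>?K. restrict \<phi> (block k)"])
    fix \<phi> assume \<phi>: "\<phi> \<in> V ?G \<rightarrow>\<^sub>E U"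
    show "(\<lambda>v\<in>V ?G. (\<lambda>k\<in>?K. restrict \<phi> (block k)) (node v) v) = \<phi>"
      using node_in \<phi> by (auto simp: fun_eq_iff PiE_def extensional_def)
    show "(\<lambda>k\<in>?K. restrict \<phi> (block k)) \<in> Pi\<^sub>E ?K ?X"
      using blockV \<phi> by (auto simp: PiE_iff subset_iff)
    let ?\<Phi> = "\<lambda>k\<in>?K. restrict \<phi> (block k)"
    have "(\<Prod>k\<in>?K. \<Prod>e\<in>own k. w (\<phi> ` e)) = (\<Prod>k\<in>?K. ?w k (?\<Phi> k))"
    proof (intro prod.cong refl)
      fix k e assume "k \<in> ?K" "e \<in> own k"
      moreover have "restrict \<phi> (block k) ` e = \<phi> ` e"
        using own_subset[OF \<open>e \<in> own k\<close>] by (intro image_cong) auto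
      ultimately show "w (\<phi> ` e) = w (?\<Phi> k ` e)" by simp
    qed
    moreover have "(\<Prod>k\<in>{2..<2 * m}. w (\<phi> ` link k)) = (\<Prod>k\<in>{2..<2 * m}. ?e k (?\<Phi> (k div 2)) (?\<Phi> k))"
    proof (intro prod.cong refl)
      fix k assume "k \<in> {2..<2 * m}"
      then show "w (\<phi> ` link k) = ?e k (?\<Phi> (k div 2)) (?\<Phi> k)"
        using link_child[of k] link_parent[of k] by (auto simp: link_def)
    qed
    ultimately show "(\<Prod>k\<in>?K. ?w k (?\<Phi> k)) * (\<Prod>k\<in>{2..<2 * m}. ?e k (?\<Phi> (k div 2)) (?\<Phi> k)) =
        (\<Prod>e\<in>E ?G. w (\<phi> ` e))"
      unfolding prod_E_Gm by simp
  next
    fix \<Phi> assume \<Phi>: "\<Phi> \<in> Pi\<^sub>E ?K ?X"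
    show "(\<lambda>v\<in>V ?G. \<Phi> (node v) v) \<in> V ?G \<rightarrow>\<^sub>E U"
      using node_in \<Phi> by (fastforce simp: PiE_iff)
    show "(\<lambda>k\<in>?K. restrict (\<lambda>v\<in>V ?G. \<Phi> (node v) v) (block k)) = \<Phi>"
    proof (rule PiE_ext[of _ ?K ?X])
      show "(\<lambda>k\<in>?K. restrict (\<lambda>v\<in>V ?G. \<Phi> (node v) v) (block k)) \<in> Pi\<^sub>E ?K ?X"
        using blockV \<Phi> node_block by (fastforce simp: PiE_iff)
      fix k assume k: "k \<in> ?K"
      then have "\<Phi> k \<in> block k \<rightarrow>\<^sub>E U" using \<Phi> by auto
      then show "(\<lambda>k\<in>?K. restrict (\<lambda>v\<in>V ?G. \<Phi> (node v) v) (block k)) k = \<Phi> k"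
        using blockV[OF k] k node_block by (auto simp: fun_eq_iff PiE_def extensional_def)
    qed (rule \<Phi>)
  qed
  then show ?thesis unfolding heap_sum_eq_tree_val[OF assms] .
qed

end

lemma hom_sum_eq_sum_homs:
  assumes "finite (V G)" "finite (V H)" "finite (E G)"
  shows "(\<Sum>\<phi>\<in>{\<phi> \<in> V G \<rightarrow>\<^sub>E V H. is_hom G H \<phi>}. \<Prod>e\<in>E G. s (\<phi> ` e)) =
    hom_sum G (V H) (\<lambda>e. if e \<in> E H then s e else 0)"
  unfolding hom_sum_def
proof (rule sum.mono_neutral_cong_left)
  show "finite (V G \<rightarrow>\<^sub>E V H)" by (rule finite_PiE) (use assms in auto)
  show "\<forall>\<phi>\<in>(V G \<rightarrow>\<^sub>E V H) - {\<phi> \<in> V G \<rightarrow>\<^sub>E V H. is_hom G H \<phi>}.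
      (\<Prod>e\<in>E G. if \<phi> ` e \<in> E H then s (\<phi> ` e) else 0) = 0"
    using assms(3) by (auto simp: is_hom_def intro!: prod_zero)
  show "(\<Prod>e\<in>E G. s (\<phi> ` e)) = (\<Prod>e\<in>E G. if \<phi> ` e \<in> E H then s (\<phi> ` e) else 0)"
    if "\<phi> \<in> {\<phi> \<in> V G \<rightarrow>\<^sub>E V H. is_hom G H \<phi>}" for \<phi>
    using that by (intro prod.cong) (auto simp: is_hom_def)
qed auto

lemma hom_poly_eq_hom_sum:
  assumes "finite (V G)" "finite (V H)" "finite (E G)"
  shows "hom_poly G H = hom_sum G (V H) (\<lambda>e. if e \<in> E H then mvar e else 0)"
  unfolding hom_poly_def by (rule hom_sum_eq_sum_homs[OF assms])

lemma msubst_hom_poly: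
  assumes "finite (V G)" "finite (V H)" "finite (E G)"
  shows "msubst s (hom_poly G H) = hom_sum G (V H) (\<lambda>e. if e \<in> E H then s e else 0)"
  unfolding hom_poly_def msubst_sum msubst_prod_mvar by (rule hom_sum_eq_sum_homs[OF assms])

text \<open>Only one inclusion holds: different homomorphisms can have the same monomial, and its
  coefficient may vanish in positive characteristic. For upper bounds on variables and degree this
  suffices.\<close>

lemma keys_hom_poly:
  assumes "M \<in> Poly_Mapping.keys (hom_poly G H :: ('w set, 'a::comm_ring_1) mpoly)"
  obtains \<phi> where "is_hom G H \<phi>" "M = (\<Sum>e\<in>E G. Poly_Mapping.single (\<phi> ` e) 1)"
proof -
  let ?S = "{\<phi> \<in> V G \<rightarrow>\<^sub>E V H. is_hom G H \<phi>}"
  have "M \<in> (\<Union>\<phi>\<in>?S. Poly_Mapping.keys (\<Prod>e\<in>E G. mvar (\<phi> ` e) :: ('w set, 'a) mpoly))"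
    by (rule subsetD[OF keys_sum_subset assms[unfolded hom_poly_def]])
  then obtain \<phi> where \<phi>: "\<phi> \<in> ?S" "M \<in> Poly_Mapping.keys (\<Prod>e\<in>E G. mvar (\<phi> ` e) :: ('w set, 'a) mpoly)"
    by (rule UN_E)
  show thesis
  proof (rule that)
    show "is_hom G H \<phi>" using \<phi>(1) by simp
    show "M = (\<Sum>e\<in>E G. Poly_Mapping.single (\<phi> ` e) 1)"
      using \<phi>(2) unfolding prod_mvar by (simp split: if_splits)
  qed
qed

lemma mvars_hom_poly:
  "mvars (hom_poly G H :: ('w set, 'a::comm_ring_1) mpoly) \<subseteq> E H"
proof
  fix x assume "x \<in> mvars (hom_poly G H :: ('w set, 'a) mpoly)"
  then obtain M where M: "M \<in> Poly_Mapping.keys (hom_poly G H :: ('w set, 'a) mpoly)" "x \<in> Poly_Mapping.keys M"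
    unfolding mvars_def by blast
  obtain \<phi> where \<phi>: "is_hom G H \<phi>" "M = (\<Sum>e\<in>E G. Poly_Mapping.single (\<phi> ` e) 1)"
    using M(1) by (rule keys_hom_poly)
  then have "x \<in> (\<Union>e\<in>E G. Poly_Mapping.keys (Poly_Mapping.single (\<phi> ` e) (1::nat)))"
    using M(2) keys_sum_subset[of "\<lambda>e. Poly_Mapping.single (\<phi> ` e) (1::nat)" "E G"] by blast
  with \<phi>(1) show "x \<in> E H" by (auto simp: is_hom_def)
qed

lemma mdegree_hom_poly: "mdegree (hom_poly G H :: ('w set, 'a::comm_ring_1) mpoly) \<le> card (E G)"
  unfolding mdegree_le_iff
proof
  fix M assume "M \<in> Poly_Mapping.keys (hom_poly G H :: ('w set, 'a) mpoly)"
  then obtain \<phi> where "M = (\<Sum>e\<in>E G. Poly_Mapping.single (\<phi> ` e) 1)" by (rule keys_hom_poly)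
  then show "mon_degree M \<le> card (E G)" by (simp add: mon_degree_sum)
qed

lemma V_Hm: "V (Hm m) = {..<m ^ 6}"
  by (simp add: V_def Hm_def)

lemma E_Hm: "E (Hm m) = {{a, b} | a b. a < m ^ 6 \<and> b < m ^ 6 \<and> a \<noteq> b}"
  by (simp add: E_def Hm_def)

lemma card_E_Hm: "finite (E (Hm m)) \<and> card (E (Hm m)) \<le> m ^ 12"
proof -
  have "E (Hm m) \<subseteq> (\<lambda>(a, b). {a, b}) ` ({..<m ^ 6} \<times> {..<m ^ 6})"
    unfolding E_Hm by auto
  moreover have "card ((\<lambda>(a, b). {a, b}) ` ({..<m ^ 6} \<times> {..<m ^ 6})) \<le> m ^ 6 * m ^ 6"
    by (rule order_trans[OF card_image_le]) (simp_all add: card_cartesian_product)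
  ultimately show ?thesis
    by (metis (no_types, lifting) card_mono finite_SigmaI finite_imageI finite_lessThan finite_subset
        le_trans mult_2_right numeral_Bit0 power_add)
qed

section \<open>Circuits for the homomorphism polynomials\<close>

lemma slp_sum_products:
  assumes "finite A" "f ` A \<subseteq> S" "g ` A \<subseteq> S"
  shows "slp S {\<Sum>y\<in>A. f y * g y} (2 * card A + 1)"
proof -
  have "slp S (\<Union>y\<in>A. {f y * g y}) (card A * 1)"
    by (intro slp_UN slp_mult) (use assms in auto)
  then have "slp S ((\<Union>y\<in>A. {f y * g y}) \<union> {\<Sum>y\<in>A. f y * g y}) (card A * 1 + (card A + 1))"
    by (intro slp_trans slp_sum) (use assms(1) in auto)
  then show ?thesis by (rule slp_mono) auto
qed

context tree_graph begin

lemma card_own: "card (own k) \<le> 2 ^ card (V (I (lab k))) + c"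
proof -
  let ?A = "(\<lambda>e. TV k ` e) ` E (I (lab k))"
  let ?B = "(\<lambda>j. {PV k j, PV k (Suc j)}) ` {1..<c} :: 'v gvert set set"
  let ?C = "{{PV k c, TV k (vp (lab k))}}"
  have fin: "finite ?A" by (intro finite_imageI wf_graph_finite_E wf lab_le_2)
  have "own k \<subseteq> ?A \<union> (?B \<union> ?C)" unfolding own_def by (rule Un_mono[OF order_refl]) simp
  then have "card (own k) \<le> card (?A \<union> (?B \<union> ?C))"
    by (rule card_mono[rotated]) (use fin in simp)
  also have "\<dots> \<le> card ?A + (card ?B + card ?C)"
    using card_Un_le[of ?A "?B \<union> ?C"] card_Un_le[of ?B ?C] by linarith
  also have "card ?A \<le> card (E (I (lab k)))"
    by (rule card_image_le) (intro wf_graph_finite_E wf lab_le_2)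
  also have "card (E (I (lab k))) \<le> 2 ^ card (V (I (lab k)))"
    by (intro wf_graph_card_E wf lab_le_2)
  also have "card ?B \<le> c - 1" by (rule order_trans[OF card_image_le]) auto
  finally show ?thesis using c_pos by simp
qed

lemma card_block: "card (block k) \<le> card (V (I (lab k))) + c"
proof -
  have fin: "finite (V (I (lab k)))" using wf[OF lab_le_2] by (simp add: wf_graph_def)
  have "card (block k) \<le> card (TV k ` V (I (lab k)) \<union> PV k ` {1..c})"
    unfolding block_def by (rule card_mono) (use fin in auto)
  also have "\<dots> \<le> card (TV k ` V (I (lab k))) + card ((PV k :: nat \<Rightarrow> 'v gvert) ` {1..c})"
    by (rule card_Un_le)
  also have "\<dots> \<le> card (V (I (lab k))) + c"
    using card_image_le[OF fin, of "TV k"] card_image_le[of "{1..c}" "PV k :: nat \<Rightarrow> 'v gvert"] by simp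
  finally show ?thesis .
qed

lemma finite_V_Gm: "finite (V (Gm I vl vr vp c m))"
  unfolding V_Gm using finite_block by blast

lemma finite_E_Gm: "finite (E (Gm I vl vr vp c m))"
  unfolding E_Gm using finite_own by blast

lemma card_E_Gm:
  assumes "\<And>k. card (own k) \<le> R"
  shows "card (E (Gm I vl vr vp c m)) \<le> 2 * m * (R + 1)"
proof -
  have "card (\<Union>k\<in>{1..<2 * m}. own k) \<le> (\<Sum>k\<in>{1..<2 * m}. card (own k))"
    by (rule card_UN_le) simp
  also have "\<dots> \<le> (\<Sum>k\<in>{1..<2 * m}. R)" by (rule sum_mono) (rule assms)
  also have "\<dots> \<le> 2 * m * R" by simp
  finally have "card (\<Union>k\<in>{1..<2 * m}. own k) \<le> 2 * m * R" .
  moreover have "card (link ` {2..<2 * m}) \<le> 2 * m"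
    by (rule order_trans[OF card_image_le]) auto
  ultimately show ?thesis
    unfolding E_Gm using card_Un_le[of "\<Union>k\<in>{1..<2 * m}. own k" "link ` {2..<2 * m}"] by simp
qed

text \<open>Nodes are processed by decreasing index, so children precede their parent. A state costs
  \<open>R + 1\<close> gates for its own weight, \<open>2 * B + 1\<close> for each of the two child
  sums and 2 for the products.\<close>

lemma slp_tree_val:
  fixes w :: "'w set \<Rightarrow> ('x, 'a::comm_ring_1) mpoly"
  assumes "finite U" and R: "\<And>k. card (own k) \<le> R" and B: "\<And>k. card (block k \<rightarrow>\<^sub>E U) \<le> B"
    and "n < 2 * m"
  defines "X \<equiv> \<lambda>k. block k \<rightarrow>\<^sub>E U"
    and "e \<equiv> \<lambda>k x y. w {x (TV (k div 2) (att k)), y (PV k 1)}"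
  defines "t \<equiv> tree_val X (\<lambda>k x. \<Prod>e\<in>own k. w (x ` e)) e m"
  shows "slp (range w) (\<Union>k\<in>{2 * m - n..<2 * m}. t k ` X k) (n * (B * (R + 4 * B + 5)))"
  using \<open>n < 2 * m\<close>
proof (induction n)
  case 0
  then show ?case by (simp add: slp_subset)
next
  case (Suc n)
  define k where "k = 2 * m - Suc n"
  have k: "0 < k" "k < 2 * m" "2 * m - n = Suc k" using Suc.prems by (auto simp: k_def)
  let ?T = "\<Union>k\<in>{Suc k..<2 * m}. t k ` X k"
  let ?S = "range w \<union> ?T"
  have finX: "finite (X k)" for k unfolding X_def by (rule finite_PiE) (use finite_block assms(1) in auto)
  have "slp ?S {t k x} (R + 4 * B + 5)" if x: "x \<in> X k" for x
  proof -
    let ?p = "\<Prod>e\<in>own k. w (x ` e)"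
    have p: "slp S {?p} (R + 1)" if "range w \<subseteq> S" for S
      by (rule slp_mono[OF slp_prod[OF finite_own]]) (use R[of k] that in auto)
    show ?thesis
    proof (cases "k < m")
      case False
      then have "t k x = ?p" unfolding t_def by (subst tree_val.simps) simp
      then show ?thesis using slp_mono[OF p[of ?S]] by auto
    next
      case True
      let ?c = "\<lambda>l. \<Sum>y\<in>X l. e l x y * t l y"
      have c: "slp S {?c l} (2 * B + 1)" if "?S \<subseteq> S" "l \<in> {2 * k, 2 * k + 1}" for l S
      proof -
        have "l \<in> {Suc k..<2 * m}" using that(2) True k(1) by auto
        then have "t l ` X l \<subseteq> S" using that(1) by blast
        then have "slp S {?c l} (2 * card (X l) + 1)"
          by (intro slp_sum_products finX) (use that(1) in \<open>auto simp: e_def\<close>)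
        then show ?thesis by (rule slp_mono) (use B[of l] in \<open>auto simp: X_def\<close>)
      qed
      have "t k x = ?p * (?c (2 * k) * ?c (2 * k + 1))"
        unfolding t_def by (subst tree_val.simps) (use True k(1) in simp)
      moreover have "slp ?S ({?p} \<union> ({?c (2 * k)} \<union> ({?c (2 * k + 1)} \<union>
          ({?c (2 * k) * ?c (2 * k + 1)} \<union> {?p * (?c (2 * k) * ?c (2 * k + 1))}))))
        ((R + 1) + ((2 * B + 1) + ((2 * B + 1) + (1 + 1))))"
        by (intro slp_trans p c slp_mult) auto
      ultimately show ?thesis by (elim slp_mono) auto
    qed
  qed
  then have "slp ?S (\<Union>x\<in>X k. {t k x}) (card (X k) * (R + 4 * B + 5))"
    by (intro slp_UN finX)
  then have "slp ?S (t k ` X k) (B * (R + 4 * B + 5))"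
    by (rule slp_mono) (use B[of k] in \<open>auto simp: X_def intro!: mult_le_mono1\<close>)
  with Suc k(3) have "slp (range w) (?T \<union> t k ` X k) (n * (B * (R + 4 * B + 5)) + B * (R + 4 * B + 5))"
    by (intro slp_trans) auto
  moreover have "{k..<2 * m} = insert k {Suc k..<2 * m}" using k by auto
  ultimately show ?case unfolding k_def[symmetric] by (elim slp_mono) auto
qed

lemma in_VP_hom_poly:
  assumes card: "\<And>i. i \<in> {0, 1, 2} \<Longrightarrow> card (V (I i)) < c" and P: "\<And>m. P m \<Longrightarrow> 1 \<le> m"
  shows "in_VP_on P (\<lambda>m. hom_poly (Gm I vl vr vp c m) (Hm m) :: (nat set, 'a::comm_ring_1) mpoly)"
proof -
  define R where "R = 2 ^ c + c"
  \<comment> \<open>A block has fewer than \<open>2 * c\<close> vertices, so this bounds its maps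
    into \<open>m ^ 6\<close> vertices. The exponent is fixed, hence the bound is polynomial in
    \<open>m\<close>.\<close>
  define B :: "nat \<Rightarrow> nat" where "B m = (m ^ 6) ^ (2 * c)" for m
  \<comment> \<open>The summands pay for the edge weights, the table of states, the sum at the root,
    the two gates of \<open>slp_imp_circ_computes\<close>, and the degree; the first one also bounds
    the number of variables.\<close>
  define q where "q m = m ^ 12 + 1 + (2 * m * (B m * (R + 4 * B m + 5)) + (B m + 1)) + 2 + 2 * m * (R + 1)" for m
  have R: "card (own k) \<le> R" for k
  proof -
    have "(2::nat) ^ card (V (I (lab k))) \<le> 2 ^ c"
      using card[OF lab_le_2[of k]] by (intro power_increasing) auto
    then show ?thesis using card_own[of k] unfolding R_def by linarith
  qed
  have "poly_bounded q" unfolding q_def B_def by (intro poly_bounded_intros)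
  moreover have "finite (mvars f) \<and> card (mvars f) \<le> q m \<and> mdegree f \<le> q m \<and>
      (\<exists>C. circ_computes C f \<and> length C \<le> q m)"
    if m: "1 \<le> m" and f: "f = (hom_poly (Gm I vl vr vp c m) (Hm m) :: (nat set, 'a) mpoly)" for m f
  proof -
    let ?G = "Gm I vl vr vp c m" and ?U = "{..<m ^ 6}"
    have "card (mvars f) \<le> m ^ 12" and fin: "finite (mvars f)"
      using mvars_hom_poly[of ?G "Hm m", where 'a = 'a] card_E_Hm[of m] unfolding f
      by (meson card_mono le_trans, meson finite_subset)
    then have vars: "card (mvars f) \<le> q m" by (simp add: q_def)
    have "mdegree f \<le> 2 * m * (R + 1)"
      using mdegree_hom_poly[of ?G "Hm m", where 'a = 'a] card_E_Gm[OF R, of m] unfolding f by linarith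
    then have deg: "mdegree f \<le> q m" by (simp add: q_def)
    define w where "w = (\<lambda>e. if e \<in> E (Hm m) then mvar e else (0 :: (nat set, 'a) mpoly))"
    let ?t = "tree_val (\<lambda>k. block k \<rightarrow>\<^sub>E ?U) (\<lambda>k x. \<Prod>e\<in>own k. w (x ` e))
        (\<lambda>k x y. w {x (TV (k div 2) (att k)), y (PV k 1)}) m"
    have B: "card (block k \<rightarrow>\<^sub>E ?U) \<le> B m" for k
    proof -
      have "card (block k \<rightarrow>\<^sub>E ?U) = (m ^ 6) ^ card (block k)"
        by (simp add: card_PiE finite_block)
      also have "\<dots> \<le> B m"
        unfolding B_def using m card_block[of k] card[OF lab_le_2[of k]]
        by (intro power_increasing) auto
      finally show ?thesis .
    qed
    have "f = hom_sum ?G ?U w"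
      unfolding f w_def V_Hm[symmetric]
      by (rule hom_poly_eq_hom_sum) (auto simp: finite_V_Gm finite_E_Gm V_Hm)
    then have ft: "f = (\<Sum>x\<in>block 1 \<rightarrow>\<^sub>E ?U. ?t 1 x)"
      unfolding hom_sum_Gm[OF m] .
    have "slp {} (range w) (m ^ 12 + 1)"
    proof -
      have "slp {} ((\<Union>e\<in>E (Hm m). {mvar e}) \<union> {mconst 0 :: (nat set, 'a) mpoly}) (card (E (Hm m)) * 1 + 1)"
        by (intro slp_trans slp_UN slp_mvar slp_mconst) (use card_E_Hm in auto)
      then show ?thesis
        by (rule slp_mono) (use card_E_Hm[of m] in \<open>auto simp: w_def\<close>)
    qed
    moreover have "slp (range w) ({?t 1 x | x. x \<in> block 1 \<rightarrow>\<^sub>E ?U} \<union> {f})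
        (2 * m * (B m * (R + 4 * B m + 5)) + (B m + 1))"
    proof (rule slp_trans)
      have "slp (range w) (\<Union>k\<in>{2 * m - (2 * m - 1)..<2 * m}. ?t k ` (block k \<rightarrow>\<^sub>E ?U))
          ((2 * m - 1) * (B m * (R + 4 * B m + 5)))"
        by (rule slp_tree_val[OF _ R B]) (use m in auto)
      moreover have "{?t 1 x | x. x \<in> block 1 \<rightarrow>\<^sub>E ?U} \<subseteq> (\<Union>k\<in>{2 * m - (2 * m - 1)..<2 * m}. ?t k ` (block k \<rightarrow>\<^sub>E ?U))"
        by (rule order_trans[OF _ UN_upper[of 1]]) (use m in auto)
      ultimately show "slp (range w) {?t 1 x | x. x \<in> block 1 \<rightarrow>\<^sub>E ?U} (2 * m * (B m * (R + 4 * B m + 5)))"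
        by (rule slp_mono[OF _ order_refl]) simp
      have "finite (block 1 \<rightarrow>\<^sub>E ?U)" by (intro finite_PiE finite_block) simp
      then have "slp (range w \<union> {?t 1 x | x. x \<in> block 1 \<rightarrow>\<^sub>E ?U}) {\<Sum>x\<in>block 1 \<rightarrow>\<^sub>E ?U. ?t 1 x}
          (card (block 1 \<rightarrow>\<^sub>E ?U) + 1)"
        by (rule slp_sum) blast
      then show "slp (range w \<union> {?t 1 x | x. x \<in> block 1 \<rightarrow>\<^sub>E ?U}) {f} (B m + 1)"
        unfolding ft by (rule slp_mono) (use B[of 1] in simp_all)
    qed
    ultimately have "slp {} (range w \<union> ({?t 1 x | x. x \<in> block 1 \<rightarrow>\<^sub>E ?U} \<union> {f}))
        (m ^ 12 + 1 + (2 * m * (B m * (R + 4 * B m + 5)) + (B m + 1)))"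
      by (intro slp_trans[where S = "{}" and T = "range w"]) (simp_all only: Un_empty_left)
    then have "slp {} {f} (m ^ 12 + 1 + (2 * m * (B m * (R + 4 * B m + 5)) + (B m + 1)))"
      by (rule slp_mono) auto
    then obtain C where "circ_computes C f"
      "length C \<le> m ^ 12 + 1 + (2 * m * (B m * (R + 4 * B m + 5)) + (B m + 1)) + 2"
      by (rule slp_imp_circ_computes)
    then have "\<exists>C. circ_computes C f \<and> length C \<le> q m"
      unfolding q_def by (meson le_add1 le_trans)
    with vars deg fin show ?thesis by blast
  qed
  ultimately show ?thesis
    unfolding in_VP_on_def using P by blast
qed

end

subsection \<open>Homogenization\<close>

text \<open>The circuit is evaluated with an extra grading variable: every input gets degree 1, so
  the coefficient at \<open>i\<close> is the homogeneous component of degree \<open>i\<close>, and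
  setting the variable to 1 recovers the value of the gate.\<close>

fun hom_gate :: "('a::comm_ring_1, 'x) gate list \<Rightarrow> nat \<Rightarrow> ('x, 'a) mpoly poly" where
  "hom_gate C k = (case C ! k of
      GIn x \<Rightarrow> monom (mvar x) 1
    | GConst a \<Rightarrow> [:mconst a:]
    | GAdd i j \<Rightarrow> (if i < k \<and> j < k then hom_gate C i + hom_gate C j else 0)
    | GMul i j \<Rightarrow> (if i < k \<and> j < k then hom_gate C i * hom_gate C j else 0))"

declare hom_gate.simps [simp del]

lemma poly_hom_gate:
  assumes "valid_circ C"
  shows "k < length C \<Longrightarrow> poly (hom_gate C k) 1 = circ_vals C ! k"
proof (induction k rule: less_induct)
  case (less k)
  have "gate_ok k (C ! k)" using assms less.prems by (auto simp: valid_circ_def)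
  with less show ?case
    unfolding circ_vals_nth[OF assms less.prems] hom_gate.simps[of C k]
    by (cases "C ! k") (auto simp: poly_monom)
qed

lemma homogeneous_coeff_hom_gate: "homogeneous i (coeff (hom_gate C k) i)"
proof (induction k arbitrary: i rule: less_induct)
  case (less k)
  show ?case
  proof (cases "C ! k")
    case (GMul a b)
    have "homogeneous i (coeff (hom_gate C a * hom_gate C b) i)" if "a < k" "b < k"
      unfolding coeff_mult
    proof (rule homogeneous_sum)
      fix j assume "j \<in> {..i}"
      then have "j + (i - j) = i" by simp
      then show "homogeneous i (coeff (hom_gate C a) j * coeff (hom_gate C b) (i - j))"
        using homogeneous_mult[OF less.IH[OF that(1)] less.IH[OF that(2)], of j "i - j"] by simp
    qed
    with GMul show ?thesis by (simp add: hom_gate.simps[of C k])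
  qed (use less homogeneous_mvar in \<open>auto simp: hom_gate.simps[of C k] homogeneous_add homogeneous_mconst
        coeff_pCons split: nat.split\<close>)
qed

definition base_comp :: "('a::comm_ring_1, 'x) gate list \<Rightarrow> nat \<Rightarrow> nat \<Rightarrow> ('x, 'a) mpoly" where
  "base_comp C h i = (case C ! h of
      GIn x \<Rightarrow> if i = 1 then mvar x else 0
    | GMul a b \<Rightarrow> (\<Sum>j\<in>{1..<i}. coeff (hom_gate C a) j * coeff (hom_gate C b) (i - j))
    | _ \<Rightarrow> 0)"

text \<open>Additions and multiplications by the constant terms of the factors are absorbed into the
  scalars \<open>l h\<close>, so that every component is a combination of variables and of products of
  components of strictly smaller degree.\<close>

lemma coeff_hom_gate_combination:
  fixes C :: "('a::comm_ring_1, 'x) gate list"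
  assumes "valid_circ C"
  shows "k < length C \<Longrightarrow> \<exists>l. \<forall>i\<ge>1. coeff (hom_gate C k) i = (\<Sum>h<length C. mconst (l h) * base_comp C h i)"
proof (induction k rule: less_induct)
  case (less k)
  have ok: "gate_ok k (C ! k)" using assms less.prems by (auto simp: valid_circ_def)
  let ?B = "\<lambda>l i. \<Sum>h<length C. mconst (l h) * base_comp C h i"
  have single: "?B (\<lambda>h. if h = k then 1 else 0) i = base_comp C k i" for i
  proof -
    have "?B (\<lambda>h. if h = k then 1 else 0) i = (\<Sum>h<length C. if h = k then base_comp C h i else 0)"
      by (rule sum.cong) auto
    then show ?thesis using less.prems by (simp add: sum.delta)
  qed
  have lin: "?B (\<lambda>h. a * l h + b * l' h + l'' h) i = mconst a * ?B l i + mconst b * ?B l' i + ?B l'' i"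
    for a b l l' l'' i
    by (simp add: mconst_add mconst_mult algebra_simps sum.distrib sum_distrib_left)
  show ?case
  proof (cases "C ! k")
    case (GIn x)
    then have "\<forall>i\<ge>1. coeff (hom_gate C k) i = ?B (\<lambda>h. if h = k then 1 else 0) i"
      unfolding single by (auto simp: hom_gate.simps[of C k] base_comp_def)
    then show ?thesis by (rule exI[where x = "\<lambda>h. if h = k then 1 else 0"])
  next
    case (GConst a)
    then have "\<forall>i\<ge>1. coeff (hom_gate C k) i = ?B (\<lambda>h. if h = k then 1 else 0) i"
      unfolding single by (auto simp: hom_gate.simps[of C k] base_comp_def coeff_pCons split: nat.split)
    then show ?thesis by (rule exI[where x = "\<lambda>h. if h = k then 1 else 0"])
  next
    case (GAdd a b)
    with ok less.prems have ab: "a < k" "b < k" "a < length C" "b < length C" by auto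
    obtain l l' where l: "\<forall>i\<ge>1. coeff (hom_gate C a) i = ?B l i" "\<forall>i\<ge>1. coeff (hom_gate C b) i = ?B l' i"
      using less.IH[OF ab(1,3)] less.IH[OF ab(2,4)] by blast
    have "\<forall>i\<ge>1. coeff (hom_gate C k) i = ?B (\<lambda>h. 1 * l h + 1 * l' h + (\<lambda>_. 0) h) i"
      unfolding lin using l GAdd ab by (simp add: hom_gate.simps[of C k])
    then show ?thesis by (rule exI[where x = "\<lambda>h. 1 * l h + 1 * l' h + (\<lambda>_. 0) h"])
  next
    case (GMul a b)
    with ok less.prems have ab: "a < k" "b < k" "a < length C" "b < length C" by auto
    obtain l l' where l: "\<forall>i\<ge>1. coeff (hom_gate C a) i = ?B l i" "\<forall>i\<ge>1. coeff (hom_gate C b) i = ?B l' i"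
      using less.IH[OF ab(1,3)] less.IH[OF ab(2,4)] by blast
    obtain u v where uv: "coeff (hom_gate C a) 0 = mconst u" "coeff (hom_gate C b) 0 = mconst v"
      using homogeneous_0_imp_mconst[OF homogeneous_coeff_hom_gate[of 0 C]] by blast
    have "coeff (hom_gate C k) i = ?B (\<lambda>h. u * l' h + v * l h + (if h = k then 1 else 0)) i" if "i \<ge> 1" for i
    proof -
      let ?f = "\<lambda>j. coeff (hom_gate C a) j * coeff (hom_gate C b) (i - j)"
      \<comment> \<open>For \<open>j = 0\<close> and \<open>j = i\<close> one factor is the constant
        \<open>u\<close> or \<open>v\<close>, so these two terms are linear in the components of the
        other gate. The scalars do not depend on \<open>i\<close>.\<close>
      have "{..i} = insert 0 (insert i {1..<i})" using that by auto
      then have "coeff (hom_gate C k) i = ?f 0 + (?f i + (\<Sum>j\<in>{1..<i}. ?f j))"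
        using GMul ab that by (simp add: hom_gate.simps[of C k] coeff_mult)
      also have "\<dots> = mconst u * ?B l' i + mconst v * ?B l i + base_comp C k i"
        using l that GMul by (simp add: uv base_comp_def mult.commute)
      finally show ?thesis unfolding lin single .
    qed
    then show ?thesis
      by (intro exI[where x = "\<lambda>h. u * l' h + v * l h + (if h = k then 1 else 0)"] allI impI)
  qed
qed

text \<open>In grammar terms, the gates are the nonterminals, \<open>\<gamma> A B D\<close> is the
  weight of the rule from \<open>A\<close> to \<open>B D\<close>, and \<open>l A x\<close> that of
  the rule from \<open>A\<close> to \<open>x\<close>. The constant term of \<open>f\<close>, which
  no derivation produces, is kept apart as \<open>a\<close>.\<close>

lemma grammar_of_circuit:
  fixes f :: "('x, 'a::comm_ring_1) mpoly"
  assumes "circ_computes C f" "mdegree f \<le> d"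
  obtains F :: "nat \<Rightarrow> nat \<Rightarrow> ('x, 'a) mpoly" and \<gamma> :: "nat \<Rightarrow> nat \<Rightarrow> nat \<Rightarrow> 'a"
    and vars :: "'x set" and l :: "nat \<Rightarrow> 'x \<Rightarrow> 'a" and A a
  where "A < length C" "f = mconst a + (\<Sum>i\<in>{1..d}. F A i)"
    "finite vars" "card vars \<le> length C"
    "\<And>A. A < length C \<Longrightarrow> F A 1 = (\<Sum>x\<in>vars. mconst (l A x) * mvar x)"
    "\<And>A n. A < length C \<Longrightarrow> 2 \<le> n \<Longrightarrow> F A n =
       (\<Sum>B<length C. \<Sum>D<length C. mconst (\<gamma> A B D) * (\<Sum>j\<in>{1..<n}. F B j * F D (n - j)))"
proof -
  let ?s = "length C"
  have val: "valid_circ C" "C \<noteq> []" "last (circ_vals C) = f"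
    using assms(1) by (auto simp: circ_computes_def valid_circ_def)
  define A where "A = ?s - 1"
  have "circ_vals C \<noteq> []" using val(2) length_circ_vals[of C] by (metis length_0_conv)
  then have A: "A < ?s" "f = circ_vals C ! A"
    using val by (simp_all add: A_def last_conv_nth)
  define F where "F k i = coeff (hom_gate C k) i" for k i
  have "f = poly (hom_gate C A) 1"
    using poly_hom_gate[OF val(1) A(1)] A(2) by simp
  also have "\<dots> = (\<Sum>i\<le>degree (hom_gate C A). F A i)"
    by (simp add: poly_altdef F_def)
  finally have "f = (\<Sum>i\<le>d. F A i)"
    by (rule homogeneous_components_truncate[OF assms(2)])
      (auto simp: F_def homogeneous_coeff_hom_gate coeff_eq_0)
  moreover have "{..d} = insert 0 {1..d}" by auto
  ultimately have f: "f = F A 0 + (\<Sum>i\<in>{1..d}. F A i)" by simp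
  obtain a where a: "F A 0 = mconst a"
    using homogeneous_0_imp_mconst[OF homogeneous_coeff_hom_gate] unfolding F_def by blast
  have "\<forall>k\<in>{..<?s}. \<exists>l. \<forall>i\<ge>1. F k i = (\<Sum>h<?s. mconst (l h) * base_comp C h i)"
    unfolding F_def by (rule ballI, rule coeff_hom_gate_combination[OF val(1)]) simp
  from bchoice[OF this] obtain L
    where "\<forall>k\<in>{..<?s}. \<forall>i\<ge>1. F k i = (\<Sum>h<?s. mconst (L k h) * base_comp C h i)" ..
  then have L: "F k i = (\<Sum>h<?s. mconst (L k h) * base_comp C h i)" if "k < ?s" "1 \<le> i" for k i
    using that by (simp only: lessThan_iff Ball_def)
  define vars where "vars = {x. GIn x \<in> set C}"
  have "vars \<subseteq> (\<lambda>g. case g of GIn x \<Rightarrow> x) ` set C" unfolding vars_def by (force split: gate.splits)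
  moreover have "finite vars" using calculation by (rule finite_subset) simp
  ultimately have vars: "finite vars" "card vars \<le> ?s"
    using surj_card_le[OF finite_set, of vars _ C] card_length[of C] by (blast, meson order_trans)
  \<comment> \<open>Several gates may read the same variable or multiply the same pair of gates;
    their scalars are collected in one rule.\<close>
  define l where "l k x = (\<Sum>h<?s. if C ! h = GIn x then L k h else 0)" for k x
  define \<gamma> where "\<gamma> k B D = (\<Sum>h<?s. if C ! h = GMul B D then L k h else 0)" for k B D
  have F1: "F k 1 = (\<Sum>x\<in>vars. mconst (l k x) * mvar x)" if k: "k < ?s" for k
  proof -
    have base: "base_comp C h 1 = (\<Sum>x\<in>vars. if C ! h = GIn x then mvar x else 0)" if "h < ?s" for h
    proof (cases "C ! h")
      case (GIn x)
      then have "x \<in> vars" using that nth_mem unfolding vars_def by fastforce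
      with GIn vars(1) show ?thesis by (simp add: base_comp_def sum.delta)
    qed (auto simp: base_comp_def)
    have "F k 1 = (\<Sum>h<?s. \<Sum>x\<in>vars. mconst (L k h) * (if C ! h = GIn x then mvar x else 0))"
      unfolding L[OF k order_refl] using base by (simp add: sum_distrib_left)
    also have "\<dots> = (\<Sum>x\<in>vars. \<Sum>h<?s. mconst (if C ! h = GIn x then L k h else 0) * mvar x)"
      by (subst sum.swap) (auto intro!: sum.cong)
    finally show ?thesis by (simp add: l_def mconst_sum sum_distrib_right)
  qed
  have Fn: "F k n = (\<Sum>B<?s. \<Sum>D<?s. mconst (\<gamma> k B D) * (\<Sum>j\<in>{1..<n}. F B j * F D (n - j)))"
    if k: "k < ?s" and n: "2 \<le> n" for k n
  proof -
    let ?P = "\<lambda>B D. \<Sum>j\<in>{1..<n}. F B j * F D (n - j)"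
    have base: "base_comp C h n = (\<Sum>B<?s. \<Sum>D<?s. if C ! h = GMul B D then ?P B D else 0)" if h: "h < ?s" for h
    proof (cases "C ! h")
      case (GMul a b)
      then have "a < ?s" "b < ?s" using val(1) h unfolding valid_circ_def by fastforce+
      moreover have "(\<Sum>D<?s. if a = B \<and> b = D then ?P B D else 0) = (if a = B then \<Sum>D<?s. if b = D then ?P B D else 0 else 0)" for B
        by simp
      ultimately show ?thesis using GMul by (simp add: base_comp_def F_def sum.delta)
    qed (use n in \<open>auto simp: base_comp_def\<close>)
    have "F k n = (\<Sum>h<?s. \<Sum>B<?s. \<Sum>D<?s. mconst (L k h) * (if C ! h = GMul B D then ?P B D else 0))"
      using L[OF k, of n] n base by (simp add: sum_distrib_left)
    also have "\<dots> = (\<Sum>B<?s. \<Sum>h<?s. \<Sum>D<?s. mconst (L k h) * (if C ! h = GMul B D then ?P B D else 0))"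
      by (rule sum.swap)
    also have "\<dots> = (\<Sum>B<?s. \<Sum>D<?s. \<Sum>h<?s. mconst (L k h) * (if C ! h = GMul B D then ?P B D else 0))"
      by (rule sum.cong[OF refl], rule sum.swap)
    also have "\<dots> = (\<Sum>B<?s. \<Sum>D<?s. \<Sum>h<?s. mconst (if C ! h = GMul B D then L k h else 0) * ?P B D)"
      by (intro sum.cong refl) auto
    finally show ?thesis by (simp add: \<gamma>_def mconst_sum sum_distrib_right)
  qed
  show thesis
    by (rule that[of A a F vars l \<gamma>]) (use A(1) f a vars F1 Fn in auto)
qed

subsection \<open>Layered product-of-sums form\<close>

text \<open>A coefficient is a constant or a single variable, which is exactly what a projection may
  substitute for an edge variable.\<close>

definition wspan :: "('x, 'a::comm_ring_1) mpoly set \<Rightarrow> ('x, 'a) mpoly set" where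
  "wspan S = {\<Sum>b\<in>S. case_sum mconst mvar (w b) * b | w. True}"

text \<open>The linear span. Unlike \<open>wspan\<close> it is closed under sums, as the depth
  reduction needs; variables enter only in the lowest layers.\<close>

definition lspan :: "('x, 'a::comm_ring_1) mpoly set \<Rightarrow> ('x, 'a) mpoly set" where
  "lspan S = {\<Sum>b\<in>S. mconst (u b) * b | u. True}"

lemma lspan_subset_wspan: "lspan S \<subseteq> wspan S"
proof
  fix p assume "p \<in> lspan S"
  then obtain u where "p = (\<Sum>b\<in>S. mconst (u b) * b)" unfolding lspan_def by blast
  then have "p = (\<Sum>b\<in>S. case_sum mconst mvar (Inl (u b)) * b)" by simp
  then show "p \<in> wspan S"
    unfolding wspan_def by (intro CollectI exI[of _ "\<lambda>b. Inl (u b)"] conjI TrueI)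
qed

lemma lspan_0 [simp]: "0 \<in> lspan S"
  unfolding lspan_def by (rule CollectI, rule exI[of _ "\<lambda>_. 0"]) simp

lemma lspan_add: assumes "p \<in> lspan S" "q \<in> lspan S" shows "p + q \<in> lspan S"
proof -
  obtain u v where "p = (\<Sum>b\<in>S. mconst (u b) * b)" "q = (\<Sum>b\<in>S. mconst (v b) * b)"
    using assms unfolding lspan_def by blast
  then have "p + q = (\<Sum>b\<in>S. mconst (u b + v b) * b)"
    by (simp add: mconst_add distrib_right sum.distrib)
  then show ?thesis unfolding lspan_def by (intro CollectI exI[of _ "\<lambda>b. u b + v b"]) simp
qed

lemma lspan_scale: assumes "p \<in> lspan S" shows "mconst a * p \<in> lspan S"
proof -
  obtain u where "p = (\<Sum>b\<in>S. mconst (u b) * b)"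
    using assms unfolding lspan_def by blast
  then have "mconst a * p = (\<Sum>b\<in>S. mconst (a * u b) * b)"
    by (simp add: mconst_mult sum_distrib_left mult.assoc)
  then show ?thesis unfolding lspan_def by (intro CollectI exI[of _ "\<lambda>b. a * u b"]) simp
qed

lemma lspan_sum: "(\<And>a. a \<in> A \<Longrightarrow> f a \<in> lspan S) \<Longrightarrow> sum f A \<in> lspan S"
  by (induction A rule: infinite_finite_induct) (auto intro: lspan_add)

lemma lspan_base: assumes "finite S" "p \<in> S" shows "p \<in> lspan S"
proof -
  have "(\<Sum>b\<in>S. mconst (if b = p then 1 else 0) * b) = (\<Sum>b\<in>S. if b = p then b else 0)"
    by (rule sum.cong) auto
  then have "p = (\<Sum>b\<in>S. mconst (if b = p then 1 else 0) * b)"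
    using assms by (simp add: sum.delta)
  then show ?thesis unfolding lspan_def
    by (intro CollectI exI[of _ "\<lambda>b. if b = p then 1 else 0"]) simp
qed

text \<open>The nodes of a layer are the polynomials they compute, so equal ones coincide and
  \<open>M\<close> bounds the number of different values. The bottom layer is 1 because a leaf of
  the tree graph contributes an empty product.\<close>

inductive layered :: "nat \<Rightarrow> nat \<Rightarrow> ('x, 'a::comm_ring_1) mpoly set \<Rightarrow> bool" for M where
  layered_0: "layered M 0 {1}"
| layered_Suc: "layered M r S \<Longrightarrow> finite T \<Longrightarrow> card T \<le> M \<Longrightarrow>
    (\<And>p. p \<in> T \<Longrightarrow> \<exists>x\<in>wspan S. \<exists>y\<in>wspan S. p = x * y) \<Longrightarrow> layered M (Suc r) T"

lemma layered_products:
  assumes "layered M r S" "finite P" "P \<subseteq> lspan S" "card P ^ 2 \<le> M"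
  shows "layered M (Suc r) ((\<lambda>(x, y). x * y) ` (P \<times> P))"
proof (rule layered_Suc[OF assms(1)])
  show "card ((\<lambda>(x, y). x * y) ` (P \<times> P)) \<le> M"
    by (rule order_trans[OF card_image_le])
      (use assms in \<open>auto simp: card_cartesian_product power2_eq_square\<close>)
  show "\<exists>x\<in>wspan S. \<exists>y\<in>wspan S. p = x * y" if "p \<in> (\<lambda>(x, y). x * y) ` (P \<times> P)" for p
  proof -
    obtain x y where "x \<in> P" "y \<in> P" "p = x * y" using \<open>p \<in> _\<close> by auto
    with assms(3) lspan_subset_wspan[of S] show ?thesis by (intro bexI[of _ x] bexI[of _ y]) auto
  qed
qed (use assms(2) in simp)

text \<open>Two binary layers multiply four elements of \<open>P\<close>; a cut produces three, and
  1 fills the fourth place. The second layer has at most \<open>card P ^ 4\<close> elements.\<close>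

lemma layered_triple_products:
  assumes "layered M r S" "finite P" "1 \<in> P" "P \<subseteq> lspan S" "card P ^ 4 \<le> M"
  obtains T where "layered M (r + 2) T" "finite T" "\<And>x y z. x \<in> P \<Longrightarrow> y \<in> P \<Longrightarrow> z \<in> P \<Longrightarrow> x * y * z \<in> T"
proof -
  let ?S1 = "(\<lambda>(x, y). x * y) ` (P \<times> P)"
  let ?S2 = "(\<lambda>(x, y). x * y) ` (?S1 \<times> ?S1)"
  have "0 < card P" using assms(2,3) by (auto simp: card_gt_0_iff)
  then have "card P ^ 2 \<le> card P ^ 4" by (intro power_increasing) auto
  then have "layered M (Suc r) ?S1" using assms by (intro layered_products) auto
  moreover have "card ?S1 \<le> card P ^ 2"
    by (rule order_trans[OF card_image_le])
      (use assms in \<open>auto simp: card_cartesian_product power2_eq_square\<close>)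
  then have "card ?S1 ^ 2 \<le> M"
    using assms(5) power_mono[of "card ?S1" "card P ^ 2" 2] by (simp add: power_mult[symmetric])
  ultimately have "layered M (Suc (Suc r)) ?S2"
    using assms(2) lspan_base[of ?S1] by (intro layered_products) auto
  moreover have "x * y * z \<in> ?S2" if "x \<in> P" "y \<in> P" "z \<in> P" for x y z
  proof -
    have "x * y \<in> ?S1" "z * 1 \<in> ?S1" using that assms(3) by force+
    then have "(x * y) * (z * 1) \<in> ?S2" by force
    then show ?thesis by simp
  qed
  ultimately show thesis using that[of ?S2] assms(2) by simp
qed

text \<open>The depth must match that of the tree exactly. The pair of 1 and \<open>f\<close>
  reproduces itself through \<open>1 * 1\<close> and \<open>f * 1\<close>; one layer creates the
  pair and one discards the 1, whence the two \<open>Suc\<close>.\<close>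

lemma layered_pad:
  assumes "layered M r S" "1 \<in> lspan S" "f \<in> lspan S" "2 \<le> M"
  shows "layered M (r + Suc (Suc k)) {f}"
proof -
  have pad: "layered M (Suc r) {1, f}" if "layered M r S" "1 \<in> wspan S" "f \<in> wspan S" for r S
  proof (rule layered_Suc[OF that(1)])
    show "card {1, f} \<le> M" using assms(4) card_insert_le_m1[of 2 "{f}" 1] by simp
    show "\<exists>x\<in>wspan S. \<exists>y\<in>wspan S. p = x * y" if "p \<in> {1, f}" for p
      using that \<open>1 \<in> wspan S\<close> \<open>f \<in> wspan S\<close> by (auto intro: bexI[of _ 1] bexI[of _ f])
  qed simp
  have in_span: "1 \<in> wspan {1, f}" "f \<in> wspan {1, f}"
    using subsetD[OF lspan_subset_wspan lspan_base[of "{1, f}"]] by auto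
  have "layered M (r + Suc k) {1, f}"
  proof (induction k)
    case 0
    then show ?case using pad[OF assms(1)] assms(2,3) lspan_subset_wspan by auto
  next
    case (Suc k)
    then show ?case using pad[OF Suc in_span] by simp
  qed
  then have "layered M (Suc (r + Suc k)) {f}"
  proof (rule layered_Suc)
    show "\<exists>x\<in>wspan {1, f}. \<exists>y\<in>wspan {1, f}. p = x * y" if "p \<in> {f}" for p
      using that in_span by (auto intro: bexI[of _ 1] bexI[of _ f])
  qed (use assms(4) in auto)
  then show ?thesis by simp
qed

text \<open>The layers are renumbered from the top, in agreement with the levels of the
  tree.\<close>

lemma layered_chain:
  assumes "layered M r T"
  obtains B where "B 0 = T" "B r = {1}" "\<And>d. 0 < d \<Longrightarrow> d \<le> r \<Longrightarrow> finite (B d)"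
    "\<And>d. 0 < d \<Longrightarrow> d < r \<Longrightarrow> card (B d) \<le> M"
    "\<And>d p. d < r \<Longrightarrow> p \<in> B d \<Longrightarrow> \<exists>x\<in>wspan (B (Suc d)). \<exists>y\<in>wspan (B (Suc d)). p = x * y"
  using assms
proof (induction arbitrary: thesis rule: layered.induct)
  case layered_0
  show ?case by (rule layered_0[of "\<lambda>_. {1}"]) auto
next
  case (layered_Suc r S T)
  obtain B where B: "B 0 = S" "B r = {1}" "\<And>d. 0 < d \<Longrightarrow> d \<le> r \<Longrightarrow> finite (B d)"
    "\<And>d. 0 < d \<Longrightarrow> d < r \<Longrightarrow> card (B d) \<le> M"
    "\<And>d p. d < r \<Longrightarrow> p \<in> B d \<Longrightarrow> \<exists>x\<in>wspan (B (Suc d)). \<exists>y\<in>wspan (B (Suc d)). p = x * y"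
    using layered_Suc.IH by metis
  have "finite S \<and> (0 < r \<longrightarrow> card S \<le> M)"
    using layered_Suc.hyps(1) by cases auto
  then have S: "finite (B 0)" "0 < r \<Longrightarrow> card (B 0) \<le> M" using B(1) by auto
  show ?case
  proof (rule layered_Suc.prems[of "case_nat T B"])
    show "finite (case_nat T B d)" if "0 < d" "d \<le> Suc r" for d
      using that S(1) B(3)[of "d - 1"] by (cases d; cases "d = 1") auto
    show "card (case_nat T B d) \<le> M" if "0 < d" "d < Suc r" for d
      using that S(2) B(4)[of "d - 1"] by (cases d; cases "d = 1") auto
    show "\<exists>x\<in>wspan (case_nat T B (Suc d)). \<exists>y\<in>wspan (case_nat T B (Suc d)). p = x * y"
      if "d < Suc r" "p \<in> case_nat T B d" for d p
      using that B(1) B(5)[of "d - 1" p] layered_Suc.hyps(4)[of p] by (cases d) auto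
  qed (simp_all add: B(2))
qed

subsection \<open>Depth reduction\<close>

locale grammar =
  fixes s :: nat and F :: "nat \<Rightarrow> nat \<Rightarrow> ('x, 'a::comm_ring_1) mpoly" and \<gamma> :: "nat \<Rightarrow> nat \<Rightarrow> nat \<Rightarrow> 'a"
  assumes F_rec: "A < s \<Longrightarrow> 2 \<le> n \<Longrightarrow> F A n =
       (\<Sum>B<s. \<Sum>D<s. mconst (\<gamma> A B D) * (\<Sum>j\<in>{1..<n}. F B j * F D (n - j)))"
begin

text \<open>The rules are rearranged so that the first factor, of degree \<open>p\<close>, has at least the degree
  \<open>j\<close> of the second one; iterating on the first factor then follows the heavy path of a derivation.\<close>

definition heavy :: "nat \<Rightarrow> nat \<Rightarrow> nat \<Rightarrow> nat \<Rightarrow> nat \<Rightarrow> 'a" where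
  "heavy A B D p j = (if j \<le> p then \<gamma> A B D else 0) + (if j < p then \<gamma> A D B else 0)"

text \<open>One step down the heavy path, with \<open>X\<close> in the place of the heavy child.
  Being linear in \<open>X\<close>, it acts on whole derivations and on contexts alike.\<close>

definition step :: "nat \<Rightarrow> nat \<Rightarrow> (nat \<Rightarrow> nat \<Rightarrow> ('x, 'a) mpoly) \<Rightarrow> ('x, 'a) mpoly" where
  "step A n X = (\<Sum>B<s. \<Sum>D<s. \<Sum>j\<in>{1..<n}. mconst (heavy A B D (n - j) j) * F D j * X B (n - j))"

lemma F_step:
  assumes "A < s" "2 \<le> n"
  shows "F A n = step A n F"
proof -
  \<comment> \<open>Terms are sorted by which factor is the heavier one; a tie
    \<open>j = n - j\<close> goes to \<open>?u\<close> only, so that it is counted once.\<close>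
  let ?u = "\<lambda>B D. \<Sum>j\<in>{1..<n}. if j \<le> n - j then mconst (\<gamma> A B D) * F D j * F B (n - j) else 0"
  let ?v = "\<lambda>B D. \<Sum>j\<in>{1..<n}. if j < n - j then mconst (\<gamma> A B D) * F D (n - j) * F B j else 0"
  have "mconst (\<gamma> A B D) * (\<Sum>j\<in>{1..<n}. F B j * F D (n - j)) = ?u B D + ?v B D" for B D
  proof -
    have u: "?u B D = (\<Sum>j\<in>{1..<n}. if n - j \<le> j then mconst (\<gamma> A B D) * F D (n - j) * F B j else 0)"
      by (rule sum.reindex_bij_witness[of _ "\<lambda>j. n - j" "\<lambda>j. n - j"]) auto
    show ?thesis
      unfolding u sum.distrib[symmetric] sum_distrib_left
    proof (intro sum.cong refl)
      fix j assume "j \<in> {1..<n}"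
      show "mconst (\<gamma> A B D) * (F B j * F D (n - j)) =
          (if n - j \<le> j then mconst (\<gamma> A B D) * F D (n - j) * F B j else 0) +
          (if j < n - j then mconst (\<gamma> A B D) * F D (n - j) * F B j else 0)"
        by (cases "j < n - j") (simp_all add: mult_ac not_less)
    qed
  qed
  then have "F A n = (\<Sum>B<s. \<Sum>D<s. ?u B D) + (\<Sum>B<s. \<Sum>D<s. ?v B D)"
    using F_rec[OF assms] by (simp add: sum.distrib)
  also have "(\<Sum>B<s. \<Sum>D<s. ?v B D) = (\<Sum>B<s. \<Sum>D<s. ?v D B)" by (rule sum.swap)
  also have "(\<Sum>B<s. \<Sum>D<s. ?u B D) + \<dots> = step A n F"
    unfolding step_def sum.distrib[symmetric]
    by (intro sum.cong refl) (auto simp: heavy_def mconst_add algebra_simps)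
  finally show ?thesis .
qed

lemma step_cong:
  assumes "\<And>B q. B < s \<Longrightarrow> q < n \<Longrightarrow> X B q = Y B q"
  shows "step A n X = step A n Y"
  unfolding step_def by (intro sum.cong refl) (use assms in auto)

lemma step_0 [simp]: "step A n (\<lambda>_ _. 0) = 0"
  by (simp add: step_def)

lemma step_add: "step A n (\<lambda>B q. X B q + Y B q) = step A n X + step A n Y"
  by (simp add: step_def distrib_left sum.distrib)

lemma step_sum: "step A n (\<lambda>B q. \<Sum>i\<in>S. X i B q) = (\<Sum>i\<in>S. step A n (X i))"
  by (induction S rule: infinite_finite_induct) (simp_all add: step_add)

lemma step_mult: "step A n (\<lambda>B q. X B q * y) = step A n X * y"
  by (simp add: step_def sum_distrib_right mult.assoc)

text \<open>The sum over derivations from \<open>(A, n)\<close> whose heavy path passes through \<open>(B, m)\<close>, with the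
  subtree at \<open>(B, m)\<close> cut out.\<close>

function ctx :: "nat \<Rightarrow> nat \<Rightarrow> nat \<Rightarrow> nat \<Rightarrow> ('x, 'a) mpoly" where
  "ctx A n B m = (if n = m then if A = B then 1 else 0
     else if n < m then 0
     else \<Sum>C<s. \<Sum>D<s. \<Sum>j\<in>{1..<n}. mconst (heavy A C D (n - j) j) * F D j * ctx C (n - j) B m)"
  by auto
termination by (relation "measure (\<lambda>(A, n, B, m). n)") auto

declare ctx.simps [simp del]

lemma ctx_refl: "ctx A n B n = (if A = B then 1 else 0)"
  by (subst ctx.simps) simp

lemma ctx_less: "n < m \<Longrightarrow> ctx A n B m = 0"
  by (subst ctx.simps) simp

lemma ctx_step: "m < n \<Longrightarrow> ctx A n B m = step A n (\<lambda>C q. ctx C q B m)"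
  by (subst ctx.simps) (simp add: step_def)

text \<open>Degrees decrease along the heavy path, so there is a unique last node
  \<open>(G, p)\<close> of degree above \<open>T\<close>; its heavy child has degree at most
  \<open>T\<close>. The context \<open>ctx A n G p\<close> collects what lies above it, the
  truncated step what lies below. With \<open>X\<close> arbitrary, this cuts both trees and
  contexts.\<close>

lemma cut:
  assumes X: "\<And>A n. A < s \<Longrightarrow> T < n \<Longrightarrow> X A n = step A n X"
  shows "A < s \<Longrightarrow> T < n \<Longrightarrow> X A n =
    (\<Sum>G<s. \<Sum>p\<in>{T<..n}. ctx A n G p * step G p (\<lambda>C q. if q \<le> T then X C q else 0))"
proof (induction n arbitrary: A rule: less_induct)
  case (less n)
  let ?Y = "\<lambda>G p. step G p (\<lambda>C q. if q \<le> T then X C q else 0)"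
  have "X A n = step A n X" by (rule X[OF less.prems])
  also have "\<dots> = step A n (\<lambda>C q. (if q \<le> T then X C q else 0) +
      (\<Sum>G<s. \<Sum>p\<in>{T<..<n}. ctx C q G p * ?Y G p))"
  proof (rule step_cong)
    fix C q assume C: "C < s" "q < n"
    show "X C q = (if q \<le> T then X C q else 0) + (\<Sum>G<s. \<Sum>p\<in>{T<..<n}. ctx C q G p * ?Y G p)"
    proof (cases "q \<le> T")
      case True
      then show ?thesis by (simp add: ctx_less)
    next
      case False
      have "(\<Sum>p\<in>{T<..<n}. ctx C q G p * ?Y G p) = (\<Sum>p\<in>{T<..q}. ctx C q G p * ?Y G p)" for G
        by (rule sum.mono_neutral_right) (use C in \<open>auto simp: ctx_less\<close>)
      then show ?thesis using less.IH[OF C(2,1)] False by simp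
    qed
  qed
  also have "\<dots> = ?Y A n + (\<Sum>G<s. \<Sum>p\<in>{T<..<n}. step A n (\<lambda>C q. ctx C q G p) * ?Y G p)"
    by (simp only: step_add step_sum step_mult)
  also have "\<dots> = ?Y A n + (\<Sum>G<s. \<Sum>p\<in>{T<..<n}. ctx A n G p * ?Y G p)"
    by (simp add: ctx_step)
  also have "?Y A n = (\<Sum>G<s. ctx A n G n * ?Y G n)"
  proof -
    have "(\<Sum>G<s. ctx A n G n * ?Y G n) = (\<Sum>G<s. if A = G then ?Y G n else 0)"
      by (rule sum.cong) (auto simp: ctx_refl)
    then show ?thesis using less.prems(1) by (simp add: sum.delta)
  qed
  also have "(\<Sum>G<s. ctx A n G n * ?Y G n) + (\<Sum>G<s. \<Sum>p\<in>{T<..<n}. ctx A n G p * ?Y G p) =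
      (\<Sum>G<s. \<Sum>p\<in>{T<..n}. ctx A n G p * ?Y G p)"
  proof -
    have "{T<..n} = insert n {T<..<n}" using less.prems(2) by auto
    then show ?thesis by (simp add: sum.distrib)
  qed
  finally show ?case .
qed

text \<open>The values at hand at some stage of the reduction: trees of degree at most
  \<open>\<alpha>\<close> and contexts that miss a degree of at most \<open>\<beta>\<close>.\<close>

definition avail :: "nat \<Rightarrow> nat \<Rightarrow> nat \<Rightarrow> ('x, 'a) mpoly set" where
  "avail d \<alpha> \<beta> = {1} \<union> {F A n | A n. A < s \<and> 1 \<le> n \<and> n \<le> d \<and> n \<le> \<alpha>} \<union>
     {ctx A n B m | A n B m. A < s \<and> B < s \<and> 1 \<le> m \<and> m \<le> n \<and> n \<le> d \<and> n - m \<le> \<beta>}"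

lemma card_avail: "finite (avail d \<alpha> \<beta>) \<and> card (avail d \<alpha> \<beta>) \<le> 1 + s * d + (s * d)\<^sup>2"
proof -
  let ?N = "{..<s} \<times> {1..d}"
  let ?F = "(\<lambda>(A, n). F A n) ` ?N" and ?K = "(\<lambda>((A, n), (B, m)). ctx A n B m) ` (?N \<times> ?N)"
  have sub: "avail d \<alpha> \<beta> \<subseteq> {1} \<union> (?F \<union> ?K)"
    unfolding avail_def by (auto simp: image_iff) (force+)?
  have fin: "finite ({1} \<union> (?F \<union> ?K))" by blast
  have "card (avail d \<alpha> \<beta>) \<le> card ({1} \<union> (?F \<union> ?K))" by (rule card_mono[OF fin sub])
  also have "\<dots> \<le> 1 + (card ?F + card ?K)"
    using card_Un_le[of "{1}" "?F \<union> ?K"] card_Un_le[of ?F ?K] by simp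
  also have "card ?F \<le> s * d" by (rule order_trans[OF card_image_le]) auto
  also have "card ?K \<le> (s * d)\<^sup>2"
    by (rule order_trans[OF card_image_le]) (auto simp: card_cartesian_product power2_eq_square)
  finally show ?thesis using finite_subset[OF sub fin] by simp
qed

text \<open>Since \<open>heavy\<close> is 0 for \<open>p - j < j\<close>, only light children of at
  most half the degree have to be considered.\<close>

lemma lspan_mult_step:
  assumes "\<And>C D j. C < s \<Longrightarrow> D < s \<Longrightarrow> 1 \<le> j \<Longrightarrow> j < p \<Longrightarrow> j \<le> p - j \<Longrightarrow> a * F D j * X C (p - j) \<in> lspan S"
  shows "a * step G p X \<in> lspan S"
proof -
  have "a * step G p X = (\<Sum>B<s. \<Sum>D<s. \<Sum>j\<in>{1..<p}. mconst (heavy G B D (p - j) j) * (a * F D j * X B (p - j)))"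
    unfolding step_def by (simp add: sum_distrib_left mult_ac)
  also have "\<dots> \<in> lspan S"
  proof (intro lspan_sum)
    fix B D j assume *: "B \<in> {..<s}" "D \<in> {..<s}" "j \<in> {1..<p}"
    show "mconst (heavy G B D (p - j) j) * (a * F D j * X B (p - j)) \<in> lspan S"
    proof (cases "j \<le> p - j")
      case True
      then show ?thesis using * by (intro lspan_scale assms) auto
    next
      case False
      then show ?thesis by (simp add: heavy_def)
    qed
  qed
  finally show ?thesis .
qed

lemma avail_subset_lspan:
  assumes "1 \<in> lspan S"
    and "\<And>A n. A < s \<Longrightarrow> 1 \<le> n \<Longrightarrow> n \<le> d \<Longrightarrow> n \<le> \<alpha> \<Longrightarrow> F A n \<in> lspan S"
    and "\<And>A n B m. A < s \<Longrightarrow> B < s \<Longrightarrow> 1 \<le> m \<Longrightarrow> m \<le> n \<Longrightarrow> n \<le> d \<Longrightarrow> n - m \<le> \<beta> \<Longrightarrow> ctx A n B m \<in> lspan S"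
  shows "avail d \<alpha> \<beta> \<subseteq> lspan S"
  unfolding avail_def using assms by blast

lemma avail_F: "A < s \<Longrightarrow> 1 \<le> n \<Longrightarrow> n \<le> d \<Longrightarrow> n \<le> \<alpha> \<Longrightarrow> F A n \<in> avail d \<alpha> \<beta>"
  and avail_ctx: "A < s \<Longrightarrow> B < s \<Longrightarrow> 1 \<le> m \<Longrightarrow> m \<le> n \<Longrightarrow> n \<le> d \<Longrightarrow> n - m \<le> \<beta> \<Longrightarrow> ctx A n B m \<in> avail d \<alpha> \<beta>"
  and avail_1: "1 \<in> avail d \<alpha> \<beta>"
  unfolding avail_def by blast+

text \<open>What is already at hand survives a round in the form \<open>x * 1 * 1\<close>.\<close>

lemma avail_trans:
  assumes "finite T" "\<And>x y z. x \<in> avail d \<alpha> \<beta> \<Longrightarrow> y \<in> avail d \<alpha> \<beta> \<Longrightarrow> z \<in> avail d \<alpha> \<beta> \<Longrightarrow> x * y * z \<in> T"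
    "x \<in> avail d \<alpha> \<beta>"
  shows "x \<in> lspan T"
  using lspan_base[OF assms(1) assms(2)[OF assms(3) avail_1 avail_1]] by simp

text \<open>Contexts are doubled by cutting them at degree \<open>m + \<tau>\<close>, halfway
  between their ends. The light tree that is split off need not be small, so trees of degree
  \<open>2 * \<tau> + 1\<close> must already be at hand.\<close>

lemma ctx_step_avail:
  assumes "finite T" "\<And>x y z. x \<in> avail d (2 * \<tau> + 1) \<tau> \<Longrightarrow> y \<in> avail d (2 * \<tau> + 1) \<tau> \<Longrightarrow>
      z \<in> avail d (2 * \<tau> + 1) \<tau> \<Longrightarrow> x * y * z \<in> T"
  shows "avail d (2 * \<tau> + 1) (2 * \<tau> + 1) \<subseteq> lspan T"
proof (rule avail_subset_lspan)
  have tr: "x \<in> lspan T" if "x \<in> avail d (2 * \<tau> + 1) \<tau>" for x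
    by (rule avail_trans[where d = d and \<alpha> = "2 * \<tau> + 1" and \<beta> = \<tau>]) (fact assms(1), rule assms(2), assumption+, rule that)
  show "1 \<in> lspan T" by (rule tr[OF avail_1])
  show "F A n \<in> lspan T" if "A < s" "1 \<le> n" "n \<le> d" "n \<le> 2 * \<tau> + 1" for A n
    by (rule tr) (use that in \<open>auto intro: avail_F\<close>)
  show "ctx A n B m \<in> lspan T"
    if A: "A < s" "B < s" "1 \<le> m" "m \<le> n" "n \<le> d" "n - m \<le> 2 * \<tau> + 1" for A n B m
  proof (cases "n - m \<le> \<tau>")
    case True
    show ?thesis by (rule tr) (use A True in \<open>auto intro: avail_ctx\<close>)
  next
    case False
    then have n: "m + \<tau> < n" by simp
    have "ctx A n B m = (\<Sum>G<s. \<Sum>p\<in>{m + \<tau><..n}. ctx A n G p *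
        step G p (\<lambda>C q. if q \<le> m + \<tau> then ctx C q B m else 0))"
      by (rule cut[where X = "\<lambda>C q. ctx C q B m"]) (use A n in \<open>auto intro: ctx_step\<close>)
    also have "\<dots> \<in> lspan T"
    proof (intro lspan_sum lspan_mult_step)
      fix G p C D j
      assume *: "G \<in> {..<s}" "p \<in> {m + \<tau><..n}" "C < s" "D < s" "1 \<le> j" "j < p" "j \<le> p - j"
      show "ctx A n G p * F D j * (if p - j \<le> m + \<tau> then ctx C (p - j) B m else 0) \<in> lspan T"
      proof (cases "m \<le> p - j \<and> p - j \<le> m + \<tau>")
        case True
        \<comment> \<open>From \<open>n \<le> m + 2 * \<tau> + 1\<close> and
          \<open>m + \<tau> < p\<close> the upper context misses at most \<open>\<tau>\<close>; the
          lower one does by \<open>p - j \<le> m + \<tau>\<close>; and \<open>m \<le> p - j\<close>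
          gives \<open>j \<le> n - m \<le> 2 * \<tau> + 1\<close>.\<close>
        have "ctx A n G p * F D j * ctx C (p - j) B m \<in> T"
          by (rule assms(2)) (use * A n True in \<open>auto intro!: avail_ctx avail_F\<close>)
        then show ?thesis using True lspan_base[OF assms(1)] by simp
      next
        case False
        then show ?thesis by (auto simp: ctx_less)
      qed
    qed
    finally show ?thesis .
  qed
qed

text \<open>Trees are doubled by cutting their heavy path at degree \<open>\<tau>\<close>.\<close>

lemma F_step_avail:
  assumes "finite T" "1 \<le> \<tau>" "\<And>x y z. x \<in> avail d \<tau> \<tau> \<Longrightarrow> y \<in> avail d \<tau> \<tau> \<Longrightarrow>
      z \<in> avail d \<tau> \<tau> \<Longrightarrow> x * y * z \<in> T"
  shows "avail d (2 * \<tau> + 1) \<tau> \<subseteq> lspan T"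
proof (rule avail_subset_lspan)
  have tr: "x \<in> lspan T" if "x \<in> avail d \<tau> \<tau>" for x
    by (rule avail_trans[where d = d and \<alpha> = \<tau> and \<beta> = \<tau>]) (fact assms(1), rule assms(3), assumption+, rule that)
  show "1 \<in> lspan T" by (rule tr[OF avail_1])
  show "ctx A n B m \<in> lspan T"
    if "A < s" "B < s" "1 \<le> m" "m \<le> n" "n \<le> d" "n - m \<le> \<tau>" for A n B m
    by (rule tr) (use that in \<open>auto intro: avail_ctx\<close>)
  show "F A n \<in> lspan T" if A: "A < s" "1 \<le> n" "n \<le> d" "n \<le> 2 * \<tau> + 1" for A n
  proof (cases "n \<le> \<tau>")
    case True
    show ?thesis by (rule tr) (use A True in \<open>auto intro: avail_F\<close>)
  next
    case False
    then have n: "\<tau> < n" by simp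
    have "F A n = (\<Sum>G<s. \<Sum>p\<in>{\<tau><..n}. ctx A n G p * step G p (\<lambda>C q. if q \<le> \<tau> then F C q else 0))"
      by (rule cut[where X = F]) (use A n assms(2) in \<open>auto intro!: F_step\<close>)
    also have "\<dots> \<in> lspan T"
    proof (intro lspan_sum lspan_mult_step)
      fix G p C D j
      assume *: "G \<in> {..<s}" "p \<in> {\<tau><..n}" "C < s" "D < s" "1 \<le> j" "j < p" "j \<le> p - j"
      show "ctx A n G p * F D j * (if p - j \<le> \<tau> then F C (p - j) else 0) \<in> lspan T"
      proof (cases "p - j \<le> \<tau>")
        case True
        \<comment> \<open>Here \<open>n \<le> 2 * \<tau> + 1\<close> and \<open>\<tau> < p\<close>
          bound the degree missing in the context by \<open>\<tau>\<close>, and the light child is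
          bounded by the heavy one, \<open>j \<le> p - j \<le> \<tau>\<close>.\<close>
        have "ctx A n G p * F D j * F C (p - j) \<in> T"
          by (rule assms(3)) (use * A n True in \<open>auto intro!: avail_ctx avail_F\<close>)
        then show ?thesis using True lspan_base[OF assms(1)] by simp
      qed auto
    qed
    finally show ?thesis .
  qed
qed

text \<open>With \<open>\<tau> = 2 ^ i - 1\<close> the invariant is availability of degrees
  \<open>2 * \<tau> + 1\<close> for trees and \<open>\<tau>\<close> for contexts. It starts with
  linear forms and the trivial contexts 0 and 1. A round first brings the contexts up to
  \<open>2 * \<tau> + 1\<close> and then doubles the trees, with two layers for each.\<close>

lemma layered_avail:
  assumes vars: "finite vars" "\<And>A. A < s \<Longrightarrow> F A 1 = (\<Sum>x\<in>vars. mconst (l A x) * mvar x)"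
    and M: "card vars + 1 \<le> M" "(1 + s * d + (s * d)\<^sup>2) ^ 4 \<le> M"
  shows "\<exists>S. layered M (1 + 4 * i) S \<and> avail d (2 * (2 ^ i - 1) + 1) (2 ^ i - 1) \<subseteq> lspan S"
proof (induction i)
  case 0
  let ?S = "insert 1 (mvar ` vars) :: ('x, 'a) mpoly set"
  have w1: "1 \<in> wspan {1 :: ('x, 'a) mpoly}"
    using subsetD[OF lspan_subset_wspan lspan_base[of "{1}"]] by simp
  have wx: "mvar x \<in> wspan {1 :: ('x, 'a) mpoly}" for x
    unfolding wspan_def by (rule CollectI, rule exI[of _ "\<lambda>_. Inr x"]) simp
  have "layered M (Suc 0) ?S"
  proof (rule layered_Suc[OF layered_0])
    show "card ?S \<le> M"
      using card_image_le[OF vars(1), of "mvar :: _ \<Rightarrow> ('x, 'a) mpoly"] M(1) vars(1)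
      by (auto simp: card_insert_if)
    show "\<exists>x\<in>wspan {1}. \<exists>y\<in>wspan {1}. p = x * y" if "p \<in> ?S" for p
      using that w1 wx by (auto intro: bexI[of _ 1])
  qed (use vars in simp)
  moreover have "avail d 1 0 \<subseteq> lspan ?S"
  proof (rule avail_subset_lspan)
    show one: "1 \<in> lspan ?S" by (rule lspan_base) (use vars in auto)
    show "F A n \<in> lspan ?S" if "A < s" "1 \<le> n" "n \<le> d" "n \<le> 1" for A n
    proof -
      have "n = 1" using that by simp
      then have "F A n = (\<Sum>x\<in>vars. mconst (l A x) * mvar x)" using vars(2)[OF that(1)] by simp
      also have "\<dots> \<in> lspan ?S"
        by (intro lspan_sum lspan_scale lspan_base) (use vars(1) in auto)
      finally show ?thesis .
    qed
    show "ctx A n B m \<in> lspan ?S" if "m \<le> n" "n - m \<le> 0" for A n B m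
      using that one by (simp add: ctx_refl)
  qed
  ultimately show ?case by (intro exI[of _ ?S]) simp
next
  case (Suc i)
  let ?\<tau> = "2 ^ i - 1 :: nat"
  have cards: "finite (avail d \<alpha> \<beta>)" "card (avail d \<alpha> \<beta>) ^ 4 \<le> M" for \<alpha> \<beta>
    using card_avail[of d \<alpha> \<beta>] M(2) power_mono[of "card (avail d \<alpha> \<beta>)" "1 + s * d + (s * d)\<^sup>2" 4]
    by (blast, linarith)
  obtain S where S: "layered M (1 + 4 * i) S" "avail d (2 * ?\<tau> + 1) ?\<tau> \<subseteq> lspan S"
    using Suc by blast
  obtain T where T: "layered M (1 + 4 * i + 2) T" "finite T"
    "\<And>x y z. x \<in> avail d (2 * ?\<tau> + 1) ?\<tau> \<Longrightarrow> y \<in> avail d (2 * ?\<tau> + 1) ?\<tau> \<Longrightarrow> z \<in> avail d (2 * ?\<tau> + 1) ?\<tau> \<Longrightarrow> x * y * z \<in> T"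
    using layered_triple_products[OF S(1) cards(1) avail_1 S(2) cards(2)] by blast
  have av: "avail d (2 * ?\<tau> + 1) (2 * ?\<tau> + 1) \<subseteq> lspan T"
    by (rule ctx_step_avail[OF T(2,3)])
  let ?\<upsilon> = "2 * ?\<tau> + 1"
  obtain U where U: "layered M (1 + 4 * i + 2 + 2) U" "finite U"
    "\<And>x y z. x \<in> avail d ?\<upsilon> ?\<upsilon> \<Longrightarrow> y \<in> avail d ?\<upsilon> ?\<upsilon> \<Longrightarrow> z \<in> avail d ?\<upsilon> ?\<upsilon> \<Longrightarrow> x * y * z \<in> U"
    using layered_triple_products[OF T(1) cards(1) avail_1 av cards(2)] by blast
  have "avail d (2 * ?\<upsilon> + 1) ?\<upsilon> \<subseteq> lspan U"
    by (rule F_step_avail[OF U(2) _ U(3)]) simp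
  moreover have "?\<upsilon> = 2 ^ Suc i - 1"
    unfolding power_Suc using one_le_power[of "2::nat" i] by linarith
  ultimately have "avail d (2 * (2 ^ Suc i - 1) + 1) (2 ^ Suc i - 1) \<subseteq> lspan U" by (simp only:)
  moreover have "1 + 4 * i + 2 + 2 = 1 + 4 * Suc i" by simp
  ultimately show ?case using U(1) by (intro exI[of _ U]) (simp only:)
qed

end

text \<open>The depth \<open>4 * i + 3\<close> consists of \<open>1 + 4 * i\<close> layers that make
  degrees up to \<open>2 ^ Suc i - 1\<close> available and of the two layers that padding takes at
  least. The summands of the bound for \<open>M\<close> account for the fourfold products, the
  variables and the padding pair.\<close>

lemma depth_reduction:
  fixes f :: "('x, 'a::comm_ring_1) mpoly"
  assumes "circ_computes C f" "mdegree f \<le> d" "length C \<le> s" "d < 2 ^ Suc i"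
    and "(1 + s * d + (s * d)\<^sup>2) ^ 4 + s + 2 \<le> M" "4 * i + 3 \<le> D"
  shows "layered M D {f}"
proof -
  obtain F :: "nat \<Rightarrow> nat \<Rightarrow> ('x, 'a) mpoly" and \<gamma> :: "nat \<Rightarrow> nat \<Rightarrow> nat \<Rightarrow> 'a"
    and vars :: "'x set" and l :: "nat \<Rightarrow> 'x \<Rightarrow> 'a" and A a
    where *: "A < length C" "f = mconst a + (\<Sum>i\<in>{1..d}. F A i)"
    "finite vars" "card vars \<le> length C"
    "\<And>A. A < length C \<Longrightarrow> F A 1 = (\<Sum>x\<in>vars. mconst (l A x) * mvar x)"
    and rec: "\<And>A n. A < length C \<Longrightarrow> 2 \<le> n \<Longrightarrow> F A n =
       (\<Sum>B<length C. \<Sum>D<length C. mconst (\<gamma> A B D) * (\<Sum>j\<in>{1..<n}. F B j * F D (n - j)))"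
    by (rule grammar_of_circuit[OF assms(1,2)], rule that)
  interpret grammar "length C" F \<gamma> by unfold_locales (rule rec)
  let ?s = "length C"
  have "(1 + ?s * d + (?s * d)\<^sup>2) ^ 4 \<le> (1 + s * d + (s * d)\<^sup>2) ^ 4"
    by (intro power_mono add_mono mult_le_mono1 assms(3) order_refl) simp_all
  then have M: "card vars + 1 \<le> M" "(1 + ?s * d + (?s * d)\<^sup>2) ^ 4 \<le> M" "2 \<le> M"
    using assms(3,5) *(4) by linarith+
  obtain S where S: "layered M (1 + 4 * i) S" "avail d (2 * (2 ^ i - 1) + 1) (2 ^ i - 1) \<subseteq> lspan S"
    using layered_avail[OF *(3,5) M(1,2)] by blast
  have "d \<le> 2 * (2 ^ i - 1) + 1" using assms(4) one_le_power[of "2::nat" i] by simp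
  then have "F A n \<in> lspan S" if "n \<in> {1..d}" for n
    using that S(2) avail_F[OF *(1), of n d] by auto
  moreover have one: "1 \<in> lspan S" using S(2) avail_1 by blast
  ultimately have "f \<in> lspan S"
    unfolding *(2) using lspan_scale[OF one, of a] by (intro lspan_add lspan_sum) auto
  then have "layered M (1 + 4 * i + Suc (Suc (D - (4 * i + 3)))) {f}"
    by (rule layered_pad[OF S(1) one _ M(3)])
  moreover have "1 + 4 * i + Suc (Suc (D - (4 * i + 3))) = D" using assms(6) by simp
  ultimately show ?thesis by (simp only:)
qed

subsection \<open>Rigid graphs\<close>

text \<open>If \<open>y\<close> were the only neighbour of \<open>x\<close>, then \<open>x\<close>
  could be moved to another neighbour of \<open>y\<close>; if \<open>y\<close> has none,
  \<open>x\<close> and \<open>y\<close> can be exchanged. Either contradicts rigidity.\<close>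

lemma rigid_two_neighbours:
  assumes "wf_graph G" "connected_graph G" "rigid G" "u \<in> V G" "v \<in> V G" "u \<noteq> v" and x: "x \<in> V G"
  shows "\<exists>y z. y \<noteq> z \<and> {x, y} \<in> E G \<and> {x, z} \<in> E G"
proof (rule ccontr)
  assume no: "\<not> ?thesis"
  obtain a where a: "a \<in> V G" "a \<noteq> x" using assms(4-6) by (cases "u = x") auto
  have "(\<lambda>x y. {x, y} \<in> E G)\<^sup>*\<^sup>* x a" using assms(2) x a(1) by (simp add: connected_graph_def)
  then obtain y where y: "{x, y} \<in> E G" using a(2) by (auto elim: converse_rtranclpE)
  have edge: "p \<noteq> q \<and> p \<in> V G \<and> q \<in> V G" if "{p, q} \<in> E G" for p q
    using wf_graph_edgeD[OF assms(1) that] by (auto simp: doubleton_eq_iff)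
  have uniq: "z = y" if "{x, z} \<in> E G" for z using no y that by blast
  have not_hom: "\<not> is_hom G G \<phi>" if "\<phi> x \<noteq> x" for \<phi>
    using assms(3) x that unfolding rigid_def by blast
  have homI: "is_hom G G \<phi>"
    if "\<And>v. v \<in> V G \<Longrightarrow> \<phi> v \<in> V G" "\<And>p q. {p, q} \<in> E G \<Longrightarrow> {\<phi> p, \<phi> q} \<in> E G" for \<phi>
    unfolding is_hom_def
  proof (intro conjI ballI)
    fix e assume "e \<in> E G"
    moreover then obtain p q where "e = {p, q}" using wf_graph_edgeD[OF assms(1)] by blast
    ultimately show "\<phi> ` e \<in> E G" using that(2) by simp
  qed (rule that(1))
  show False
  proof (cases "\<exists>b. {y, b} \<in> E G \<and> b \<noteq> x")
    case True
    then obtain b where b: "{y, b} \<in> E G" "b \<noteq> x" by blast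
    have "is_hom G G (id(x := b))"
    proof (rule homI)
      fix p q assume pq: "{p, q} \<in> E G"
      have "p = x \<Longrightarrow> q = y" "q = x \<Longrightarrow> p = y"
        using pq uniq[of q] uniq[of p] by (simp_all add: insert_commute)
      then consider "p = x" "q = y" | "q = x" "p = y" | "p \<noteq> x" "q \<noteq> x" by blast
      then show "{(id(x := b)) p, (id(x := b)) q} \<in> E G"
        using pq b y edge[OF y] by cases (auto simp: insert_commute)
    qed (use edge[OF b(1)] in auto)
    then show False using not_hom[of "id(x := b)"] b(2) by simp
  next
    case False
    have "is_hom G G (id(x := y, y := x))"
    proof (rule homI)
      fix p q assume pq: "{p, q} \<in> E G"
      have "p = x \<Longrightarrow> q = y" "q = x \<Longrightarrow> p = y"
        using pq uniq[of q] uniq[of p] by (simp_all add: insert_commute)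
      moreover have "p = y \<Longrightarrow> q = x" "q = y \<Longrightarrow> p = x"
        using pq False by (auto simp: insert_commute)
      ultimately consider "p = x" "q = y" | "q = x" "p = y" | "p \<notin> {x, y}" "q \<notin> {x, y}" by blast
      then show "{(id(x := y, y := x)) p, (id(x := y, y := x)) q} \<in> E G"
        using pq edge[OF y] by cases (auto simp: insert_commute)
    qed (use edge[OF y] in auto)
    then show False using not_hom[of "id(x := y, y := x)"] edge[OF y] by auto
  qed
qed

text \<open>The choice of the neighbour depends on the time \<open>k\<close>, so that two walks can
  be made to differ in a single prescribed step.\<close>

primrec walk :: "(nat \<Rightarrow> 'v \<Rightarrow> 'v) \<Rightarrow> 'v \<Rightarrow> nat \<Rightarrow> 'v" where
  "walk nb a 0 = a"
| "walk nb a (Suc k) = nb k (walk nb a k)"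

lemma walk_cong: "(\<And>j. j < k \<Longrightarrow> nb j = nb' j) \<Longrightarrow> walk nb a k = walk nb' a k"
  by (induction k) auto

locale rigid_tree_graph = tree_graph I vl vr vp c
  for I :: "nat \<Rightarrow> 'v graph" and vl vr vp c +
  assumes conn: "i \<in> {0, 1, 2} \<Longrightarrow> connected_graph (I i)"
    and rigid: "i \<in> {0, 1, 2} \<Longrightarrow> rigid (I i)"
    and incomp: "i \<in> {0, 1, 2} \<Longrightarrow> j \<in> {0, 1, 2} \<Longrightarrow> i \<noteq> j \<Longrightarrow> incomparable (I i) (I j)"
    and cmax: "i \<in> {0, 1, 2} \<Longrightarrow> card (V (I i)) < c"
    and vl_vr: "i \<in> {0, 1, 2} \<Longrightarrow> vl i \<noteq> vr i"
    and vl_vp: "i \<in> {1, 2} \<Longrightarrow> vl i \<noteq> vp i"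
    and vr_vp: "i \<in> {1, 2} \<Longrightarrow> vr i \<noteq> vp i"
begin

lemma two_neighbours:
  "i \<in> {0, 1, 2} \<Longrightarrow> x \<in> V (I i) \<Longrightarrow> \<exists>y z. y \<noteq> z \<and> {x, y} \<in> E (I i) \<and> {x, z} \<in> E (I i)"
  by (rule rigid_two_neighbours[OF wf conn rigid vl vr vl_vr])

lemma edge_ends: "i \<in> {0, 1, 2} \<Longrightarrow> {x, y} \<in> E (I i) \<Longrightarrow> x \<noteq> y \<and> x \<in> V (I i) \<and> y \<in> V (I i)"
  using wf_graph_edgeD[OF wf, of i "{x, y}"] by (auto simp: doubleton_eq_iff)

lemma obtain_neighbours:
  obtains f g where "\<And>i x. i \<in> {0, 1, 2} \<Longrightarrow> x \<in> V (I i) \<Longrightarrow>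
    f i x \<noteq> g i x \<and> {x, f i x} \<in> E (I i) \<and> {x, g i x} \<in> E (I i)"
proof -
  have "\<forall>i x. \<exists>y z. i \<in> {0, 1, 2} \<longrightarrow> x \<in> V (I i) \<longrightarrow> y \<noteq> z \<and> {x, y} \<in> E (I i) \<and> {x, z} \<in> E (I i)"
    using two_neighbours by metis
  then show thesis using that by metis
qed

end

subsection \<open>The layered target graph\<close>

definition lb :: "nat \<Rightarrow> nat" where
  "lb d = (if d = 0 then 0 else if odd d then 1 else 2)"

lemma lb_range: "lb d \<in> {0, 1, 2}"
  by (simp add: lb_def)

lemma lb_Suc: "lb (Suc d) \<noteq> lb d" "lb (Suc d) \<in> {1, 2}"
  by (auto simp: lb_def)

lemma level_1: "level 1 = 0"
  by (simp add: level.simps)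

lemma level_double: "1 \<le> k \<Longrightarrow> level (2 * k) = Suc (level k)" "1 \<le> k \<Longrightarrow> level (2 * k + 1) = Suc (level k)"
  by (subst level.simps, simp)+

lemma level_less_iff: "1 \<le> k \<Longrightarrow> level k < D \<longleftrightarrow> k < 2 ^ D"
proof (induction D arbitrary: k)
  case (Suc D)
  show ?case
  proof (cases "k = 1")
    case False
    with Suc.prems have "level k = Suc (level (k div 2))" by (subst level.simps) simp
    moreover have "k div 2 < 2 ^ D \<longleftrightarrow> k < 2 ^ Suc D" by auto
    ultimately show ?thesis using Suc.IH[of "k div 2"] Suc.prems False by simp
  qed (use one_less_power[of "2::nat" "Suc D"] in \<open>simp add: level_1[simplified]\<close>)
qed simp

lemma lab_conv_lb: "1 \<le> k \<Longrightarrow> lab k = lb (level k)"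
  using level_less_iff[of k 1] by (cases "k = 1") (auto simp: lab_def lb_def level_1[simplified])

text \<open>\<open>HT d b x\<close> is the vertex \<open>x\<close> of the copy that stands for the node \<open>b\<close> of layer \<open>d\<close>, and
  \<open>HP d b s b' j\<close> is the \<open>j\<close>-th vertex of the path from the left (\<open>s\<close>) or right port of that copy
  to the copy of the node \<open>b'\<close> of the next layer.\<close>

datatype ('b, 'v) tvert = HT nat 'b 'v | HP nat 'b bool 'b nat

locale target = rigid_tree_graph I vl vr vp c
  for I :: "nat \<Rightarrow> 'v graph" and vl vr vp c +
  fixes D :: nat and B :: "nat \<Rightarrow> 'b set" and wt :: "nat \<Rightarrow> bool \<Rightarrow> 'b \<Rightarrow> 'b \<Rightarrow> 'r::comm_ring_1"
begin

definition port :: "bool \<Rightarrow> nat \<Rightarrow> 'v" where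
  "port s i = (if s then vl i else vr i)"

lemma port_in: "i \<in> {0, 1, 2} \<Longrightarrow> port s i \<in> V (I i)"
  using vl vr by (simp add: port_def)

lemma att_port: "att k = port (even k) (lab (k div 2))"
  by (simp add: att_def port_def)

text \<open>The coefficient sits on the first edge of a path alone; the other edges have weight 1,
  so a path as a whole contributes it once.\<close>

definition port_arc :: "nat \<Rightarrow> 'b \<Rightarrow> 'v \<Rightarrow> nat \<Rightarrow> 'b \<Rightarrow> bool \<Rightarrow> 'b \<Rightarrow> nat \<Rightarrow> 'r" where
  "port_arc d b x d' b1 s b2 j =
     (if d = d' \<and> b = b1 \<and> j = 1 \<and> x = port s (lb d) then wt d s b1 b2
      else if d = Suc d' \<and> b = b2 \<and> j = c \<and> x = vp (lb d) then 1 else 0)"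

fun arc :: "('b, 'v) tvert \<Rightarrow> ('b, 'v) tvert \<Rightarrow> 'r" where
  "arc (HT d b x) (HT d' b' x') = (if d = d' \<and> b = b' \<and> {x, x'} \<in> E (I (lb d)) then 1 else 0)"
| "arc (HT d b x) (HP d' b1 s b2 j) = port_arc d b x d' b1 s b2 j"
| "arc (HP d' b1 s b2 j) (HT d b x) = port_arc d b x d' b1 s b2 j"
| "arc (HP d b s b' j) (HP d1 b1 s1 b1' j1) =
     (if d = d1 \<and> b = b1 \<and> s = s1 \<and> b' = b1' \<and> (j1 = Suc j \<or> j = Suc j1) then 1 else 0)"

lemma arc_sym: "arc u v = arc v u"
  by (cases u; cases v) (auto simp: insert_commute)

lemma arc_refl: "arc u u = 0"
proof -
  have "{x, x} \<notin> E (I (lb d))" for x d using edge_ends[OF lb_range] by blast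
  then show ?thesis by (cases u) auto
qed

text \<open>Edges are unordered, so an arbitrary ordering is chosen; \<open>arc_sym\<close> makes
  the choice immaterial.\<close>

definition wgt :: "('b, 'v) tvert set \<Rightarrow> 'r" where
  "wgt e = (let p = SOME p. e = {fst p, snd p} in arc (fst p) (snd p))"

lemma wgt_pair: "wgt {u, v} = arc u v"
proof -
  let ?p = "SOME p. {u, v} = {fst p, snd p}"
  have "{u, v} = {fst ?p, snd ?p}" by (rule someI[of _ "(u, v)"]) simp
  then have "arc (fst ?p) (snd ?p) = arc u v"
    using arc_sym by (auto simp: doubleton_eq_iff)
  then show ?thesis by (simp add: wgt_def)
qed

definition VH :: "('b, 'v) tvert set" where
  "VH = {HT d b x | d b x. d \<le> D \<and> b \<in> B d \<and> x \<in> V (I (lb d))} \<union>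
     {HP d b s b' j | d b s b' j. d < D \<and> b \<in> B d \<and> b' \<in> B (Suc d) \<and> j \<in> {1..c}}"

lemma HT_VH: "HT d b x \<in> VH \<longleftrightarrow> d \<le> D \<and> b \<in> B d \<and> x \<in> V (I (lb d))"
  and HP_VH: "HP d b s b' j \<in> VH \<longleftrightarrow> d < D \<and> b \<in> B d \<and> b' \<in> B (Suc d) \<and> j \<in> {1..c}"
  by (auto simp: VH_def)

text \<open>A connected graph with fewer than \<open>c\<close> vertices misses a vertex of every path. The halves of
  the paths are folded back into the copies they are attached to, which turns a map into the target
  into a homomorphism between two of the graphs \<open>I\<close>.\<close>

definition cell :: "(nat \<Rightarrow> 'b \<Rightarrow> bool \<Rightarrow> 'b \<Rightarrow> nat) \<Rightarrow> ('b, 'v) tvert \<Rightarrow> nat \<times> 'b" where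
  "cell J u = (case u of HT d b x \<Rightarrow> (d, b)
     | HP d b s b' j \<Rightarrow> if j < J d b s b' then (d, b) else (Suc d, b'))"

text \<open>\<open>J\<close> gives the missed vertex of each path. Either half is laid along a walk
  that starts where the half is attached, the second one counted from the far end by
  \<open>Suc c - j\<close>. The free choice of the walks is what \<open>hom_copy\<close>
  exploits.\<close>

definition retr :: "(nat \<Rightarrow> nat \<Rightarrow> 'v \<Rightarrow> 'v) \<Rightarrow> (nat \<Rightarrow> 'b \<Rightarrow> bool \<Rightarrow> 'b \<Rightarrow> nat) \<Rightarrow> ('b, 'v) tvert \<Rightarrow> 'v" where
  "retr nb J u = (case u of HT d b x \<Rightarrow> x
     | HP d b s b' j \<Rightarrow> if j < J d b s b' then walk (nb (lb d)) (port s (lb d)) j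
                        else walk (nb (lb (Suc d))) (vp (lb (Suc d))) (Suc c - j))"

definition nb_ok :: "(nat \<Rightarrow> nat \<Rightarrow> 'v \<Rightarrow> 'v) \<Rightarrow> bool" where
  "nb_ok nb \<longleftrightarrow> (\<forall>i\<in>{0, 1, 2}. \<forall>k. \<forall>x\<in>V (I i). {x, nb i k x} \<in> E (I i))"

lemma walk_in: "nb_ok nb \<Longrightarrow> i \<in> {0, 1, 2} \<Longrightarrow> a \<in> V (I i) \<Longrightarrow> walk (nb i) a k \<in> V (I i)"
proof (induction k)
  case (Suc k)
  then show ?case using edge_ends[of i "walk (nb i) a k" "nb i k (walk (nb i) a k)"]
    by (auto simp: nb_ok_def)
qed simp

lemma walk_edge:
  "nb_ok nb \<Longrightarrow> i \<in> {0, 1, 2} \<Longrightarrow> a \<in> V (I i) \<Longrightarrow> {walk (nb i) a k, walk (nb i) a (Suc k)} \<in> E (I i)"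
  using walk_in[of nb i a k] by (auto simp: nb_ok_def)

lemma retr_in: "nb_ok nb \<Longrightarrow> u \<in> VH \<Longrightarrow> retr nb J u \<in> V (I (lb (fst (cell J u))))"
  by (cases u) (auto simp: retr_def cell_def HT_VH intro!: walk_in lb_range port_in vp lb_Suc(2))

lemma retr_port_arc:
  assumes nb: "nb_ok nb" and u: "HP d' b1 s b2 j \<in> VH" "HT d b x \<in> VH"
    and J: "1 \<le> J d' b1 s b2" "J d' b1 s b2 \<le> c" "j \<noteq> J d' b1 s b2"
    and arc: "port_arc d b x d' b1 s b2 j \<noteq> 0"
  shows "cell J (HP d' b1 s b2 j) = (d, b) \<and> {x, retr nb J (HP d' b1 s b2 j)} \<in> E (I (lb d))"
proof -
  from arc consider "d = d'" "b = b1" "j = 1" "x = port s (lb d)"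
    | "d = Suc d'" "b = b2" "j = c" "x = vp (lb d)"
    unfolding port_arc_def by (auto split: if_splits)
  then show ?thesis
  proof cases
    case 1
    then have "1 < J d' b1 s b2" using J by auto
    then show ?thesis using 1 walk_edge[OF nb lb_range port_in[OF lb_range], of d' s 0]
      by (simp add: cell_def retr_def)
  next
    case 2
    then have "\<not> c < J d' b1 s b2" using J by auto
    then show ?thesis using 2 walk_edge[OF nb lb_range vp[OF lb_Suc(2)], of d' 0]
      by (simp add: cell_def retr_def)
  qed
qed

lemma retr_path_arc:
  assumes nb: "nb_ok nb" and u: "HP d b s b' j \<in> VH" "HP d b s b' (Suc j) \<in> VH"
    and J: "j \<noteq> J d b s b'" "Suc j \<noteq> J d b s b'"
  shows "cell J (HP d b s b' j) = cell J (HP d b s b' (Suc j)) \<and>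
    {retr nb J (HP d b s b' j), retr nb J (HP d b s b' (Suc j))} \<in> E (I (lb (fst (cell J (HP d b s b' j)))))"
proof (cases "j < J d b s b'")
  case True
  then have "Suc j < J d b s b'" using J by auto
  then show ?thesis using True walk_edge[OF nb lb_range port_in[OF lb_range], of d s j]
    by (simp add: cell_def retr_def)
next
  case False
  moreover have "Suc c - j = Suc (Suc c - Suc j)" using u(2) by (auto simp: HP_VH)
  ultimately show ?thesis using walk_edge[OF nb lb_range vp[OF lb_Suc(2)], of d "Suc c - Suc j"]
    by (simp add: cell_def retr_def insert_commute del: walk.simps)
qed

text \<open>The cell changes along a path only at its missed vertex, so an arc that avoids these
  vertices stays within one cell.\<close>

lemma retr_arc:
  assumes nb: "nb_ok nb" and uv: "u \<in> VH" "v \<in> VH" "arc u v \<noteq> 0"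
    and J: "\<And>d b s b'. 1 \<le> J d b s b' \<and> J d b s b' \<le> c"
      "\<And>d b s b'. u \<noteq> HP d b s b' (J d b s b')" "\<And>d b s b'. v \<noteq> HP d b s b' (J d b s b')"
  shows "cell J u = cell J v \<and> {retr nb J u, retr nb J v} \<in> E (I (lb (fst (cell J u))))"
proof (cases u)
  case u: (HT d b x)
  show ?thesis
  proof (cases v)
    case (HT d' b' x')
    then show ?thesis using u uv(3) by (auto simp: cell_def retr_def split: if_splits)
  next
    case (HP d' b1 s b2 j)
    have "cell J v = (d, b) \<and> {x, retr nb J v} \<in> E (I (lb d))"
      unfolding HP by (rule retr_port_arc[OF nb]) (use u HP uv J(1) J(3)[of d' b1 s b2] in auto)
    then show ?thesis using u by (simp add: cell_def retr_def)
  qed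
next
  case u: (HP d b s b' j)
  show ?thesis
  proof (cases v)
    case (HT d' b'' x)
    have "cell J u = (d', b'') \<and> {x, retr nb J u} \<in> E (I (lb d'))"
      unfolding u by (rule retr_port_arc[OF nb]) (use u HT uv J(1) J(2)[of d b s b'] in auto)
    then show ?thesis using HT by (simp add: cell_def retr_def insert_commute)
  next
    case (HP d1 b1 s1 b2 j1)
    then have eq: "d = d1" "b = b1" "s = s1" "b' = b2" and "j1 = Suc j \<or> j = Suc j1"
      using u uv(3) by (auto split: if_splits)
    have J': "j \<noteq> J d b s b'" "j1 \<noteq> J d b s b'"
      using J(2)[of d b s b'] J(3)[of d b s b'] u HP eq by auto
    from \<open>j1 = Suc j \<or> j = Suc j1\<close> show ?thesis
    proof
      assume "j1 = Suc j"
      then show ?thesis using retr_path_arc[OF nb, of d b s b' j J] u HP uv(1,2) J' eq by auto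
    next
      assume "j = Suc j1"
      then show ?thesis using retr_path_arc[OF nb, of d b s b' j1 J] u HP uv(1,2) J' eq
        by (auto simp: insert_commute)
    qed
  qed
qed

text \<open>By connectedness the image lies in one cell, and folding it back gives a homomorphism
  from \<open>I i\<close> to \<open>I (lb d)\<close>. Incomparability forces
  \<open>lb d = i\<close>, and then rigidity forces the identity for every choice of the walks. A
  vertex on a path would be moved by changing the last step of its walk, so there is none.\<close>

lemma hom_copy:
  assumes i: "i \<in> {0, 1, 2}" and \<psi>: "\<And>x. x \<in> V (I i) \<Longrightarrow> \<psi> x \<in> VH"
    and arcs: "\<And>x y. {x, y} \<in> E (I i) \<Longrightarrow> arc (\<psi> x) (\<psi> y) \<noteq> 0"
  shows "\<exists>d b. d \<le> D \<and> b \<in> B d \<and> lb d = i \<and> (\<forall>x\<in>V (I i). \<psi> x = HT d b x)"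
proof -
  have fin: "finite (V (I i))" using wf[OF i] by (simp add: wf_graph_def)
  have "\<exists>j. j \<in> {1..c} \<and> HP d b s b' j \<notin> \<psi> ` V (I i)" for d b s b'
  proof (rule ccontr)
    assume no: "\<not> ?thesis"
    let ?P = "HP d b s b' ` {1..c} :: ('b, 'v) tvert set"
    from no have "?P \<subseteq> \<psi> ` V (I i)" by auto
    then have "card ?P \<le> card (\<psi> ` V (I i))" using fin by (intro card_mono) auto
    moreover have "card ?P = c" by (subst card_image) (auto simp: inj_on_def)
    ultimately show False using card_image_le[OF fin, of \<psi>] cmax[OF i] by simp
  qed
  then obtain J where J0: "\<And>d b s b'. J d b s b' \<in> {1..c} \<and> HP d b s b' (J d b s b') \<notin> \<psi> ` V (I i)"
    by metis
  then have J: "\<And>d b s b'. 1 \<le> J d b s b' \<and> J d b s b' \<le> c"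
    "\<And>x d b s b'. x \<in> V (I i) \<Longrightarrow> \<psi> x \<noteq> HP d b s b' (J d b s b')"
    by (simp, metis imageI)
  have edge: "cell J (\<psi> x) = cell J (\<psi> y) \<and>
      {retr nb J (\<psi> x), retr nb J (\<psi> y)} \<in> E (I (lb (fst (cell J (\<psi> x)))))"
    if "nb_ok nb" "{x, y} \<in> E (I i)" for nb x y
    by (rule retr_arc[OF that(1)]) (use edge_ends[OF i that(2)] \<psi> arcs[OF that(2)] J in auto)
  obtain f g where fg: "\<And>i x. i \<in> {0, 1, 2} \<Longrightarrow> x \<in> V (I i) \<Longrightarrow>
    f i x \<noteq> g i x \<and> {x, f i x} \<in> E (I i) \<and> {x, g i x} \<in> E (I i)"
    by (rule obtain_neighbours, rule that)
  define nb where "nb = (\<lambda>i (k::nat). f i)"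
  \<comment> \<open>The second walk deviates to the other neighbour at time \<open>K\<close>
    only.\<close>
  define nb' where "nb' K = (\<lambda>i k. if k = K then g i else f i)" for K :: nat
  have nb: "nb_ok nb" "nb_ok (nb' K)" for K
    using fg by (auto simp: nb_ok_def nb_def nb'_def)
  have walk_diff: "walk (nb l) a k \<noteq> walk (nb' (k - 1) l) a k"
    if "1 \<le> k" "l \<in> {0, 1, 2}" "a \<in> V (I l)" for l a k
  proof -
    from that(1) obtain K where K: "k = Suc K" by (cases k) auto
    have "walk (nb l) a K = walk (nb' K l) a K"
      by (rule walk_cong) (simp add: nb_def nb'_def)
    then show ?thesis using fg[OF that(2) walk_in[OF nb(1) that(2,3), of K]]
      unfolding K by (simp add: nb_def nb'_def)
  qed
  define r where "r = vl i"
  have r: "r \<in> V (I i)" using vl[OF i] by (simp add: r_def)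
  obtain d b where db: "cell J (\<psi> r) = (d, b)" by fastforce
  have cell: "cell J (\<psi> x) = (d, b)" if "x \<in> V (I i)" for x
  proof -
    have "(\<lambda>x y. {x, y} \<in> E (I i))\<^sup>*\<^sup>* r x"
      using conn[OF i] r that by (simp add: connected_graph_def)
    then show ?thesis
    proof (induction rule: rtranclp_induct)
      case base
      then show ?case by (rule db)
    next
      case (step y z)
      then show ?case using edge[OF nb(1)] by simp
    qed
  qed
  have hom: "is_hom (I i) (I (lb d)) (\<lambda>x. retr n J (\<psi> x))" if n: "nb_ok n" for n
    unfolding is_hom_def
  proof (intro conjI ballI)
    show "retr n J (\<psi> x) \<in> V (I (lb d))" if "x \<in> V (I i)" for x
      using retr_in[OF n \<psi>[OF that], of J] cell[OF that] by simp
    fix e assume "e \<in> E (I i)"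
    moreover then obtain x y where "e = {x, y}" "x \<in> V (I i)"
      using wf_graph_edgeD[OF wf[OF i]] by blast
    ultimately show "(\<lambda>x. retr n J (\<psi> x)) ` e \<in> E (I (lb d))"
      using edge[OF n, of x y] cell by simp
  qed
  have lbd: "lb d = i"
  proof (rule ccontr)
    assume "lb d \<noteq> i"
    then show False using incomp[OF i lb_range, of d] hom[OF nb(1)] unfolding incomparable_def by auto
  qed
  have fix_pt: "retr n J (\<psi> x) = x" if "nb_ok n" "x \<in> V (I i)" for n x
    using rigid[OF i] hom[OF that(1)] that(2) unfolding rigid_def lbd by blast
  have copy: "\<psi> x = HT d b x" if x: "x \<in> V (I i)" for x
  proof (cases "\<psi> x")
    case (HT d' b' y)
    then show ?thesis using cell[OF x] fix_pt[OF nb(1) x] by (simp add: cell_def retr_def)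
  next
    case (HP d' b1 s b2 j)
    then have j: "1 \<le> j" "1 \<le> Suc c - j" using \<psi>[OF x] by (auto simp: HP_VH)
    let ?k = "if j < J d' b1 s b2 then j else Suc c - j"
    have "retr nb J (\<psi> x) \<noteq> retr (nb' (?k - 1)) J (\<psi> x)"
    proof (cases "j < J d' b1 s b2")
      case True
      then show ?thesis unfolding HP
        using walk_diff[OF j(1) lb_range port_in[OF lb_range], of d' s] by (simp add: retr_def)
    next
      case False
      then show ?thesis unfolding HP
        using walk_diff[OF j(2) lb_range vp[OF lb_Suc(2)], of d'] by (simp add: retr_def del: diff_Suc_1)
    qed
    then show ?thesis using fix_pt[OF nb(1) x] fix_pt[OF nb(2) x] by simp
  qed
  moreover have "d \<le> D \<and> b \<in> B d" using \<psi>[OF r] copy[OF r] by (simp add: HT_VH)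
  ultimately show ?thesis using lbd by blast
qed

text \<open>The function \<open>\<rho>\<close> is the distance from the copy \<open>(d, b)\<close>,
  cut off at \<open>Suc c\<close>. It grows by at most 1 per edge but has to get from 0 to
  \<open>Suc c\<close> in \<open>Suc c\<close> steps, because the other end lies in a different
  copy. So it grows in every step and the path cannot turn back.\<close>

lemma path_unique:
  assumes p: "\<And>j. 1 \<le> j \<Longrightarrow> j \<le> c \<Longrightarrow> p j \<in> VH"
    and first: "arc (HT d b (port s (lb d))) (p 1) \<noteq> 0"
    and steps: "\<And>j. 1 \<le> j \<Longrightarrow> j < c \<Longrightarrow> arc (p j) (p (Suc j)) \<noteq> 0"
    and last: "arc (p c) (HT d' b' (vp (lb d'))) \<noteq> 0" and lb: "lb d' \<noteq> lb d"
  shows "d' = Suc d \<and> (\<forall>j. 1 \<le> j \<longrightarrow> j \<le> c \<longrightarrow> p j = HP d b s b' j)"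
proof -
  define \<rho> where "\<rho> u = (case u of HT d1 b1 x \<Rightarrow> if d1 = d \<and> b1 = b then 0 else Suc c
    | HP d1 b1 s1 b2 j \<Rightarrow> if d1 = d \<and> b1 = b then j else if Suc d1 = d \<and> b2 = b then Suc c - j else Suc c)" for u :: "('b, 'v) tvert"
  define rng where "rng u = (case u of HT d1 b1 x \<Rightarrow> True | HP d1 b1 s1 b2 j \<Rightarrow> 1 \<le> j \<and> j \<le> c)" for u :: "('b, 'v) tvert"
  have lip: "\<rho> v \<le> Suc (\<rho> u)" if "arc u v \<noteq> 0" "rng u" "rng v" for u v
    using that by (cases u; cases v) (auto simp: \<rho>_def rng_def port_arc_def split: if_splits)
  define q where "q j = (if j = 0 then HT d b (port s (lb d)) else if j = Suc c then HT d' b' (vp (lb d')) else p j)" for j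
  have q: "arc (q j) (q (Suc j)) \<noteq> 0" if "j \<le> c" for j
    using that first steps[of j] last c_pos by (cases "j = 0"; cases "j = c") (auto simp: q_def)
  have rng: "rng (q j)" if "j \<le> Suc c" for j
  proof (cases "j = 0 \<or> j = Suc c")
    case False
    with that have "p j \<in> VH" by (intro p) auto
    with False show ?thesis by (cases "p j") (auto simp: q_def rng_def HP_VH)
  qed (auto simp: q_def rng_def)
  have le: "j \<le> Suc c \<Longrightarrow> \<rho> (q j) \<le> j" for j
  proof (induction j)
    case 0
    then show ?case by (simp add: q_def \<rho>_def)
  next
    case (Suc j)
    then show ?case using lip[OF q rng rng, of j] by simp
  qed
  have ge: "j \<le> Suc c \<Longrightarrow> Suc c - j \<le> \<rho> (q (Suc c - j))" for j
  proof (induction j)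
    case 0
    have "(d', b') \<noteq> (d, b)" using lb by auto
    then show ?case by (auto simp: q_def \<rho>_def)
  next
    case (Suc j)
    then have "\<rho> (q (Suc (Suc c - Suc j))) \<le> Suc (\<rho> (q (Suc c - Suc j)))"
      using lip[of "q (Suc c - Suc j)" "q (Suc (Suc c - Suc j))"] q[of "Suc c - Suc j"] rng by simp
    moreover have "Suc (Suc c - Suc j) = Suc c - j" using Suc.prems by simp
    ultimately show ?case using Suc by simp
  qed
  have rho: "\<rho> (q j) = j" if "j \<le> Suc c" for j
    using le[OF that] ge[of "Suc c - j"] that by simp
  have rho_p: "\<rho> (p j) = j" if "1 \<le> j" "j \<le> c" for j
    using rho[of j] that by (simp add: q_def)
  have "\<exists>b2. p 1 = HP d b s b2 1"
  proof (cases "p 1")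
    case (HT d1 b1 x)
    then show ?thesis using first rho_p[of 1] c_pos by (auto simp: \<rho>_def split: if_splits)
  next
    case (HP d1 b1 t b2 j)
    \<comment> \<open>Distinctness of the ports excludes leaving along a path that comes from the
      previous layer, as such a path is attached at \<open>vp\<close>.\<close>
    have "\<not> (d = Suc d1 \<and> port s (lb d) = vp (lb d))"
      using vl_vp[OF lb_Suc(2)] vr_vp[OF lb_Suc(2)] by (auto simp: port_def)
    with first HP have "d = d1" "b = b1" "j = 1" "port s (lb d) = port t (lb d)"
      by (auto simp: port_arc_def split: if_splits)
    moreover from this(4) have "s = t"
      using vl_vr[OF lb_range, of d] by (auto simp: port_def split: if_splits)
    ultimately show ?thesis using HP by simp
  qed
  then obtain b2 where b2: "p 1 = HP d b s b2 1" by blast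
  have path: "j \<le> c \<Longrightarrow> p j = HP d b s b2 j" if "1 \<le> j" for j
    using that
  proof (induction j rule: dec_induct)
    case base
    then show ?case using b2 by simp
  next
    case (step j)
    then have ar: "arc (HP d b s b2 j) (p (Suc j)) \<noteq> 0" and r: "\<rho> (p (Suc j)) = Suc j"
      using steps[of j] rho_p[of "Suc j"] by auto
    show ?case
    proof (cases "p (Suc j)")
      case (HT d1 b1 x)
      then show ?thesis using ar r step by (auto simp: port_arc_def \<rho>_def split: if_splits)
    next
      case (HP d1 b1 t b3 j1)
      then show ?thesis using ar r step by (auto simp: \<rho>_def split: if_splits)
    qed
  qed
  have "port_arc d' b' (vp (lb d')) d b s b2 c \<noteq> 0"
    using last path[OF c_pos order_refl] by simp
  then have "d' = Suc d" "b' = b2" using lb by (auto simp: port_arc_def split: if_splits)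
  with path show ?thesis by simp
qed

end

section \<open>Embedding a target into a larger vertex set\<close>

lemma hom_sum_embed:
  assumes inj: "inj_on \<iota> U" and sub: "\<iota> ` U \<subseteq> W" and fin: "finite W" "finite (V G)" "finite (E G)"
    and E: "\<And>e. e \<in> E G \<Longrightarrow> e \<subseteq> V G" and V: "\<And>v. v \<in> V G \<Longrightarrow> \<exists>e\<in>E G. v \<in> e"
    and s: "\<And>e. \<not> e \<subseteq> \<iota> ` U \<Longrightarrow> s e = 0"
  shows "hom_sum G W s = hom_sum G U (\<lambda>e. s (\<iota> ` e))"
proof -
  have "hom_sum G W s = (\<Sum>\<phi>\<in>V G \<rightarrow>\<^sub>E \<iota> ` U. \<Prod>e\<in>E G. s (\<phi> ` e))"
    unfolding hom_sum_def
  proof (rule sum.mono_neutral_right)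
    show "finite (V G \<rightarrow>\<^sub>E W)" by (rule finite_PiE) (use fin in auto)
    show "V G \<rightarrow>\<^sub>E \<iota> ` U \<subseteq> V G \<rightarrow>\<^sub>E W" by (rule PiE_mono) (rule sub)
    show "\<forall>\<phi>\<in>(V G \<rightarrow>\<^sub>E W) - (V G \<rightarrow>\<^sub>E \<iota> ` U). (\<Prod>e\<in>E G. s (\<phi> ` e)) = 0"
    proof
      fix \<phi> assume "\<phi> \<in> (V G \<rightarrow>\<^sub>E W) - (V G \<rightarrow>\<^sub>E \<iota> ` U)"
      then obtain v where v: "v \<in> V G" "\<phi> v \<notin> \<iota> ` U" by (auto simp: PiE_iff)
      \<comment> \<open>A vertex mapped outside the embedded target is noticed only through an edge
        at it, hence the requirement that edges cover all vertices.\<close>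
      obtain e where e: "e \<in> E G" "v \<in> e" using V[OF v(1)] by blast
      have "s (\<phi> ` e) = 0" by (rule s) (use v e in blast)
      then show "(\<Prod>e\<in>E G. s (\<phi> ` e)) = 0" using e(1) fin(3) by (intro prod_zero) auto
    qed
  qed
  also have "\<dots> = hom_sum G U (\<lambda>e. s (\<iota> ` e))"
    unfolding hom_sum_def
  proof (rule sum.reindex_bij_witness[where i = "\<lambda>\<psi>. \<lambda>v\<in>V G. \<iota> (\<psi> v)"
        and j = "\<lambda>\<phi>. \<lambda>v\<in>V G. inv_into U \<iota> (\<phi> v)"])
    fix \<phi> assume \<phi>: "\<phi> \<in> V G \<rightarrow>\<^sub>E \<iota> ` U"
    then show "(\<lambda>v\<in>V G. \<iota> ((\<lambda>v\<in>V G. inv_into U \<iota> (\<phi> v)) v)) = \<phi>"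
      by (auto simp: fun_eq_iff PiE_iff extensional_def f_inv_into_f)
    show "(\<lambda>v\<in>V G. inv_into U \<iota> (\<phi> v)) \<in> V G \<rightarrow>\<^sub>E U"
      using \<phi> by (auto simp: PiE_iff inv_into_into)
    show "(\<Prod>e\<in>E G. s (\<iota> ` (\<lambda>v\<in>V G. inv_into U \<iota> (\<phi> v)) ` e)) = (\<Prod>e\<in>E G. s (\<phi> ` e))"
    proof (rule prod.cong[OF refl])
      fix e assume "e \<in> E G"
      then have "\<iota> ` (\<lambda>v\<in>V G. inv_into U \<iota> (\<phi> v)) ` e = \<phi> ` e"
        unfolding image_image using E \<phi> by (intro image_cong) (auto simp: PiE_iff f_inv_into_f subset_iff)
      then show "s (\<iota> ` (\<lambda>v\<in>V G. inv_into U \<iota> (\<phi> v)) ` e) = s (\<phi> ` e)" by simp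
    qed
  next
    fix \<psi> assume \<psi>: "\<psi> \<in> V G \<rightarrow>\<^sub>E U"
    then show "(\<lambda>v\<in>V G. inv_into U \<iota> ((\<lambda>v\<in>V G. \<iota> (\<psi> v)) v)) = \<psi>"
      using inj by (auto simp: fun_eq_iff PiE_iff extensional_def)
    show "(\<lambda>v\<in>V G. \<iota> (\<psi> v)) \<in> V G \<rightarrow>\<^sub>E \<iota> ` U" using \<psi> by (auto simp: PiE_iff)
  qed
  finally show ?thesis .
qed

context rigid_tree_graph begin

lemma E_Gm_pair:
  assumes "e \<in> E (Gm I vl vr vp c m)"
  obtains a b where "e = {a, b}"
proof -
  consider k where "e \<in> own k" | k where "e = link k" using assms unfolding E_Gm by blast
  then show thesis
  proof cases
    case 1
    then consider f where "f \<in> E (I (lab k))" "e = TV k ` f" | j where "e = {PV k j, PV k (Suc j)}"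
      | "e = {PV k c, TV k (vp (lab k))}"
      unfolding own_def by (auto split: if_splits)
    then show thesis
    proof cases
      case 1
      then obtain p q where "f = {p, q}" using wf_graph_edgeD[OF wf[OF lab_le_2]] by blast
      then show thesis using that[of "TV k p" "TV k q"] 1(2) by simp
    next
      case 2
      then show thesis by (rule that)
    next
      case 3
      then show thesis by (rule that)
    qed
  next
    case 2
    then show thesis using that unfolding link_def by blast
  qed
qed

lemma E_Gm_subset:
  assumes "e \<in> E (Gm I vl vr vp c m)" shows "e \<subseteq> V (Gm I vl vr vp c m)"
proof -
  consider k where "k \<in> {1..<2 * m}" "e \<in> own k" | k where "k \<in> {2..<2 * m}" "e = link k"
    using assms unfolding E_Gm by blast
  then show ?thesis
  proof cases
    case 1
    then show ?thesis unfolding V_Gm using own_subset by blast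
  next
    case 2
    then have "k div 2 \<in> {1..<2 * m}" "k \<in> {1..<2 * m}" "2 \<le> k" by auto
    then show ?thesis unfolding V_Gm 2(2) link_def using link_parent[of k] link_child[of k] by blast
  qed
qed

lemma V_Gm_covered:
  assumes "v \<in> V (Gm I vl vr vp c m)" shows "\<exists>e\<in>E (Gm I vl vr vp c m). v \<in> e"
proof -
  obtain k where k: "k \<in> {1..<2 * m}" "v \<in> block k" using assms unfolding V_Gm by blast
  have "\<exists>e\<in>own k. v \<in> e"
  proof -
    from k(2) consider x where "x \<in> V (I (lab k))" "v = TV k x"
      | j where "2 \<le> k" "j \<in> {1..c}" "v = PV k j"
      unfolding block_def by (auto split: if_splits)
    then show ?thesis
    proof cases
      case 1
      then obtain y where "{x, y} \<in> E (I (lab k))" using two_neighbours[OF lab_le_2] by blast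
      then have "TV k ` {x, y} \<in> own k" unfolding own_def by blast
      then show ?thesis unfolding 1(2) by (rule bexI[rotated]) simp
    next
      case 2
      have "{PV k j, PV k (Suc j)} \<in> own k" if "j \<noteq> c"
      proof -
        have "j \<in> {1..<c}" using 2(2) that by auto
        then show ?thesis using 2(1) by (simp add: own_def)
      qed
      moreover have "{PV k c, TV k (vp (lab k))} \<in> own k" using 2(1) unfolding own_def by simp
      ultimately show ?thesis unfolding 2(3) by (cases "j = c") (auto intro: bexI[rotated])
    qed
  qed
  then show ?thesis using k(1) unfolding E_Gm by blast
qed

end

section \<open>The value of the homomorphism sum into the target\<close>

locale valued_target = target I vl vr vp c D B wt
  for I :: "nat \<Rightarrow> 'v graph" and vl vr vp c D
    and B :: "nat \<Rightarrow> 'b set" and wt :: "nat \<Rightarrow> bool \<Rightarrow> 'b \<Rightarrow> 'b \<Rightarrow> 'r::comm_ring_1" +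
  fixes val :: "'b \<Rightarrow> 'r" and root :: 'b
  assumes finite_B: "d \<le> D \<Longrightarrow> finite (B d)"
    and val_leaf: "b \<in> B D \<Longrightarrow> val b = 1"
    and val_step: "d < D \<Longrightarrow> b \<in> B d \<Longrightarrow> val b =
        (\<Sum>b'\<in>B (Suc d). wt d True b b' * val b') * (\<Sum>b'\<in>B (Suc d). wt d False b b' * val b')"
    and B_0: "B 0 = {root}"
begin

abbreviation "states k \<equiv> block k \<rightarrow>\<^sub>E VH"
abbreviation "om k x \<equiv> \<Prod>e\<in>own k. wgt (x ` e)"
abbreviation "ep k x y \<equiv> wgt {x (TV (k div 2) (att k)), y (PV k 1)}"

text \<open>The intended map of a block: the node to the copy of \<open>b'\<close>, its path to the
  one coming from \<open>b\<close>. At the root the truncated difference \<open>level k - 1\<close>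
  does no harm, since \<open>block 1\<close> contains no path.\<close>

definition std :: "nat \<Rightarrow> 'b \<Rightarrow> 'b \<Rightarrow> 'v gvert \<Rightarrow> ('b, 'v) tvert" where
  "std k b b' = (\<lambda>v\<in>block k. case v of TV _ x \<Rightarrow> HT (level k) b' x
     | PV _ j \<Rightarrow> HP (level k - 1) b (even k) b' j)"

lemma card_VH:
  assumes M: "\<And>d. d \<le> D \<Longrightarrow> card (B d) \<le> M"
  shows "finite VH \<and> card VH \<le> (D + 1) * (M * c) + D * (M * (2 * (M * c)))"
proof -
  let ?H = "\<lambda>d. (\<lambda>(b, x). HT d b x :: ('b, 'v) tvert) ` (B d \<times> V (I (lb d)))"
  let ?P = "\<lambda>d. (\<lambda>(b, s, b', j). HP d b s b' j :: ('b, 'v) tvert) ` (B d \<times> (UNIV :: bool set) \<times> B (Suc d) \<times> {1..c})"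
  have VH: "VH = (\<Union>d\<in>{..D}. ?H d) \<union> (\<Union>d\<in>{..<D}. ?P d)"
  proof (intro set_eqI)
    fix u show "u \<in> VH \<longleftrightarrow> u \<in> (\<Union>d\<in>{..D}. ?H d) \<union> (\<Union>d\<in>{..<D}. ?P d)"
      by (cases u) (auto simp: HT_VH HP_VH image_iff)
  qed
  have finV: "finite (V (I (lb d)))" for d using wf[OF lb_range] by (simp add: wf_graph_def)
  have "card (?H d) \<le> M * c" if "d \<le> D" for d
  proof -
    have "card (?H d) \<le> card (B d \<times> V (I (lb d)))"
      by (rule card_image_le) (use finite_B[OF that] finV in simp)
    also have "\<dots> \<le> M * c"
      unfolding card_cartesian_product using M[OF that] cmax[OF lb_range, of d] by (intro mult_le_mono) auto
    finally show ?thesis .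
  qed
  then have "(\<Sum>d\<in>{..D}. card (?H d)) \<le> (\<Sum>d\<in>{..D}. M * c)" by (intro sum_mono) simp
  then have H: "card (\<Union>d\<in>{..D}. ?H d) \<le> (D + 1) * (M * c)"
    using card_UN_le[of "{..D}" ?H] by simp
  have "card (?P d) \<le> M * (2 * (M * c))" if "d < D" for d
  proof -
    have "card (?P d) \<le> card (B d \<times> (UNIV :: bool set) \<times> B (Suc d) \<times> {1..c})"
      by (rule card_image_le) (use finite_B[of d] finite_B[of "Suc d"] that in simp)
    also have "\<dots> \<le> M * (2 * (M * c))"
      unfolding card_cartesian_product using M[of d] M[of "Suc d"] that by (intro mult_le_mono) auto
    finally show ?thesis .
  qed
  then have "(\<Sum>d\<in>{..<D}. card (?P d)) \<le> (\<Sum>d\<in>{..<D}. M * (2 * (M * c)))" by (intro sum_mono) simp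
  then have P: "card (\<Union>d\<in>{..<D}. ?P d) \<le> D * (M * (2 * (M * c)))"
    using card_UN_le[of "{..<D}" ?P] by simp
  have "finite VH" unfolding VH using finite_B finV by auto
  moreover have "card VH \<le> card (\<Union>d\<in>{..D}. ?H d) + card (\<Union>d\<in>{..<D}. ?P d)"
    unfolding VH by (rule card_Un_le)
  ultimately show ?thesis using H P by linarith
qed

lemma finite_states: "finite (states k)"
proof -
  have "finite VH"
    using card_VH[of "\<Sum>d\<le>D. card (B d)"] member_le_sum[of _ "{..D}" "\<lambda>d. card (B d)"] by auto
  then show ?thesis by (intro finite_PiE finite_block)
qed

lemma om_nonzero:
  assumes "om k x \<noteq> 0" "e \<in> own k" shows "wgt (x ` e) \<noteq> 0"
  using assms finite_own[of k] by (metis prod_zero)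

lemma om_nonzero_copy:
  assumes x: "x \<in> states k" "om k x \<noteq> 0"
  shows "\<exists>d b. d \<le> D \<and> b \<in> B d \<and> lb d = lab k \<and> (\<forall>v\<in>V (I (lab k)). x (TV k v) = HT d b v)"
proof (rule hom_copy[OF lab_le_2])
  show "x (TV k v) \<in> VH" if "v \<in> V (I (lab k))" for v
    using x(1) that by (intro PiE_mem[OF x(1)]) (simp add: block_def)
  show "arc (x (TV k u)) (x (TV k v)) \<noteq> 0" if "{u, v} \<in> E (I (lab k))" for u v
  proof -
    have "TV k ` {u, v} \<in> own k" using that unfolding own_def by blast
    from om_nonzero[OF x(2) this] show ?thesis by (simp add: wgt_pair)
  qed
qed

text \<open>The only edge with a coefficient is the first one of the path, which is
  \<open>link k\<close> and does not belong to \<open>own k\<close>.\<close>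

lemma om_std:
  assumes k: "1 \<le> k" shows "om k (std k b b') = 1"
proof (rule prod.neutral, rule ballI)
  fix e assume e: "e \<in> own k"
  then consider f where "f \<in> E (I (lab k))" "e = TV k ` f"
    | j where "2 \<le> k" "j \<in> {1..<c}" "e = {PV k j, PV k (Suc j)}"
    | "2 \<le> k" "e = {PV k c, TV k (vp (lab k))}"
    unfolding own_def by (auto split: if_splits)
  then show "wgt (std k b b' ` e) = 1"
  proof cases
    case 1
    obtain p q where pq: "f = {p, q}" using wf_graph_edgeD[OF wf[OF lab_le_2] 1(1)] by blast
    then have "p \<in> V (I (lab k))" "q \<in> V (I (lab k))" using edge_ends[OF lab_le_2] 1(1) by auto
    then show ?thesis using 1 pq by (simp add: std_def block_def wgt_pair lab_conv_lb[OF k])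
  next
    case 2
    then show ?thesis by (simp add: std_def block_def wgt_pair)
  next
    case 3
    have "0 < level k" using 3(1) level_less_iff[of k 1] by auto
    then have "level k \<noteq> level k - Suc 0" by simp
    moreover have "vp (lab k) \<in> V (I (lab k))" by (intro vp lab_child) (use 3 in simp)
    ultimately show ?thesis using 3 c_pos \<open>0 < level k\<close>
      by (simp add: std_def block_def wgt_pair port_arc_def lab_conv_lb[OF k])
  qed
qed

lemma std_in_states:
  assumes k: "2 \<le> k" "level k = Suc l" "l < D" and b: "b \<in> B l" "b' \<in> B (Suc l)"
  shows "std k b b' \<in> states k"
proof (rule PiE_I)
  fix v assume "v \<in> block k"
  then show "std k b b' v \<in> VH"
    using k b lab_conv_lb[of k] by (auto simp: std_def block_def HT_VH HP_VH)
qed (simp add: std_def)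

text \<open>For a surviving summand \<open>hom_copy\<close> yields a copy with the right label, but
  in an unknown layer; \<open>path_unique\<close> then places it in the next layer and fixes the
  whole path. Hence only the maps \<open>std k' b b'\<close> remain.\<close>

lemma child_sum:
  assumes k: "1 \<le> k" "k' \<in> {2 * k, 2 * k + 1}" "level k < D" and b: "b \<in> B (level k)"
    and x: "\<And>v. v \<in> V (I (lab k)) \<Longrightarrow> x (TV k v) = HT (level k) b v"
    and T: "\<And>y. om k' y = 0 \<Longrightarrow> T y = 0"
  shows "(\<Sum>y\<in>states k'. ep k' x y * T y) =
    (\<Sum>b'\<in>B (Suc (level k)). wt (level k) (even k') b b' * T (std k' b b'))"
proof -
  let ?l = "level k"
  have k': "2 \<le> k'" "k' div 2 = k" "level k' = Suc ?l" using k(1,2) level_double[OF k(1)] by auto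
  have lab': "lab k' = lb (Suc ?l)" using lab_conv_lb[of k'] k' by simp
  have lab: "lab k = lb ?l" by (rule lab_conv_lb[OF k(1)])
  have att: "att k' = port (even k') (lb ?l)" using att_port k' lab by simp
  have xatt: "x (TV (k' div 2) (att k')) = HT ?l b (port (even k') (lb ?l))"
    using x[of "att k'"] port_in[OF lb_range, of "even k'" ?l] unfolding k' att lab by simp
  have vp': "vp (lab k') \<in> V (I (lab k'))" unfolding lab' by (rule vp[OF lb_Suc(2)])
  have inj: "inj_on (std k' b) (B (Suc ?l))"
  proof (rule inj_onI)
    fix b1 b2 assume "std k' b b1 = std k' b b2"
    then have "std k' b b1 (TV k' (vp (lab k'))) = std k' b b2 (TV k' (vp (lab k')))" by simp
    then show "b1 = b2" using vp' by (simp add: std_def block_def)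
  qed
  have "(\<Sum>y\<in>states k'. ep k' x y * T y) = (\<Sum>y\<in>std k' b ` B (Suc ?l). ep k' x y * T y)"
  proof (rule sum.mono_neutral_right[OF finite_states])
    show "std k' b ` B (Suc ?l) \<subseteq> states k'"
      using std_in_states[OF k'(1,3) k(3) b] by blast
    show "\<forall>y\<in>states k' - std k' b ` B (Suc ?l). ep k' x y * T y = 0"
    proof (rule ballI, rule ccontr)
      fix y assume y: "y \<in> states k' - std k' b ` B (Suc ?l)" and ne: "ep k' x y * T y \<noteq> 0"
      then have om: "om k' y \<noteq> 0" and ep: "ep k' x y \<noteq> 0" using T[of y] by (fastforce, fastforce)
      obtain d b' where db: "d \<le> D" "b' \<in> B d" "lb d = lab k'"
        "\<And>v. v \<in> V (I (lab k')) \<Longrightarrow> y (TV k' v) = HT d b' v"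
        using om_nonzero_copy[OF _ om] y by blast
      have "d = Suc ?l \<and> (\<forall>j. 1 \<le> j \<longrightarrow> j \<le> c \<longrightarrow> y (PV k' j) = HP ?l b (even k') b' j)"
      proof (rule path_unique)
        show "y (PV k' j) \<in> VH" if "1 \<le> j" "j \<le> c" for j
          using y that k'(1) by (intro PiE_mem[of y "block k'"]) (auto simp: block_def)
        show "arc (HT ?l b (port (even k') (lb ?l))) (y (PV k' 1)) \<noteq> 0"
          using ep unfolding xatt wgt_pair .
        show "arc (y (PV k' j)) (y (PV k' (Suc j))) \<noteq> 0" if "1 \<le> j" "j < c" for j
        proof -
          have "{PV k' j, PV k' (Suc j)} \<in> own k'" using that k'(1) by (auto simp: own_def)
          from om_nonzero[OF om this] show ?thesis by (simp add: wgt_pair)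
        qed
        have "{PV k' c, TV k' (vp (lab k'))} \<in> own k'" using k'(1) by (simp add: own_def)
        from om_nonzero[OF om this] show "arc (y (PV k' c)) (HT d b' (vp (lb d))) \<noteq> 0"
          using db(4)[OF vp'] by (simp add: wgt_pair db(3))
        show "lb d \<noteq> lb ?l" using db(3) lab' lb_Suc(1) by simp
      qed
      then have d: "d = Suc ?l" and path: "\<And>j. 1 \<le> j \<Longrightarrow> j \<le> c \<Longrightarrow> y (PV k' j) = HP ?l b (even k') b' j"
        by blast+
      have "y = std k' b b'"
      proof (rule PiE_ext[of _ "block k'" "\<lambda>_. VH"])
        show "y \<in> states k'" using y by blast
        show "std k' b b' \<in> states k'" using std_in_states[OF k'(1,3) k(3) b] db(2) d by blast
        show "y v = std k' b b' v" if "v \<in> block k'" for v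
          using that db(4) path d k' by (auto simp: std_def block_def)
      qed
      then show False using y db(2) d by blast
    qed
  qed
  also have "\<dots> = (\<Sum>b'\<in>B (Suc ?l). ep k' x (std k' b b') * T (std k' b b'))"
    by (subst sum.reindex[OF inj]) simp
  also have "\<dots> = (\<Sum>b'\<in>B (Suc ?l). wt ?l (even k') b b' * T (std k' b b'))"
  proof (rule sum.cong[OF refl])
    fix b' assume "b' \<in> B (Suc ?l)"
    have "std k' b b' (PV k' 1) = HP ?l b (even k') b' 1"
      using link_child[OF k'(1)] k'(3) by (simp add: std_def)
    then show "ep k' x (std k' b b') * T (std k' b b') = wt ?l (even k') b b' * T (std k' b b')"
      unfolding xatt wgt_pair by (simp add: port_arc_def)
  qed
  finally show ?thesis .
qed

abbreviation "tv \<equiv> tree_val states (\<lambda>k x. om k x) (\<lambda>k x y. ep k x y) (2 ^ D)"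

text \<open>The leaves have level \<open>D\<close>, where \<open>val_leaf\<close> applies. At an
  inner node the two child sums are the factors of \<open>val_step\<close>, told apart by the parity
  of the heap index.\<close>

lemma tree_val_copy:
  assumes "1 \<le> k" "k < 2 * 2 ^ D" "b \<in> B (level k)" "om k x = 1"
    and "\<And>v. v \<in> V (I (lab k)) \<Longrightarrow> x (TV k v) = HT (level k) b v"
  shows "tv k x = val b"
  using assms
proof (induction "2 * 2 ^ D - k" arbitrary: k x b rule: less_induct)
  case less
  let ?l = "level k"
  have zero: "tv k' y = 0" if "om k' y = 0" for k' y
    using that by (subst tree_val.simps) simp
  show ?case
  proof (cases "k < 2 ^ D")
    case False
    then have "\<not> ?l < D" using less.prems(1) by (simp add: level_less_iff)
    moreover have "?l < Suc D" using less.prems(1,2) level_less_iff[of k "Suc D"] by simp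
    ultimately have "?l = D" by simp
    then show ?thesis using False less.prems val_leaf by (subst tree_val.simps) simp
  next
    case True
    then have l: "?l < D" using less.prems(1) by (simp add: level_less_iff)
    have child: "(\<Sum>y\<in>states k'. ep k' x y * tv k' y) =
        (\<Sum>b'\<in>B (Suc ?l). wt ?l (even k') b b' * val b')" if k': "k' \<in> {2 * k, 2 * k + 1}" for k'
    proof -
      have lev: "level k' = Suc ?l" "1 \<le> k'" using k' level_double[OF less.prems(1)] less.prems(1) by auto
      have "(\<Sum>y\<in>states k'. ep k' x y * tv k' y) =
          (\<Sum>b'\<in>B (Suc ?l). wt ?l (even k') b b' * tv k' (std k' b b'))"
        by (rule child_sum[OF less.prems(1) k' l less.prems(3,5) zero])
      also have "\<dots> = (\<Sum>b'\<in>B (Suc ?l). wt ?l (even k') b b' * val b')"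
      proof (rule sum.cong[OF refl])
        fix b' assume "b' \<in> B (Suc ?l)"
        then have "tv k' (std k' b b') = val b'"
          by (intro less.hyps om_std)
            (use k' lev less.prems(1) True in \<open>auto simp: std_def block_def\<close>)
        then show "wt ?l (even k') b b' * tv k' (std k' b b') = wt ?l (even k') b b' * val b'" by simp
      qed
      finally show ?thesis .
    qed
    have "tv k x = om k x * ((\<Sum>y\<in>states (2 * k). ep (2 * k) x y * tv (2 * k) y) *
        (\<Sum>y\<in>states (2 * k + 1). ep (2 * k + 1) x y * tv (2 * k + 1) y))"
      using True less.prems(1) by (subst tree_val.simps) (simp only: if_True conj_absorb, simp)
    also have "\<dots> = val b"
      unfolding less.prems(4) child[OF insertI1] child[OF insertI2[OF singletonI]]
      using val_step[OF l less.prems(3)] by simp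
    finally show ?thesis .
  qed
qed

lemma hom_sum_target: "hom_sum (Gm I vl vr vp c (2 ^ D)) VH wgt = val root"
proof -
  let ?x = "std 1 root root"
  have lab1: "lab 1 = 0" "lb 0 = 0" "level 1 = 0" by (simp_all add: lab_def lb_def level_1[simplified])
  have x: "?x \<in> states 1"
  proof (rule PiE_I)
    fix v assume "v \<in> block 1"
    then show "?x v \<in> VH" using lab1 B_0 by (auto simp: std_def block_def HT_VH)
  qed (simp add: std_def)
  have "hom_sum (Gm I vl vr vp c (2 ^ D)) VH wgt = (\<Sum>x\<in>states 1. tv 1 x)"
    by (rule hom_sum_Gm) simp
  also have "\<dots> = (\<Sum>x\<in>{?x}. tv 1 x)"
  proof (rule sum.mono_neutral_right[OF finite_states])
    show "{?x} \<subseteq> states 1" using x by simp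
    show "\<forall>y\<in>states 1 - {?x}. tv 1 y = 0"
    proof (rule ballI, rule ccontr)
      fix y assume y: "y \<in> states 1 - {?x}" "tv 1 y \<noteq> 0"
      have om: "om 1 y \<noteq> 0"
      proof
        assume "om 1 y = 0"
        then have "tv 1 y = 0" by (subst tree_val.simps) simp
        with y(2) show False by simp
      qed
      obtain d b where db: "b \<in> B d" "lb d = lab 1" "\<And>v. v \<in> V (I (lab 1)) \<Longrightarrow> y (TV 1 v) = HT d b v"
        using om_nonzero_copy[OF _ om] y(1) by blast
      \<comment> \<open>The label 0 occurs in layer 0 only, which anchors the root and thereby all
        layers below it.\<close>
      then have "d = 0" "b = root" using lab1 B_0 by (auto simp: lb_def split: if_splits)
      have "y = ?x"
      proof (rule PiE_ext[OF _ x])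
        show "y \<in> states 1" using y by blast
        show "y v = ?x v" if "v \<in> block 1" for v
          using that db(3) \<open>d = 0\<close> \<open>b = root\<close> lab1 by (auto simp: std_def block_def)
      qed
      with y show False by simp
    qed
  qed
  also have "\<dots> = tv 1 ?x" by simp
  also have "\<dots> = val root"
  proof (rule tree_val_copy)
    show "om 1 ?x = 1" by (rule om_std) simp
    show "?x (TV 1 v) = HT (level 1) root v" if "v \<in> V (I (lab 1))" for v
      using that by (simp add: std_def block_def)
    show "1 < 2 * (2::nat) ^ D" using one_le_power[of "2::nat" D] by linarith
  qed (use B_0 lab1 in auto)
  finally show ?thesis .
qed

end

section \<open>The projection and the choice of its parameters\<close>

lemma (in target) arc_range:
  assumes "{0, 1} \<subseteq> R" "\<And>d s b b'. wt d s b b' \<in> R"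
  shows "arc u v \<in> R"
  using assms by (cases u; cases v) (auto simp: port_arc_def)

context rigid_tree_graph begin

lemma is_projection_layered:
  fixes f :: "('x, 'a::comm_ring_1) mpoly"
  assumes "layered M D {f}" "1 \<le> M"
    and size: "(D + 1) * (M * c) + D * (M * (2 * (M * c))) \<le> (2 ^ D) ^ 6"
  shows "is_projection f (hom_poly (Gm I vl vr vp c (2 ^ D)) (Hm (2 ^ D)))"
proof -
  obtain B where B: "B 0 = {f}" "B D = {1}" "\<And>d. 0 < d \<Longrightarrow> d \<le> D \<Longrightarrow> finite (B d)"
    "\<And>d. 0 < d \<Longrightarrow> d < D \<Longrightarrow> card (B d) \<le> M"
    "\<And>d p. d < D \<Longrightarrow> p \<in> B d \<Longrightarrow> \<exists>x\<in>wspan (B (Suc d)). \<exists>y\<in>wspan (B (Suc d)). p = x * y"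
    by (rule layered_chain[OF assms(1)], rule that)
  have fin: "finite (B d)" and card: "card (B d) \<le> M" if "d \<le> D" for d
  proof -
    show "finite (B d)" using B(1) B(3)[of d] that by (cases "d = 0") auto
    show "card (B d) \<le> M"
      using B(1,2) B(4)[of d] that assms(2) by (cases "d = 0"; cases "d = D") auto
  qed
  have "\<forall>d p. \<exists>w w'. d < D \<longrightarrow> p \<in> B d \<longrightarrow> p = (\<Sum>b\<in>B (Suc d). case_sum mconst mvar (w b) * b) *
      (\<Sum>b\<in>B (Suc d). case_sum mconst mvar (w' b) * b)"
  proof (intro allI)
    fix d p
    show "\<exists>w w'. d < D \<longrightarrow> p \<in> B d \<longrightarrow> p = (\<Sum>b\<in>B (Suc d). case_sum mconst mvar (w b) * b) *
      (\<Sum>b\<in>B (Suc d). case_sum mconst mvar (w' b) * b)"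
    proof (cases "d < D \<and> p \<in> B d")
      case True
      then obtain x y where "x \<in> wspan (B (Suc d))" "y \<in> wspan (B (Suc d))" "p = x * y"
        using B(5) by blast
      then show ?thesis unfolding wspan_def by fast
    qed auto
  qed
  then obtain wL wR :: "nat \<Rightarrow> ('x, 'a) mpoly \<Rightarrow> ('x, 'a) mpoly \<Rightarrow> 'a + 'x" where w:
    "\<And>d p. d < D \<Longrightarrow> p \<in> B d \<Longrightarrow> p = (\<Sum>b\<in>B (Suc d). case_sum mconst mvar (wL d p b) * b) *
      (\<Sum>b\<in>B (Suc d). case_sum mconst mvar (wR d p b) * b)"
    unfolding choice_iff by blast
  define wt where "wt d s p b = case_sum mconst mvar ((if s then wL else wR) d p b)"
    for d s p b
  interpret valued_target I vl vr vp c D B wt "\<lambda>b. b" f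
  proof unfold_locales
    show "p = (\<Sum>b'\<in>B (Suc d). wt d True p b' * b') * (\<Sum>b'\<in>B (Suc d). wt d False p b' * b')"
      if "d < D" "p \<in> B d" for d p
      using w[OF that] unfolding wt_def if_True if_False .
  qed (use B(1,2) fin in auto)
  let ?G = "Gm I vl vr vp c (2 ^ D)" and ?W = "{..<(2 ^ D) ^ 6 :: nat}"
  have VH: "finite VH" "card VH \<le> card ?W"
    using card_VH[OF card] size by auto
  obtain \<iota> where \<iota>: "\<iota> ` VH \<subseteq> ?W" "inj_on \<iota> VH"
    using card_le_inj[OF VH(1) _ VH(2)] by auto
  \<comment> \<open>Edges of the complete graph outside the embedded target are switched off by the
    constant 0.\<close>
  define s where "s e = (if e \<subseteq> \<iota> ` VH then wgt (inv_into VH \<iota> ` e) else 0)" for e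
  have "s e \<in> range (case_sum mconst mvar)" for e
  proof -
    have R: "{0, 1} \<subseteq> range (case_sum mconst mvar :: 'a + 'x \<Rightarrow> _)"
      using rangeI[of "case_sum mconst mvar :: 'a + 'x \<Rightarrow> _" "Inl 0"]
        rangeI[of "case_sum mconst mvar :: 'a + 'x \<Rightarrow> _" "Inl 1"] by simp
    then show ?thesis
      unfolding s_def wgt_def Let_def using arc_range[OF R] by (auto simp: wt_def)
  qed
  then have "\<forall>e. \<exists>t. s e = case_sum mconst mvar t" by blast
  then obtain \<sigma> where \<sigma>: "\<And>e. s e = case_sum mconst mvar (\<sigma> e)" by metis
  have "msubst s (hom_poly ?G (Hm (2 ^ D))) =
      hom_sum ?G ?W (\<lambda>e. if e \<in> E (Hm (2 ^ D)) then s e else 0)"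
    unfolding V_Hm[symmetric] by (rule msubst_hom_poly) (auto simp: finite_V_Gm finite_E_Gm V_Hm)
  also have "\<dots> = hom_sum ?G VH (\<lambda>e. if \<iota> ` e \<in> E (Hm (2 ^ D)) then s (\<iota> ` e) else 0)"
    by (rule hom_sum_embed[OF \<iota>(2,1)])
      (use finite_V_Gm finite_E_Gm E_Gm_subset V_Gm_covered in \<open>auto simp: s_def\<close>)
  also have "\<dots> = hom_sum ?G VH wgt"
    unfolding hom_sum_def
  proof (intro sum.cong prod.cong refl)
    fix \<psi> e assume \<psi>: "\<psi> \<in> V ?G \<rightarrow>\<^sub>E VH" and e: "e \<in> E ?G"
    obtain a b where ab: "e = {a, b}" using e by (rule E_Gm_pair)
    have img: "\<psi> ` e \<subseteq> VH" using E_Gm_subset[OF e] \<psi> by auto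
    have "inv_into VH \<iota> ` \<iota> ` \<psi> ` e = \<psi> ` e"
      using \<iota>(2) img by (rule inv_into_image_cancel)
    then have s: "s (\<iota> ` \<psi> ` e) = wgt (\<psi> ` e)"
      using img by (simp add: s_def image_mono)
    \<comment> \<open>The complete graph has no loops, so maps that collapse an edge are missing
      from its sum; in the target they have weight 0 by \<open>arc_refl\<close>.\<close>
    show "(if \<iota> ` \<psi> ` e \<in> E (Hm (2 ^ D)) then s (\<iota> ` \<psi> ` e) else 0) = wgt (\<psi> ` e)"
    proof (cases "\<psi> a = \<psi> b")
      case True
      then have "wgt (\<psi> ` e) = 0" using wgt_pair[of "\<psi> a" "\<psi> a"] arc_refl by (simp add: ab)
      then show ?thesis using s by simp
    next
      case False
      have in_VH: "\<psi> a \<in> VH" "\<psi> b \<in> VH" using img by (auto simp: ab)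
      then have "\<iota> (\<psi> a) \<noteq> \<iota> (\<psi> b)" using \<iota>(2) False by (auto dest: inj_onD)
      moreover have "\<iota> (\<psi> a) < (2 ^ D) ^ 6" "\<iota> (\<psi> b) < (2 ^ D) ^ 6" using \<iota>(1) in_VH by auto
      ultimately have "\<iota> ` \<psi> ` e \<in> E (Hm (2 ^ D))" unfolding E_Hm ab by auto
      then show ?thesis using s by simp
    qed
  qed
  also have "\<dots> = f" by (rule hom_sum_target)
  finally have "msubst s (hom_poly ?G (Hm (2 ^ D))) = f" .
  moreover have "s = (\<lambda>x. case \<sigma> x of Inl a \<Rightarrow> mconst a | Inr y \<Rightarrow> mvar y)"
    using \<sigma> by (auto simp: fun_eq_iff)
  ultimately show ?thesis unfolding is_projection_def by blast
qed

lemma p_projection_hom_poly: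
  fixes f :: "nat \<Rightarrow> ('x, 'a::comm_ring_1) mpoly"
  assumes "in_VP f"
  shows "p_projection_on (\<lambda>m. \<exists>k. m = 2 ^ k) f (\<lambda>m. hom_poly (Gm I vl vr vp c m) (Hm m))"
proof -
  obtain q where q: "poly_bounded q" "\<And>n. mdegree (f n) \<le> q n"
    "\<And>n. \<exists>C. circ_computes C (f n) \<and> length C \<le> q n"
    using assms unfolding in_VP_on_def by blast
  \<comment> \<open>The least power of two above \<open>Q n\<close> is at most
    \<open>2 * Q n\<close>, hence still polynomially bounded; the added \<open>c + 2\<close> ensures
    \<open>c \<le> z\<close> and \<open>2 \<le> z\<close> for \<open>z = 2 ^ L n\<close>.\<close>
  define Q where "Q n = q n + c + 2" for n
  define L where "L n = (LEAST l. Q n \<le> 2 ^ l)" for n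
  have L1: "Q n \<le> 2 ^ L n" for n
    unfolding L_def by (rule LeastI[of _ "Q n"]) (simp add: less_imp_le)
  have L0: "0 < L n" for n
    using L1[of n] by (cases "L n") (auto simp: Q_def)
  have L2: "2 ^ L n \<le> 2 * Q n" for n
  proof -
    obtain l where l: "L n = Suc l" using L0[of n] by (cases "L n") auto
    then have "\<not> Q n \<le> 2 ^ l" using not_less_Least[of l "\<lambda>l. Q n \<le> 2 ^ l"] by (simp add: L_def)
    then show ?thesis by (simp add: l)
  qed
  \<comment> \<open>The tree gets \<open>30 * L n\<close> layers, generously more than the
    \<open>4 * L n + 3\<close> of the depth reduction, so that \<open>(t n) ^ 6 = z ^ 180\<close>
    vertices have room for the target.\<close>
  define t :: "nat \<Rightarrow> nat" where "t n = 2 ^ (30 * L n)" for n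
  have "poly_bounded (\<lambda>n. (2 * (q n + c + 2)) ^ 30)"
    by (intro poly_bounded_intros q(1))
  then have "poly_bounded t"
  proof (rule poly_bounded_mono)
    fix n
    have "t n = (2 ^ L n) ^ 30" by (simp add: t_def power_mult[symmetric] mult.commute)
    also have "\<dots> \<le> (2 * (q n + c + 2)) ^ 30" using L2[of n] by (intro power_mono) (auto simp: Q_def)
    finally show "t n \<le> (2 * (q n + c + 2)) ^ 30" .
  qed
  moreover have "is_projection (f n) (hom_poly (Gm I vl vr vp c (t n)) (Hm (t n)))" for n
    unfolding t_def
  proof (rule is_projection_layered)
    let ?L = "L n"
    define z :: nat where "z = 2 ^ ?L"
    have z: "2 \<le> z" "q n \<le> z" "c \<le> z" "?L < z"
      using L1[of n] by (auto simp: z_def Q_def less_exp)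
    obtain C where C: "circ_computes C (f n)" "length C \<le> q n" using q(3) by blast
    have zp: "z ^ i \<le> z ^ j" if "i \<le> j" for i j using z(1) that by (intro power_increasing) auto
    \<comment> \<open>The exponent 26 is \<open>4 * 6 + 2\<close>: at most \<open>z ^ 6\<close>
      values are available, their fourfold products number at most \<open>z ^ 24\<close>, and a
      factor \<open>z ^ 2\<close> absorbs the lower-order terms.\<close>
    show "layered (2 ^ (26 * ?L)) (30 * ?L) {f n}"
    proof (rule depth_reduction[OF C(1) q(2) order_trans[OF C(2) order_refl], of "?L"])
      show "q n < 2 ^ Suc ?L" using z(2) z(1) by (simp add: z_def)
      show "4 * ?L + 3 \<le> 30 * ?L" using L0[of n] by simp
      have "q n * q n \<le> z ^ 2" using z(2) by (simp add: power2_eq_square mult_le_mono)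
      moreover have "(q n * q n)\<^sup>2 \<le> z ^ 4"
        using power_mono[OF \<open>q n * q n \<le> z ^ 2\<close>, of 2] by (simp add: power_mult[symmetric])
      moreover have "z ^ 2 \<le> z ^ 4" "1 \<le> z ^ 4" by (rule zp, simp, rule one_le_power, use z(1) in simp)
      ultimately have "1 + q n * q n + (q n * q n)\<^sup>2 \<le> 4 * z ^ 4" by linarith
      also have "\<dots> \<le> z ^ 2 * z ^ 4" using power_mono[OF z(1), of 2] by (intro mult_le_mono1) simp
      also have "\<dots> = z ^ 6" by (simp flip: power_add)
      finally have "1 + q n * q n + (q n * q n)\<^sup>2 \<le> z ^ 6" .
      then have "(1 + q n * q n + (q n * q n)\<^sup>2) ^ 4 \<le> (z ^ 6) ^ 4" by (rule power_mono) simp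
      then have "(1 + q n * q n + (q n * q n)\<^sup>2) ^ 4 \<le> z ^ 24" by (simp flip: power_mult)
      moreover have "z ^ 1 \<le> z ^ 24" by (rule zp) simp
      ultimately have "(1 + q n * q n + (q n * q n)\<^sup>2) ^ 4 + q n + 2 \<le> 4 * z ^ 24"
        using z(1,2) by simp
      also have "\<dots> \<le> z ^ 2 * z ^ 24" using power_mono[OF z(1), of 2] by (intro mult_le_mono1) simp
      also have "\<dots> = 2 ^ (26 * ?L)" by (simp add: z_def mult.commute flip: power_add power_mult)
      finally show "(1 + q n * q n + (q n * q n)\<^sup>2) ^ 4 + q n + 2 \<le> 2 ^ (26 * ?L)" .
    qed
    show "(1::nat) \<le> 2 ^ (26 * ?L)" by simp
    \<comment> \<open>The depth is below \<open>z ^ 7\<close>, the layers have at most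
      \<open>z ^ 26\<close> nodes and \<open>c \<le> z\<close>, so the target has at most
      \<open>2 * z ^ 61\<close> vertices.\<close>
    show "(30 * ?L + 1) * (2 ^ (26 * ?L) * c) + 30 * ?L * (2 ^ (26 * ?L) * (2 * (2 ^ (26 * ?L) * c)))
        \<le> (2 ^ (30 * ?L)) ^ 6"
    proof -
      have M: "2 ^ (26 * ?L) = z ^ 26" by (simp add: z_def mult.commute flip: power_mult)
      have D: "30 * ?L + 1 \<le> z ^ 7"
      proof -
        have "30 * ?L + 1 \<le> 2 ^ 5 * z" using z(1,4) by simp
        also have "\<dots> \<le> z ^ 5 * z" by (intro mult_le_mono1 power_mono z(1)) simp
        also have "\<dots> \<le> z ^ 7" using zp[of 6 7] by (simp flip: power_Suc2)
        finally show ?thesis .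
      qed
      have "(30 * ?L + 1) * (z ^ 26 * c) \<le> z ^ 7 * (z ^ 26 * z ^ 1)"
        using D z(3) by (intro mult_le_mono) auto
      also have "\<dots> = z ^ 34" by (simp only: power_add[symmetric], simp)
      also have "\<dots> \<le> z ^ 61" by (rule zp) simp
      finally have *: "(30 * ?L + 1) * (z ^ 26 * c) \<le> z ^ 61" .
      have "30 * ?L * (z ^ 26 * (2 * (z ^ 26 * c))) \<le> z ^ 7 * (z ^ 26 * (z ^ 1 * (z ^ 26 * z ^ 1)))"
        using D z(1,3) by (intro mult_le_mono) auto
      also have "\<dots> = z ^ 61" by (simp only: power_add[symmetric], simp)
      finally have "30 * ?L * (z ^ 26 * (2 * (z ^ 26 * c))) \<le> z ^ 61" .
      with * have "(30 * ?L + 1) * (z ^ 26 * c) + 30 * ?L * (z ^ 26 * (2 * (z ^ 26 * c))) \<le> 2 * z ^ 61"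
        by simp
      also have "\<dots> \<le> z * z ^ 61" by (rule mult_le_mono1) (rule z(1))
      also have "\<dots> = z ^ 62" by (simp only: power_Suc[symmetric], simp)
      also have "\<dots> \<le> z ^ 180" by (rule zp) simp
      also have "\<dots> = (2 ^ (30 * ?L)) ^ 6" by (simp add: z_def mult.commute flip: power_mult)
      finally show ?thesis unfolding M .
    qed
  qed
  ultimately show ?thesis
    unfolding p_projection_on_def by (intro exI[of _ t]) (auto simp: t_def)
qed

end

theorem theorem4:
  fixes I :: "nat \<Rightarrow> 'v graph"
    and vl vr vp :: "nat \<Rightarrow> 'v"
    and c :: nat
  assumes graphs: "\<forall>i\<in>{0,1,2::nat}. wf_graph (I i) \<and> connected_graph (I i) \<and> rigid (I i)"
    and incomp: "\<forall>i\<in>{0,1,2::nat}. \<forall>j\<in>{0,1,2::nat}. i \<noteq> j \<longrightarrow> incomparable (I i) (I j)"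
    and cmax: "\<forall>i\<in>{0,1,2::nat}. card (V (I i)) < c"
    and v0: "vl 0 \<in> V (I 0)" "vr 0 \<in> V (I 0)" "vl 0 \<noteq> vr 0"
    and v12: "\<forall>i\<in>{1,2::nat}. vl i \<in> V (I i) \<and> vr i \<in> V (I i) \<and> vp i \<in> V (I i) \<and>
                 vl i \<noteq> vr i \<and> vl i \<noteq> vp i \<and> vr i \<noteq> vp i"
  shows "VP_complete_on (\<lambda>m. \<exists>k. m = 2 ^ k)
           (\<lambda>m. hom_poly (Gm I vl vr vp c m) (Hm m) :: (nat set, 'a::field) mpoly)"
proof -
  have "0 < c" using cmax by auto
  then interpret rigid_tree_graph I vl vr vp c
    by unfold_locales (use assms in auto)
  show ?thesis
    unfolding VP_complete_on_def
  proof (intro conjI allI impI)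
    show "in_VP_on (\<lambda>m. \<exists>k. m = 2 ^ k)
        (\<lambda>m. hom_poly (Gm I vl vr vp c m) (Hm m) :: (nat set, 'a) mpoly)"
      by (rule in_VP_hom_poly) (use cmax in auto)
  qed (rule p_projection_hom_poly)
qed

end
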